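(* Let $G$ be a group in $\mathcal{A}_0$ with standard representation $$d=\sum_{\tau\in T_0}\frac{s_\tau}{m_\tau}e_0^{(\tau)},$$ where $T_0=T_0(G)$ and $\{e_0^{(\tau)}\mid\tau\in T_0\}$ is an $rc$-basis of $G$, and let $s=(s_\tau\overline{1_\tau})_{\tau\in T_1}\in S^*$, where $T_1=T_1(G)$ (so $T_1=T_0$ when $G$ is rigid). Then $G\cong\mathrm{Mult}\,G$ if and only if $G$ is a rigid group and $s^2\in\Gamma V_\infty$.
   Context: All groups are additively written Abelian groups. $\mathrm{Mult}\,G=\mathrm{Hom}(G\otimes G,G)$ is the additive group of all multiplications on $G$. A torsion-free group $G$ of finite rank is almost completely decomposable (ACD) if it contains a completely decomposable subgroup (a direct sum of rank-1 groups) of finite index. Its regulator $\mathrm{Reg}\,G$ is the intersection of all its completely decomposable subgroups of least index; it is a completely decomposable, fully invariant subgroup of finite index. For a type $\tau$, $\mathrm{Reg}_\tau G$ denotes the sum of the rank-1 direct summands of type $\tau$ in a given decomposition of $\mathrm{Reg}\,G$ into rank-1 summands, and $T(G)=\{\tau\mid \mathrm{Reg}_\tau G\neq0\}$. $G$ is block-rigid if the types in $T(G)$ are pairwise incomparable (then the $\mathrm{Reg}_\tau G$ are uniquely determined); it is rigid if moreover each $\mathrm{Reg}_\tau G$ ($\tau\in T(G)$) has rank 1. $G$ is of ring type if all types in $T(G)$ are idempotent. $\mathcal{A}_0$ is the class of block-rigid ACD groups of ring type with cyclic quotient $G/\mathrm{Reg}\,G$. Let $G\in\mathcal{A}_0$,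 $A=\mathrm{Reg}\,G$, $A_\tau=\mathrm{Reg}_\tau G$, and let $n=|G/A|$. The divisible hull is $\tilde G=\tilde A=\bigoplus_{\tau\in T(G)}\tilde A_\tau$ with projections $\pi_\tau:\tilde G\to\tilde A_\tau$. If $G/A=\langle d+A\rangle$, then $m_\tau=m_\tau(G)$ is the order of $\pi_\tau(d)+A$ in $\tilde A/A$ (independent of $d$). Put $T_0(G)=\{\tau\in T(G)\mid m_\tau>1\}$ and $T_1(G)=\{\tau\in T(G)\mid m_\tau>1,\ r(A_\tau)=1\}$, where $r$ denotes rank. For $\tau\in T(G)$, $P_\infty(\tau)=\{p\text{ prime}\mid\tau(p)=\infty\}$, $P_0(\tau)$ is the set of all other primes, and $R_\tau$ is the unital subring of $\mathbb{Q}$ whose additive group has type $\tau$. For a set $P_1$ of primes, a $P_1$-number is a nonzero integer all of whose prime divisors lie in $P_1$ (so $1$ is always a $P_1$-number). There is a decomposition $G=G_1\oplus C$ (fixed; a main decomposition), with $C$ block-rigid completely decomposable and $G_1$ a rigid ACD group with cyclic regulator quotient such that $T(G_1)=T_0(G)$ and $m_\tau(G_1)=m_\tau(G)$ for $\tau\in T_0(G)$. Put $B=\mathrm{Reg}\,G_1$. An $rc$-basis of $G$ is a system $E_0=\{e_0^{(\tau)}\in\mathrm{Reg}_\tau G_1\mid\tau\in T_0(G)\}$ with $B=\bigoplus_{\tau\in T_0(G)}R_\tau e_0^{(\tau)}$ for which there is $d\in G_1$ with $G/A=\langle d+A\rangle$ and $d=\sum_{\tau\in T_0(G)}\frac{s_\tau}{m_\tau}e_0^{(\tau)}$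 in $\tilde G_1$, where, for all $\tau\in T_0(G)$, $s_\tau$ and $m_\tau$ are $P_0(\tau)$-numbers and $\gcd(s_\tau,m_\tau)=1$. Such an equality is called a standard representation of $G$. Let $S=\prod_{\tau\in T_1}\mathbb{Z}/m_\tau\mathbb{Z}$ (product of rings), $\overline{1_\tau}=1+m_\tau\mathbb{Z}$, and let $S^*$ be the unit group of $S$. Define subgroups of $S^*$: $$\Gamma=\{(\alpha\overline{1_\tau})_{\tau\in T_1}(\beta\overline{1_\tau})_{\tau\in T_1}^{-1}\mid\alpha,\beta\in\mathbb{Z},\ \gcd(\alpha,n)=\gcd(\beta,n)=1\},$$ $$V_\infty=\{(x_\tau\overline{1_\tau})_{\tau\in T_1}(y_\tau\overline{1_\tau})_{\tau\in T_1}^{-1}\mid x_\tau,y_\tau\text{ are }P_\infty(\tau)\text{-numbers for all }\tau\in T_1\}.$$ (Each $m_\tau$ is a $P_0(\tau)$-number, so these are well defined.) *)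

theory Defs
  imports
    "HOL-Library.Extended_Nat"
    "HOL-Algebra.Free_Abelian_Groups"
    "HOL-Algebra.Multiplicative_Group"
    "HOL-Number_Theory.Residues"
begin

(* Abelian groups are subsets of a type of class ab_group_add that are closed under the group
   operations (a whole type is the special case UNIV).  The record add_group H makes the notions
   of HOL-Algebra (quotients, orders, isomorphism) available for them. *)

definition add_group :: "'a::ab_group_add set \<Rightarrow> 'a monoid" where
  "add_group H = \<lparr>carrier = H, monoid.mult = (+), one = 0\<rparr>"

abbreviation add_subgroup :: "'a::ab_group_add set \<Rightarrow> bool" where
  "add_subgroup H \<equiv> subgroup H (add_group UNIV)"

definition zmul :: "int \<Rightarrow> 'a::ab_group_add \<Rightarrow> 'a" where
  "zmul k x = x [^]\<^bsub>add_group UNIV\<^esub> k"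

definition torsion_free :: "'a::ab_group_add set \<Rightarrow> bool" where
  "torsion_free H \<longleftrightarrow> (\<forall>x\<in>H. \<forall>k. k \<noteq> 0 \<and> zmul k x = 0 \<longrightarrow> x = 0)"

lemma comm_group_add_group_UNIV: "comm_group (add_group (UNIV :: 'a::ab_group_add set))"
proof -
  have "\<exists>y. y + x = 0" for x :: 'a
    by (rule exI[of _ "- x"]) simp
  then show ?thesis
    by (intro comm_groupI) (auto simp: add_group_def algebra_simps)
qed

lemma
  fixes x y :: "'a::ab_group_add"
  shows zmul_add_left: "zmul (i + j) x = zmul i x + zmul j x"
  and zmul_zmul: "zmul i (zmul j x) = zmul (i * j) x"
  and zmul_add_right: "zmul i (x + y) = zmul i x + zmul i y"
  and zmul_one [simp]: "zmul 1 x = x"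
  and zmul_zero_right [simp]: "zmul i (0 :: 'a) = 0"
  and zmul_zero_left [simp]: "zmul 0 x = 0"
proof -
  interpret comm_group "add_group (UNIV :: 'a set)"
    by (rule comm_group_add_group_UNIV)
  show "zmul (i + j) x = zmul i x + zmul j x"
    using int_pow_mult[of x i j] by (simp add: zmul_def add_group_def)
  show "zmul i (zmul j x) = zmul (i * j) x"
    using int_pow_pow[of x j i] by (simp add: zmul_def add_group_def mult.commute)
  show "zmul i (x + y) = zmul i x + zmul i y"
    using int_pow_distrib[of x y i] by (simp add: zmul_def add_group_def)
  show "zmul 1 x = x"
    using int_pow_1[of x] by (simp add: zmul_def add_group_def)
  show "zmul i (0 :: 'a) = 0"
    using int_pow_one[of i] by (simp add: zmul_def add_group_def)
  show "zmul 0 x = 0"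
    by (simp add: zmul_def add_group_def int_pow_def2)
qed

lemma zmul_minus_right: "zmul i (- x) = - zmul i x"
  using zmul_add_right[of i x "- x"] by (simp add: minus_unique)

(* The divisible hull of the group carried by 'a modulo its torsion: fractions x/m with m a nonzero
   integer, a vector space over the rationals.  The canonical map to_hull is injective on every
   torsion-free subgroup. *)

definition hull_rel :: "'a::ab_group_add \<times> int \<Rightarrow> 'a \<times> int \<Rightarrow> bool" where
  "hull_rel = (\<lambda>(x, m) (y, n).
     m \<noteq> 0 \<and> n \<noteq> 0 \<and> (\<exists>k. k \<noteq> 0 \<and> zmul (k * n) x = zmul (k * m) y))"

lemma hull_relI:
  "m \<noteq> 0 \<Longrightarrow> n \<noteq> 0 \<Longrightarrow> zmul n x = zmul m y \<Longrightarrow> hull_rel (x, m) (y, n)"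
  unfolding hull_rel_def by (auto intro!: exI[of _ 1])

lemma part_equivp_hull_rel: "part_equivp (hull_rel :: 'a::ab_group_add \<times> int \<Rightarrow> _)"
proof (rule part_equivpI)
  show "\<exists>x :: 'a \<times> int. hull_rel x x"
    by (rule exI[of _ "(0, 1)"]) (rule hull_relI; simp)
  show "symp (hull_rel :: 'a \<times> int \<Rightarrow> _)"
    by (rule sympI) (force simp: hull_rel_def)
  show "transp (hull_rel :: 'a \<times> int \<Rightarrow> _)"
  proof (rule transpI)
    fix p q r :: "'a \<times> int"
    assume pq: "hull_rel p q" and qr: "hull_rel q r"
    obtain x l where p: "p = (x, l)" by (cases p)
    obtain y m where q: "q = (y, m)" by (cases q)
    obtain z n where r: "r = (z, n)" by (cases r)
    from pq obtain i where i: "i \<noteq> 0" "zmul (i * m) x = zmul (i * l) y" and nz: "l \<noteq> 0" "m \<noteq> 0"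
      by (auto simp: hull_rel_def p q)
    from qr obtain j where j: "j \<noteq> 0" "zmul (j * n) y = zmul (j * m) z" and nz': "n \<noteq> 0"
      by (auto simp: hull_rel_def q r)
    have "zmul ((i * j * m) * n) x = zmul (j * n) (zmul (i * m) x)"
      by (simp add: zmul_zmul ac_simps)
    also have "\<dots> = zmul (i * l) (zmul (j * n) y)"
      by (simp add: i zmul_zmul ac_simps)
    also have "\<dots> = zmul ((i * j * m) * l) z"
      by (simp add: j zmul_zmul ac_simps)
    finally show "hull_rel p r"
      unfolding p r hull_rel_def using i j nz nz'
      by (auto intro!: exI[of _ "i * j * m"])
  qed
qed

quotient_type (overloaded) 'a div_hull = "'a::ab_group_add \<times> int" / partial: hull_rel
  by (rule part_equivp_hull_rel)

instantiation div_hull :: (ab_group_add) ab_group_add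
begin

lift_definition zero_div_hull :: "'a div_hull" is "(0, 1)"
  by (rule hull_relI; simp)

lift_definition plus_div_hull :: "'a div_hull \<Rightarrow> 'a div_hull \<Rightarrow> 'a div_hull"
  is "\<lambda>(x, m) (y, n). (zmul n x + zmul m y, m * n)"
proof (clarify)
  fix x x' y y' :: 'a and m m' n n' :: int
  assume "hull_rel (x, m) (x', m')" "hull_rel (y, n) (y', n')"
  then obtain i j where i: "i \<noteq> 0" "zmul (i * m') x = zmul (i * m) x'"
    and j: "j \<noteq> 0" "zmul (j * n') y = zmul (j * n) y'"
    and nz: "m \<noteq> 0" "m' \<noteq> 0" "n \<noteq> 0" "n' \<noteq> 0"
    by (auto simp: hull_rel_def)
  have "zmul (i * j * (m' * n')) (zmul n x + zmul m y)
      = zmul (j * n' * n) (zmul (i * m') x) + zmul (i * m' * m) (zmul (j * n') y)"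
    by (simp add: zmul_zmul zmul_add_right ac_simps)
  also have "\<dots> = zmul (j * n' * n) (zmul (i * m) x') + zmul (i * m' * m) (zmul (j * n) y')"
    by (simp add: i j)
  also have "\<dots> = zmul (i * j * (m * n)) (zmul n' x' + zmul m' y')"
    by (simp add: zmul_zmul zmul_add_right ac_simps)
  finally show "hull_rel (zmul n x + zmul m y, m * n) (zmul n' x' + zmul m' y', m' * n')"
    unfolding hull_rel_def using i j nz by (auto intro!: exI[of _ "i * j"])
qed

lift_definition uminus_div_hull :: "'a div_hull \<Rightarrow> 'a div_hull"
  is "\<lambda>(x, m). (- x, m)"
  by (force simp: hull_rel_def zmul_minus_right)

definition minus_div_hull :: "'a div_hull \<Rightarrow> 'a div_hull \<Rightarrow> 'a div_hull" where
  "minus_div_hull x y = x + - y"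

instance
proof
  fix a b c :: "'a div_hull"
  show "a + b + c = a + (b + c)"
    by transfer (auto intro!: hull_relI simp: hull_rel_def zmul_zmul zmul_add_right ac_simps)
  show "a + b = b + a"
    by transfer (auto intro!: hull_relI simp: hull_rel_def zmul_zmul zmul_add_right ac_simps)
  show "0 + a = a"
    by transfer (auto intro!: hull_relI simp: hull_rel_def)
  show "- a + a = 0"
    by transfer (auto intro!: hull_relI simp: hull_rel_def zmul_minus_right)
  show "a - b = a + - b"
    by (rule minus_div_hull_def)
qed

end

lift_definition to_hull :: "'a::ab_group_add \<Rightarrow> 'a div_hull" is "\<lambda>x. (x, 1)"
  by (rule hull_relI; simp)

lift_definition hull_scale :: "rat \<Rightarrow> 'a::ab_group_add div_hull \<Rightarrow> 'a div_hull"
  is "\<lambda>q (x, m). (zmul (fst (quotient_of q)) x, snd (quotient_of q) * m)"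
proof (clarify)
  fix q :: rat and x x' :: 'a and m m' :: int
  assume "hull_rel (x, m) (x', m')"
  then obtain i where i: "i \<noteq> 0" "zmul (i * m') x = zmul (i * m) x'"
    and nz: "m \<noteq> 0" "m' \<noteq> 0"
    by (auto simp: hull_rel_def)
  obtain a b where ab: "quotient_of q = (a, b)" by fastforce
  then have "b \<noteq> 0" using quotient_of_denom_pos by fastforce
  have "zmul (i * (b * m')) (zmul a x) = zmul (a * b) (zmul (i * m') x)"
    by (simp add: zmul_zmul ac_simps)
  also have "\<dots> = zmul (i * (b * m)) (zmul a x')"
    by (simp add: i zmul_zmul ac_simps)
  finally show "hull_rel (zmul (fst (quotient_of q)) x, snd (quotient_of q) * m)
      (zmul (fst (quotient_of q)) x', snd (quotient_of q) * m')"
    unfolding hull_rel_def using i nz \<open>b \<noteq> 0\<close> by (auto simp: ab)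
qed

lemma quotient_of_cross:
  assumes "quotient_of p = (a, b)" "quotient_of q = (a', b')" "quotient_of r = (c, d)"
  shows "b > 0" "b' > 0" "d > 0"
    and "r = p + q \<Longrightarrow> c * (b * b') = d * (a * b' + a' * b)"
    and "r = p * q \<Longrightarrow> c * (b * b') = d * (a * a')"
proof -
  show pos: "b > 0" "b' > 0" "d > 0"
    using assms quotient_of_denom_pos by auto
  have q: "p = of_int a / of_int b" "q = of_int a' / of_int b'" "r = of_int c / of_int d"
    using assms quotient_of_div by auto
  show "c * (b * b') = d * (a * b' + a' * b)" if "r = p + q"
  proof -
    have "(of_int c :: rat) * (of_int b * of_int b')
        = of_int d * (of_int a * of_int b' + of_int a' * of_int b)"
      using that pos unfolding q by (simp add: field_simps)
    then have "(of_int (c * (b * b')) :: rat) = of_int (d * (a * b' + a' * b))"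
      by simp
    then show ?thesis by (simp only: of_int_eq_iff)
  qed
  show "c * (b * b') = d * (a * a')" if "r = p * q"
  proof -
    have "(of_int c :: rat) * (of_int b * of_int b') = of_int d * (of_int a * of_int a')"
      using that pos unfolding q by (simp add: field_simps)
    then have "(of_int (c * (b * b')) :: rat) = of_int (d * (a * a'))"
      by simp
    then show ?thesis by (simp only: of_int_eq_iff)
  qed
qed

interpretation hull: vector_space "hull_scale :: rat \<Rightarrow> 'a::ab_group_add div_hull \<Rightarrow> _"
proof
  fix p q :: rat and u v :: "'a div_hull"
  obtain a b where p: "quotient_of p = (a, b)" by fastforce
  obtain a' b' where q: "quotient_of q = (a', b')" by fastforce
  show "hull_scale p (u + v) = hull_scale p u + hull_scale p v"
    using quotient_of_cross(1)[OF p p p] p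
    by transfer (auto intro!: hull_relI simp: hull_rel_def zmul_zmul zmul_add_right ac_simps)
  show "hull_scale (p + q) u = hull_scale p u + hull_scale q u"
  proof -
    obtain c d where r: "quotient_of (p + q) = (c, d)" by fastforce
    have pos: "b \<noteq> 0" "b' \<noteq> 0" "d \<noteq> 0" and eq: "c * (b * b') = d * (a * b' + a' * b)"
      using quotient_of_cross[OF p q r] by auto
    have "hull_rel (zmul c x, d * m) (zmul (b' * m) (zmul a x) + zmul (b * m) (zmul a' x), b * m * (b' * m))"
      if "m \<noteq> 0" for x :: 'a and m
    proof (rule hull_relI)
      have "b * m * (b' * m) * c = m * m * (c * (b * b'))" by (simp add: ac_simps)
      also have "\<dots> = d * m * (b' * m * a) + d * m * (b * m * a')"
        unfolding eq by (simp add: algebra_simps)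
      finally show "zmul (b * m * (b' * m)) (zmul c x)
          = zmul (d * m) (zmul (b' * m) (zmul a x) + zmul (b * m) (zmul a' x))"
        by (simp only: zmul_zmul zmul_add_right zmul_add_left mult.assoc)
    qed (use pos that in auto)
    then show ?thesis
      using p q r by transfer (auto simp: hull_rel_def)
  qed
  show "hull_scale p (hull_scale q u) = hull_scale (p * q) u"
  proof -
    obtain c d where r: "quotient_of (p * q) = (c, d)" by fastforce
    have pos: "b \<noteq> 0" "b' \<noteq> 0" "d \<noteq> 0" and eq: "c * (b * b') = d * (a * a')"
      using quotient_of_cross[OF p q r] by auto
    have "hull_rel (zmul a (zmul a' x), b * (b' * m)) (zmul c x, d * m)"
      if "m \<noteq> 0" for x :: 'a and m
    proof (rule hull_relI)
      have "b * (b' * m) * c = m * (c * (b * b'))" by (simp add: ac_simps)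
      also have "\<dots> = d * m * (a * a')" unfolding eq by (simp add: ac_simps)
      finally show "zmul (d * m) (zmul a (zmul a' x)) = zmul (b * (b' * m)) (zmul c x)"
        by (simp only: zmul_zmul mult.assoc)
    qed (use pos that in auto)
    then show ?thesis
      using p q r by transfer (auto simp: hull_rel_def)
  qed
  show "hull_scale 1 u = u"
    by transfer (auto intro!: hull_relI simp: hull_rel_def)
qed

lemma inj_on_to_hull:
  assumes "add_subgroup H" "torsion_free H"
  shows "inj_on to_hull H"
proof (rule inj_onI)
  fix x y assume xy: "x \<in> H" "y \<in> H" "to_hull x = to_hull y"
  from xy(3) obtain k where k: "k \<noteq> 0" "zmul k x = zmul k y"
    by transfer (auto simp: hull_rel_def)
  interpret comm_group "add_group (UNIV :: 'a set)"
    by (rule comm_group_add_group_UNIV)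
  have "inv\<^bsub>add_group UNIV\<^esub> y = - y"
    by (rule inv_equality) (auto simp: add_group_def)
  then have "x + - y \<in> H"
    using subgroup.m_closed[OF assms(1) xy(1) subgroup.m_inv_closed[OF assms(1) xy(2)]]
    by (simp add: add_group_def)
  moreover have "zmul k (x + - y) = 0"
    by (simp add: zmul_add_right zmul_minus_right k del: add_uminus_conv_diff)
  ultimately have "x + - y = 0"
    using assms(2) k(1) unfolding torsion_free_def by blast
  then show "x = y" by simp
qed

definition hull_of :: "'a::ab_group_add set \<Rightarrow> 'a div_hull set" where
  "hull_of H = hull.span (to_hull ` H)"

definition rank :: "'a::ab_group_add set \<Rightarrow> nat" where
  "rank H = hull.dim (to_hull ` H)"

(* hull.dim is 0 on infinite-dimensional sets, hence a separate predicate. *)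
definition finite_rank :: "'a::ab_group_add set \<Rightarrow> bool" where
  "finite_rank H \<longleftrightarrow> (\<exists>B. finite B \<and> to_hull ` H \<subseteq> hull.span B)"

definition internal_dsum :: "'a::ab_group_add set \<Rightarrow> 'i set \<Rightarrow> ('i \<Rightarrow> 'a set) \<Rightarrow> bool" where
  "internal_dsum A I X \<longleftrightarrow> finite I \<and> (\<forall>i\<in>I. add_subgroup (X i)) \<and>
     bij_betw (\<lambda>x. \<Sum>i\<in>I. x i) (\<Pi>\<^sub>E i\<in>I. X i) A"

definition internal_dsum2 :: "'a::ab_group_add set \<Rightarrow> 'a set \<Rightarrow> 'a set \<Rightarrow> bool" where
  "internal_dsum2 A X Y \<longleftrightarrow> add_subgroup X \<and> add_subgroup Y \<and>
     bij_betw (\<lambda>(x, y). x + y) (X \<times> Y) A"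

definition rank_one :: "'a::ab_group_add set \<Rightarrow> bool" where
  "rank_one X \<longleftrightarrow> add_subgroup X \<and> torsion_free X \<and> rank X = 1"

(* A type is a class of equivalent characteristics; only the values at primes matter. *)
type_synonym gtype = "(nat \<Rightarrow> enat) set"

definition height :: "'a::ab_group_add set \<Rightarrow> 'a \<Rightarrow> nat \<Rightarrow> enat" where
  "height H x p = Sup {enat k | k. \<exists>y\<in>H. zmul (int (p ^ k)) y = x}"

definition char_equiv :: "(nat \<Rightarrow> enat) \<Rightarrow> (nat \<Rightarrow> enat) \<Rightarrow> bool" where
  "char_equiv \<chi> \<psi> \<longleftrightarrow> finite {p. prime p \<and> \<chi> p \<noteq> \<psi> p} \<and>
     (\<forall>p. prime p \<and> \<chi> p \<noteq> \<psi> p \<longrightarrow> \<chi> p \<noteq> \<infinity> \<and> \<psi> p \<noteq> \<infinity>)"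

(* Meant for groups of rank 1, where the heights of all nonzero elements are equivalent. *)
definition type_of :: "'a::ab_group_add set \<Rightarrow> gtype" where
  "type_of X = {\<chi>. \<exists>x\<in>X. x \<noteq> 0 \<and> char_equiv \<chi> (height X x)}"

definition type_le :: "gtype \<Rightarrow> gtype \<Rightarrow> bool" where
  "type_le \<sigma> \<tau> \<longleftrightarrow> (\<exists>\<chi>\<in>\<sigma>. \<exists>\<psi>\<in>\<tau>. \<forall>p. prime p \<longrightarrow> \<chi> p \<le> \<psi> p)"

definition type_mult :: "gtype \<Rightarrow> gtype \<Rightarrow> gtype" where
  "type_mult \<sigma> \<tau> = {\<rho>. \<exists>\<chi>\<in>\<sigma>. \<exists>\<psi>\<in>\<tau>. char_equiv \<rho> (\<lambda>p. \<chi> p + \<psi> p)}"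

definition idempotent_type :: "gtype \<Rightarrow> bool" where
  "idempotent_type \<tau> \<longleftrightarrow> type_mult \<tau> \<tau> = \<tau>"

definition P_inf :: "gtype \<Rightarrow> nat set" where
  "P_inf \<tau> = {p. prime p \<and> (\<exists>\<chi>\<in>\<tau>. \<chi> p = \<infinity>)}"

definition P_zero :: "gtype \<Rightarrow> nat set" where
  "P_zero \<tau> = {p. prime p} - P_inf \<tau>"

definition P_number :: "nat set \<Rightarrow> int \<Rightarrow> bool" where
  "P_number P k \<longleftrightarrow> k \<noteq> 0 \<and> (\<forall>p. prime p \<and> int p dvd k \<longrightarrow> p \<in> P)"

(* For idempotent \<tau> there is exactly one such subring of the rationals. *)
definition R_ring :: "gtype \<Rightarrow> rat set" where
  "R_ring \<tau> = (THE R. 1 \<in> R \<and> (\<forall>x\<in>R. \<forall>y\<in>R. x - y \<in> R \<and> x * y \<in> R) \<and> type_of R = \<tau>)"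

definition rank1_decomp :: "'a::ab_group_add set \<Rightarrow> 'a set set \<Rightarrow> bool" where
  "rank1_decomp A D \<longleftrightarrow> internal_dsum A D (\<lambda>X. X) \<and> (\<forall>X\<in>D. rank_one X)"

definition completely_decomposable :: "'a::ab_group_add set \<Rightarrow> bool" where
  "completely_decomposable A \<longleftrightarrow> (\<exists>D. rank1_decomp A D)"

definition quot :: "'a::ab_group_add set \<Rightarrow> 'a set \<Rightarrow> 'a set monoid" where
  "quot G A = add_group G Mod A"

definition coset :: "'a::ab_group_add set \<Rightarrow> 'a set \<Rightarrow> 'a \<Rightarrow> 'a set" where
  "coset G A x = A #>\<^bsub>add_group G\<^esub> x"

definition cd_finite_index :: "'a::ab_group_add set \<Rightarrow> 'a set \<Rightarrow> bool" where
  "cd_finite_index G A \<longleftrightarrow> add_subgroup A \<and> A \<subseteq> G \<and> completely_decomposable A \<and>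
     finite (carrier (quot G A))"

definition acd :: "'a::ab_group_add set \<Rightarrow> bool" where
  "acd G \<longleftrightarrow> add_subgroup G \<and> torsion_free G \<and> finite_rank G \<and> (\<exists>A. cd_finite_index G A)"

definition Reg :: "'a::ab_group_add set \<Rightarrow> 'a set" where
  "Reg G = \<Inter>{A. cd_finite_index G A \<and>
                (\<forall>B. cd_finite_index G B \<longrightarrow> order (quot G A) \<le> order (quot G B))}"

definition given_decomp :: "'a::ab_group_add set \<Rightarrow> 'a set set" where
  "given_decomp G = (SOME D. rank1_decomp (Reg G) D)"

definition Reg_at :: "'a::ab_group_add set \<Rightarrow> gtype \<Rightarrow> 'a set" where
  "Reg_at G \<tau> = {(\<Sum>X | X \<in> given_decomp G \<and> type_of X = \<tau>. f X) | f.
                  \<forall>X\<in>given_decomp G. f X \<in> X}"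

definition T_of :: "'a::ab_group_add set \<Rightarrow> gtype set" where
  "T_of G = {\<tau>. Reg_at G \<tau> \<noteq> {0}}"

definition block_rigid :: "'a::ab_group_add set \<Rightarrow> bool" where
  "block_rigid G \<longleftrightarrow> acd G \<and>
     (\<forall>\<sigma>\<in>T_of G. \<forall>\<tau>\<in>T_of G. \<sigma> \<noteq> \<tau> \<longrightarrow> \<not> type_le \<sigma> \<tau> \<and> \<not> type_le \<tau> \<sigma>)"

definition rigid :: "'a::ab_group_add set \<Rightarrow> bool" where
  "rigid G \<longleftrightarrow> block_rigid G \<and> (\<forall>\<tau>\<in>T_of G. rank (Reg_at G \<tau>) = 1)"

definition ring_type :: "'a::ab_group_add set \<Rightarrow> bool" where
  "ring_type G \<longleftrightarrow> (\<forall>\<tau>\<in>T_of G. idempotent_type \<tau>)"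

definition class_A0 :: "'a::ab_group_add set \<Rightarrow> bool" where
  "class_A0 G \<longleftrightarrow> block_rigid G \<and> ring_type G \<and> cyclic_group (quot G (Reg G))"

definition generates_quot :: "'a::ab_group_add set \<Rightarrow> 'a \<Rightarrow> bool" where
  "generates_quot G d \<longleftrightarrow> d \<in> G \<and>
     subgroup_generated (quot G (Reg G)) {coset G (Reg G) d} = quot G (Reg G)"

definition hull_proj :: "'a::ab_group_add set \<Rightarrow> gtype \<Rightarrow> 'a div_hull \<Rightarrow> 'a div_hull" where
  "hull_proj G \<tau> x =
     (THE y. y \<in> (\<Pi>\<^sub>E \<sigma>\<in>T_of G. hull_of (Reg_at G \<sigma>)) \<and> (\<Sum>\<sigma>\<in>T_of G. y \<sigma>) = x) \<tau>"

definition m_of :: "'a::ab_group_add set \<Rightarrow> gtype \<Rightarrow> nat" where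
  "m_of G \<tau> = (let d = (SOME d. generates_quot G d); A = to_hull ` Reg G in
     group.ord (quot (hull_of G) A) (coset (hull_of G) A (hull_proj G \<tau> (to_hull d))))"

definition T0 :: "'a::ab_group_add set \<Rightarrow> gtype set" where
  "T0 G = {\<tau> \<in> T_of G. m_of G \<tau> > 1}"

definition T1 :: "'a::ab_group_add set \<Rightarrow> gtype set" where
  "T1 G = {\<tau> \<in> T_of G. m_of G \<tau> > 1 \<and> rank (Reg_at G \<tau>) = 1}"

definition main_decomp :: "'a::ab_group_add set \<Rightarrow> 'a set \<Rightarrow> 'a set \<Rightarrow> bool" where
  "main_decomp G G1 C \<longleftrightarrow> internal_dsum2 G G1 C \<and>
     block_rigid C \<and> completely_decomposable C \<and>
     rigid G1 \<and> cyclic_group (quot G1 (Reg G1)) \<and>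
     T_of G1 = T0 G \<and> (\<forall>\<tau>\<in>T0 G. m_of G1 \<tau> = m_of G \<tau>)"

definition std_repr ::
  "'a::ab_group_add set \<Rightarrow> 'a set \<Rightarrow> (gtype \<Rightarrow> 'a) \<Rightarrow> 'a \<Rightarrow> (gtype \<Rightarrow> int) \<Rightarrow> bool" where
  "std_repr G G1 e d s \<longleftrightarrow> d \<in> G1 \<and> generates_quot G d \<and>
     to_hull d = (\<Sum>\<tau>\<in>T0 G. hull_scale (of_int (s \<tau>) / of_nat (m_of G \<tau>)) (to_hull (e \<tau>))) \<and>
     (\<forall>\<tau>\<in>T0 G. P_number (P_zero \<tau>) (s \<tau>) \<and> P_number (P_zero \<tau>) (int (m_of G \<tau>)) \<and>
                coprime (s \<tau>) (int (m_of G \<tau>)))"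

definition rc_basis :: "'a::ab_group_add set \<Rightarrow> 'a set \<Rightarrow> (gtype \<Rightarrow> 'a) \<Rightarrow> bool" where
  "rc_basis G G1 e \<longleftrightarrow> (\<forall>\<tau>\<in>T0 G. e \<tau> \<in> Reg_at G1 \<tau>) \<and>
     internal_dsum (to_hull ` Reg G1) (T0 G)
       (\<lambda>\<tau>. {hull_scale r (to_hull (e \<tau>)) | r. r \<in> R_ring \<tau>}) \<and>
     (\<exists>d s. std_repr G G1 e d s)"

definition product_ring :: "'i set \<Rightarrow> ('i \<Rightarrow> 'b ring) \<Rightarrow> ('i \<Rightarrow> 'b) ring" where
  "product_ring I R =
     \<lparr>carrier = (\<Pi>\<^sub>E i\<in>I. carrier (R i)),
      monoid.mult = (\<lambda>x y. \<lambda>i\<in>I. x i \<otimes>\<^bsub>R i\<^esub> y i), one = (\<lambda>i\<in>I. \<one>\<^bsub>R i\<^esub>),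
      zero = (\<lambda>i\<in>I. \<zero>\<^bsub>R i\<^esub>), add = (\<lambda>x y. \<lambda>i\<in>I. x i \<oplus>\<^bsub>R i\<^esub> y i)\<rparr>"

definition S_ring :: "'a::ab_group_add set \<Rightarrow> (gtype \<Rightarrow> int) ring" where
  "S_ring G = product_ring (T1 G) (\<lambda>\<tau>. residue_ring (int (m_of G \<tau>)))"

definition S_units :: "'a::ab_group_add set \<Rightarrow> (gtype \<Rightarrow> int) monoid" where
  "S_units G = units_of (S_ring G)"

(* The family of the a(\<tau>) times the residue class of 1, in the representation of
   residue_ring m by {0..m-1}. *)
definition S_elem :: "'a::ab_group_add set \<Rightarrow> (gtype \<Rightarrow> int) \<Rightarrow> gtype \<Rightarrow> int" where
  "S_elem G a = (\<lambda>\<tau>\<in>T1 G. a \<tau> mod int (m_of G \<tau>))"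

definition Gamma :: "'a::ab_group_add set \<Rightarrow> (gtype \<Rightarrow> int) set" where
  "Gamma G = {S_elem G (\<lambda>_. \<alpha>) \<otimes>\<^bsub>S_units G\<^esub> inv\<^bsub>S_units G\<^esub> (S_elem G (\<lambda>_. \<beta>)) | \<alpha> \<beta>.
      coprime \<alpha> (int (order (quot G (Reg G)))) \<and> coprime \<beta> (int (order (quot G (Reg G))))}"

definition V_inf :: "'a::ab_group_add set \<Rightarrow> (gtype \<Rightarrow> int) set" where
  "V_inf G = {S_elem G x \<otimes>\<^bsub>S_units G\<^esub> inv\<^bsub>S_units G\<^esub> (S_elem G y) | x y.
      \<forall>\<tau>\<in>T1 G. P_number (P_inf \<tau>) (x \<tau>) \<and> P_number (P_inf \<tau>) (y \<tau>)}"

definition tensor_relators ::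
  "'a::ab_group_add set \<Rightarrow> 'b::ab_group_add set \<Rightarrow> ('a \<times> 'b \<Rightarrow>\<^sub>0 int) set" where
  "tensor_relators A B =
     {frag_of (x + x', y) - frag_of (x, y) - frag_of (x', y) | x x' y. x \<in> A \<and> x' \<in> A \<and> y \<in> B} \<union>
     {frag_of (x, y + y') - frag_of (x, y) - frag_of (x, y') | x y y'. x \<in> A \<and> y \<in> B \<and> y' \<in> B}"

definition tensor ::
  "'a::ab_group_add set \<Rightarrow> 'b::ab_group_add set \<Rightarrow> ('a \<times> 'b \<Rightarrow>\<^sub>0 int) set monoid" where
  "tensor A B = free_Abelian_group (A \<times> B) Mod
     generate (free_Abelian_group (A \<times> B)) (tensor_relators A B)"

definition Hom :: "('a, 'c) monoid_scheme \<Rightarrow> ('b, 'd) monoid_scheme \<Rightarrow> ('a \<Rightarrow> 'b) monoid" where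
  "Hom K H = \<lparr>carrier = hom K H \<inter> extensional (carrier K),
              monoid.mult = (\<lambda>f g. \<lambda>x\<in>carrier K. f x \<otimes>\<^bsub>H\<^esub> g x),
              one = (\<lambda>x\<in>carrier K. \<one>\<^bsub>H\<^esub>)\<rparr>"

definition Mult :: "'a::ab_group_add set \<Rightarrow> (('a \<times> 'a \<Rightarrow>\<^sub>0 int) set \<Rightarrow> 'a) monoid" where
  "Mult G = Hom (tensor G G) (add_group G)"

end

theory Submission
  imports Defs "HOL-Library.Function_Algebras"
begin

text \<open>
  In a rational basis adapted to a decomposition of the regulator, \<open>G\<close> becomes a group \<open>K\<close> of
  rational vectors between \<open>\<Prod> R\<^sub>\<tau>\<close> and \<open>(1/n) \<Prod> R\<^sub>\<tau>\<close>, and \<open>Mult G\<close> becomes the group of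
  bilinear maps \<open>K \<times> K \<rightarrow> K\<close>. If two coordinates have the same type, there are more independent
  bilinear maps than coordinates, so \<open>G \<cong> Mult G\<close> forces \<open>G\<close> to be rigid.

  In the rigid case divisibility by the primes of \<open>P\<^sub>\<infinity>(\<tau>)\<close>, together with the incomparability of
  types, makes every additive map between such groups diagonal. The standard representation says
  \<open>K = K(s) = {c. \<exists>k. \<forall>\<tau>. c\<^sub>\<tau> \<in> k s\<^sub>\<tau>/m\<^sub>\<tau> + R\<^sub>\<tau>}\<close>. A bilinear map is \<open>(x, y) \<mapsto> a\<^sub>\<tau> x\<^sub>\<tau> y\<^sub>\<tau>\<close>; purity of
  the coordinate blocks gives \<open>a\<^sub>\<tau> = m\<^sub>\<tau>\<^sup>2 c\<^sub>\<tau>\<close>, where \<open>c\<close> ranges exactly over \<open>K(s\<^sup>-\<^sup>1)\<close>. Finally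
  \<open>K(s) \<cong> K(s\<^sup>-\<^sup>1)\<close> holds iff some diagonal map with entries units of \<open>R\<^sub>\<tau>\<close> carries \<open>s\<close> to a multiple
  \<open>k s\<^sup>-\<^sup>1\<close> modulo the \<open>m\<^sub>\<tau>\<close> with \<open>k\<close> prime to \<open>n\<close>, which is the condition \<open>s\<^sup>2 \<in> \<Gamma> V\<^sub>\<infinity>\<close>.
\<close>

section \<open>Additive groups\<close>

text \<open>All purity used here comes from the cyclic quotient. In it a subgroup above the
  regulator is determined by its index, so \<open>Reg G\<close> is itself completely decomposable of
  least index. Enlarging its rank-one summands to their pure closures gives a completely
  decomposable subgroup above it, which must be \<open>Reg G\<close> again; so the summands are pure
  in \<open>G\<close>. In coordinates this says that each m_\<tau> divides every common multiple of
  the other m_\<sigma>.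

  The factor m_\<tau>^2 comes from testing a bilinear map with coefficients a_\<tau> three times.
  Two unit vectors give a_\<tau> in R_\<tau>; the generator and a unit vector give a_\<tau>/m_\<tau>
  in R_\<tau>; the generator with itself gives a_\<tau> s_\<tau>^2/m_\<tau>^2 = k s_\<tau>/m_\<tau>
  modulo R_\<tau> with one k for all \<tau>, and dividing by s_\<tau>^2 produces the inverse of s.

  An obstacle is that the rc-basis is taken in the regulator of the summand G1, while purity
  concerns that of G. Divisibility and purity show that the basis elements generate the components
  of \<open>Reg G\<close> as well.\<close>

lemma add_group_simps [simp]:
  "carrier (add_group H) = H"
  "x \<otimes>\<^bsub>add_group H\<^esub> y = x + y"
  "\<one>\<^bsub>add_group H\<^esub> = 0"
  by (auto simp: add_group_def)

lemma inv_add_group_UNIV: "inv\<^bsub>add_group UNIV\<^esub> (y :: 'a::ab_group_add) = - y"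
proof -
  interpret comm_group "add_group (UNIV :: 'a set)"
    by (rule comm_group_add_group_UNIV)
  show ?thesis by (rule inv_equality) auto
qed

lemma add_subgroup_iff:
  "add_subgroup H \<longleftrightarrow> 0 \<in> H \<and> (\<forall>x\<in>H. \<forall>y\<in>H. x + y \<in> H) \<and> (\<forall>x\<in>H. - x \<in> H)"
  by (auto simp: subgroup_def inv_add_group_UNIV)

lemma add_subgroupI:
  assumes "0 \<in> H" "\<And>x y. x \<in> H \<Longrightarrow> y \<in> H \<Longrightarrow> x + y \<in> H" "\<And>x. x \<in> H \<Longrightarrow> - x \<in> H"
  shows "add_subgroup H"
  using assms by (simp add: add_subgroup_iff)

lemma comm_group_add_group:
  assumes "add_subgroup H" shows "comm_group (add_group H)"
proof (rule comm_groupI)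
  fix x assume "x \<in> carrier (add_group H)"
  then show "\<exists>y\<in>carrier (add_group H). y \<otimes>\<^bsub>add_group H\<^esub> x = \<one>\<^bsub>add_group H\<^esub>"
    using assms by (auto simp: add_subgroup_iff intro!: bexI[of _ "- x"])
qed (use assms in \<open>auto simp: add_subgroup_iff algebra_simps\<close>)

lemma group_add_group: "add_subgroup H \<Longrightarrow> group (add_group H)"
  using comm_group_add_group comm_group.axioms(2) by blast

lemma inv_add_group:
  assumes "add_subgroup H" "x \<in> H" shows "inv\<^bsub>add_group H\<^esub> x = - x"
proof -
  interpret comm_group "add_group H" by (rule comm_group_add_group[OF assms(1)])
  show ?thesis by (rule inv_equality) (use assms in \<open>auto simp: add_subgroup_iff\<close>)
qed

lemma
  assumes "add_subgroup H"
  shows add_subgroup_zero: "0 \<in> H"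
    and add_subgroup_add: "x \<in> H \<Longrightarrow> y \<in> H \<Longrightarrow> x + y \<in> H"
    and add_subgroup_minus: "x \<in> H \<Longrightarrow> - x \<in> H"
    and add_subgroup_diff: "x \<in> H \<Longrightarrow> y \<in> H \<Longrightarrow> x - y \<in> H"
proof -
  show "0 \<in> H" "x \<in> H \<Longrightarrow> y \<in> H \<Longrightarrow> x + y \<in> H" and m: "x \<in> H \<Longrightarrow> - x \<in> H" for x y
    using assms by (auto simp: add_subgroup_iff)
  show "x \<in> H \<Longrightarrow> y \<in> H \<Longrightarrow> x - y \<in> H"
    using assms by (metis add_subgroup_iff diff_conv_add_uminus)
qed

lemma add_subgroup_sum:
  assumes "add_subgroup H" "\<And>i. i \<in> I \<Longrightarrow> f i \<in> H"
  shows "sum f I \<in> H"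
  using assms(2) by (induction I rule: infinite_finite_induct)
    (auto simp: add_subgroup_zero[OF assms(1)] intro!: add_subgroup_add[OF assms(1)])

lemma zmul_minus_left: "zmul (- k) x = - zmul k x"
  using zmul_add_left[of "- k" k x] by (simp add: eq_neg_iff_add_eq_0)

lemma zmul_diff_right: "zmul k (x - y) = zmul k x - zmul k y"
  using zmul_add_right[of k x "- y"] by (simp add: zmul_minus_right)



lemma zmul_sum: "zmul k (sum f I) = (\<Sum>i\<in>I. zmul k (f i))"
  by (induction I rule: infinite_finite_induct) (auto simp: zmul_add_right)

text \<open>Negative integers are reached by reflection, so that additivity and the sign law of
  \<open>zmul\<close> suffice.\<close>

lemma int_induct_add [case_names zero add1 minus]:
  fixes k :: int
  assumes "P 0" "\<And>k. P k \<Longrightarrow> P (k + 1)" "\<And>k. P k \<Longrightarrow> P (- k)"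
  shows "P k"
proof -
  have *: "P (int n)" for n
    by (induction n) (use assms(1) assms(2)[of "int _"] in \<open>auto simp: add.commute\<close>)
  show ?thesis
    using *[of "nat k"] assms(3)[OF *[of "nat (- k)"]] by (cases "k \<ge> 0") auto
qed

lemma add_subgroup_zmul:
  assumes "add_subgroup H" "x \<in> H" shows "zmul k x \<in> H"
  by (induction k rule: int_induct_add)
    (use assms in \<open>auto simp: add_subgroup_zero zmul_add_left zmul_minus_left
       intro: add_subgroup_add add_subgroup_minus\<close>)

text \<open>The codomain is a whole type, so coordinate functionals, maps into the divisible hull
  and maps between vector groups are all instances; the image is constrained only where it
  matters.\<close>

locale additive_on =
  fixes H :: "'a::ab_group_add set" and \<phi> :: "'a \<Rightarrow> 'b::ab_group_add"
  assumes subgroup: "add_subgroup H"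
    and add: "x \<in> H \<Longrightarrow> y \<in> H \<Longrightarrow> \<phi> (x + y) = \<phi> x + \<phi> y"
begin

lemma zero: "\<phi> 0 = 0"
  using add[of 0 0] add_subgroup_zero[OF subgroup] by simp

lemma minus: "x \<in> H \<Longrightarrow> \<phi> (- x) = - \<phi> x"
  using add[of "- x" x] zero add_subgroup_minus[OF subgroup, of x] by (simp add: eq_neg_iff_add_eq_0)

lemma diff: "x \<in> H \<Longrightarrow> y \<in> H \<Longrightarrow> \<phi> (x - y) = \<phi> x - \<phi> y"
  using add[of x "- y"] minus[of y] add_subgroup_minus[OF subgroup, of y] by simp

lemma zmul: assumes "x \<in> H" shows "\<phi> (zmul k x) = zmul k (\<phi> x)"
  by (induction k rule: int_induct_add)
    (use assms in \<open>auto simp: zero add minus add_subgroup_zmul[OF subgroup] zmul_add_left zmul_minus_left\<close>)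

lemma sum: "(\<And>i. i \<in> I \<Longrightarrow> f i \<in> H) \<Longrightarrow> \<phi> (sum f I) = (\<Sum>i\<in>I. \<phi> (f i))"
  by (induction I rule: infinite_finite_induct)
    (auto simp: zero add add_subgroup_sum[OF subgroup])

lemma subgroup_image: "add_subgroup (\<phi> ` H)"
proof (rule add_subgroupI)
  show "0 \<in> \<phi> ` H" using zero add_subgroup_zero[OF subgroup] by (metis imageI)
qed (auto simp flip: add minus intro!: imageI add_subgroup_add[OF subgroup] add_subgroup_minus[OF subgroup])

lemma iso_image: assumes "inj_on \<phi> H" shows "add_group H \<cong> add_group (\<phi> ` H)"
  using assms by (intro is_isoI[of \<phi>] isoI homI) (auto simp: add bij_betw_def)

end



lemma zmul_rat: "zmul k (q :: rat) = of_int k * q"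
  by (induction k rule: int_induct_add) (auto simp: zmul_add_left zmul_minus_left algebra_simps)

lemma zmul_fun: "zmul k f i = zmul k (f i)"
  by (induction k rule: int_induct_add)
    (auto simp: zmul_add_left zmul_minus_left)

lemma sum_fun_apply: "sum f J i = (\<Sum>j\<in>J. f j i)"
  by (induction J rule: infinite_finite_induct) auto

lemma iso_add_groupE:
  assumes "add_group H \<cong> add_group K" "add_subgroup H"
  obtains h where "additive_on H h" "bij_betw h H K"
proof -
  obtain h where "h \<in> iso (add_group H) (add_group K)"
    using assms(1) by (auto simp: is_iso_def)
  then show thesis using that[of h] assms(2) by (auto simp: iso_def hom_def additive_on_def)
qed

section \<open>Common denominators and linear dependence over the rationals\<close>

lemma rational_fraction:
  obtains a b :: int where "(q :: rat) = of_int a / of_int b" "b \<noteq> 0"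
  using quotient_of_div[of q] quotient_of_denom_pos[of q] that by (cases "quotient_of q") force

text \<open>Additive maps commute with integers only; rational coordinates become usable after
  multiplication by \<open>M\<close>, the product of the denominators.\<close>

lemma common_denominator:
  fixes q :: "'j \<Rightarrow> rat"
  assumes "finite J"
  obtains M :: int and a where "M > 0" "\<And>j. j \<in> J \<Longrightarrow> of_int M * q j = of_int (a j)"
proof -
  define den where "den j = snd (quotient_of (q j))" for j
  have pos: "den j > 0" for j
    by (simp add: den_def quotient_of_denom_pos')
  have "of_int (prod den J) * q j = of_int (prod den (J - {j}) * fst (quotient_of (q j)))"
    if j: "j \<in> J" for j
  proof -
    have "prod den J = den j * prod den (J - {j})"
      using assms j by (simp add: prod.remove)
    moreover have "q j = of_int (fst (quotient_of (q j))) / of_int (den j)"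
      unfolding den_def by (intro quotient_of_div) simp
    ultimately show ?thesis using pos[of j] by (simp add: field_simps)
  qed
  moreover have "prod den J > 0" using pos by (simp add: prod_pos)
  ultimately show thesis by (intro that)
qed

text \<open>Gaussian elimination by induction on the coordinates: a pivot \<open>b\<close> with
  nonzero entry at \<open>a\<close> clears that entry in all other vectors, which are still more
  numerous than the remaining coordinates.\<close>

lemma rational_relation:
  fixes v :: "'j \<Rightarrow> 'i \<Rightarrow> rat"
  assumes "finite I" "finite J" "card J > card I"
  shows "\<exists>q. (\<exists>j\<in>J. q j \<noteq> 0) \<and> (\<forall>i\<in>I. (\<Sum>j\<in>J. q j * v j i) = 0)"
  using assms
proof (induction I arbitrary: J v rule: finite_induct)
  case empty
  then obtain j where "j \<in> J" by (metis card.empty card_gt_0_iff ex_in_conv)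
  then show ?case by (intro exI[of _ "\<lambda>_. 1"]) auto
next
  case (insert a I)
  show ?case
  proof (cases "\<forall>j\<in>J. v j a = 0")
    case True
    then show ?thesis using insert.IH[of J v] insert.prems insert.hyps by auto
  next
    case False
    then obtain b where b: "b \<in> J" "v b a \<noteq> 0" by auto
    define w where "w j i = v j i - v j a / v b a * v b i" for j i
    have "card (J - {b}) > card I" using insert b by auto
    from insert.IH[OF _ this, of w] insert.prems obtain q
      where q: "\<exists>j\<in>J - {b}. q j \<noteq> 0" "\<And>i. i \<in> I \<Longrightarrow> (\<Sum>j\<in>J - {b}. q j * w j i) = 0"
      by auto
    \<comment> \<open>The coefficient \<open>- r\<close> of the pivot collects what the row
      operations subtracted.\<close>
    define r where "r = (\<Sum>j\<in>J - {b}. q j * v j a / v b a)"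
    have *: "(\<Sum>j\<in>J. (q(b := - r)) j * v j i) = (\<Sum>j\<in>J - {b}. q j * w j i)" for i
    proof -
      have "(\<Sum>j\<in>J. (q(b := - r)) j * v j i) = - r * v b i + (\<Sum>j\<in>J - {b}. q j * v j i)"
        using insert.prems(1) b(1) by (simp add: sum.remove)
      also have "\<dots> = (\<Sum>j\<in>J - {b}. q j * v j i - q j * v j a / v b a * v b i)"
        by (simp add: r_def sum_distrib_right sum_subtractf)
      also have "\<dots> = (\<Sum>j\<in>J - {b}. q j * w j i)"
        by (intro sum.cong) (auto simp: w_def algebra_simps)
      finally show ?thesis .
    qed
    have "w j a = 0" for j using b by (simp add: w_def)
    then have "\<forall>i\<in>insert a I. (\<Sum>j\<in>J. (q(b := - r)) j * v j i) = 0"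
      using q(2) unfolding * by auto
    moreover have "\<exists>j\<in>J. (q(b := - r)) j \<noteq> 0" using q(1) by auto
    ultimately show ?thesis by blast
  qed
qed

text \<open>Only an integral relation between group elements can be carried through a group
  isomorphism.\<close>

lemma integer_relation:
  fixes v :: "'j \<Rightarrow> 'i \<Rightarrow> rat"
  assumes "finite I" "finite J" "card J > card I"
  obtains k :: "'j \<Rightarrow> int" where "\<exists>j\<in>J. k j \<noteq> 0" "\<And>i. i \<in> I \<Longrightarrow> (\<Sum>j\<in>J. of_int (k j) * v j i) = 0"
proof -
  obtain q where q: "\<exists>j\<in>J. q j \<noteq> 0" "\<And>i. i \<in> I \<Longrightarrow> (\<Sum>j\<in>J. q j * v j i) = 0"
    using rational_relation[OF assms] by blast
  obtain M k where M: "M > 0" and k: "\<And>j. j \<in> J \<Longrightarrow> of_int M * q j = of_int (k j)"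
    using common_denominator[OF assms(2), of q] by metis
  show thesis
  proof
    obtain j where "j \<in> J" "q j \<noteq> 0" using q(1) by blast
    then show "\<exists>j\<in>J. k j \<noteq> 0" using k[of j] M by (intro bexI[of _ j]) auto
    fix i assume "i \<in> I"
    have "(\<Sum>j\<in>J. of_int (k j) * v j i) = of_int M * (\<Sum>j\<in>J. q j * v j i)"
      by (simp add: sum_distrib_left flip: k mult.assoc)
    then show "(\<Sum>j\<in>J. of_int (k j) * v j i) = 0" using q(2)[OF \<open>i \<in> I\<close>] by simp
  qed
qed

lemma prime_dvd_prime_power_eq:
  assumes "prime q" "prime p" "int q dvd int p ^ k" shows "q = p"
proof -
  have "int q dvd int (p ^ k)" using assms(3) by simp
  then have "q dvd p ^ k" by (simp only: of_nat_dvd_iff)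
  then have "q dvd p" by (rule prime_dvd_power[OF assms(1)])
  then show ?thesis using assms(1,2) primes_dvd_imp_eq by blast
qed

section \<open>Localizations of the integers\<close>

text \<open>For \<open>P = P_inf \<tau>\<close> this is the ring \<open>R_ring \<tau>\<close>, in an
  explicit form that replaces its description by unique existence.\<close>

definition Rloc :: "nat set \<Rightarrow> rat set" where
  "Rloc P = {of_int a / of_int b | a b. P_number P b}"

lemma P_number_one [simp]: "P_number P 1"
  by (auto simp: P_number_def)

lemma P_number_mult: "P_number P a \<Longrightarrow> P_number P b \<Longrightarrow> P_number P (a * b)"
  by (auto simp: P_number_def prime_dvd_mult_iff)

lemma P_number_coprime:
  assumes "P_number P b" "m \<noteq> 0" "\<And>p. prime p \<Longrightarrow> p \<in> P \<Longrightarrow> \<not> int p dvd m"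
  shows "coprime m b"
proof (rule ccontr)
  assume "\<not> coprime m b"
  then have "\<not> is_unit (gcd m b)" "gcd m b \<noteq> 0" using assms(2) by auto
  then obtain p where p: "prime p" "p dvd gcd m b" by (metis prime_divisorE)
  have q: "prime (nat p)" "int (nat p) = p"
    using p(1) by (simp_all only: prime_int_nat_transfer int_nat_eq if_True)
  have dvd: "int (nat p) dvd m" "int (nat p) dvd b"
    using p(2) unfolding q(2) by simp_all
  have "nat p \<in> P" using assms(1) dvd(2) q(1) by (simp add: P_number_def)
  then show False using assms(3)[OF q(1)] dvd(1) by blast
qed

lemma Rloc_intI [simp]: "of_int a \<in> Rloc P"
  unfolding Rloc_def by (simp, rule exI[of _ a], rule exI[of _ 1]) simp

lemma Rloc_0 [simp]: "0 \<in> Rloc P" and Rloc_1 [simp]: "1 \<in> Rloc P"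
  using Rloc_intI[of 0] Rloc_intI[of 1] by auto

lemma Rloc_mult: assumes "x \<in> Rloc P" "y \<in> Rloc P" shows "x * y \<in> Rloc P"
proof -
  obtain a b c d where "x = of_int a / of_int b" "y = of_int c / of_int d" "P_number P b" "P_number P d"
    using assms by (auto simp: Rloc_def)
  then have "x * y = of_int (a * c) / of_int (b * d)" by simp
  with \<open>P_number P b\<close> \<open>P_number P d\<close> show ?thesis unfolding Rloc_def using P_number_mult by blast
qed

lemma Rloc_add: assumes "x \<in> Rloc P" "y \<in> Rloc P" shows "x + y \<in> Rloc P"
proof -
  obtain a b c d where *: "x = of_int a / of_int b" "y = of_int c / of_int d" "P_number P b" "P_number P d"
    using assms by (auto simp: Rloc_def)
  then have "x + y = of_int (a * d + c * b) / of_int (b * d)"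
    by (simp add: P_number_def field_simps)
  then show ?thesis unfolding Rloc_def using * P_number_mult by blast
qed

lemma Rloc_minus: "x \<in> Rloc P \<Longrightarrow> - x \<in> Rloc P"
  using Rloc_mult[of "of_int (-1)" P x] Rloc_intI[of "-1" P] by simp

lemma Rloc_diff: "x \<in> Rloc P \<Longrightarrow> y \<in> Rloc P \<Longrightarrow> x - y \<in> Rloc P"
  using Rloc_add[of x P "- y"] Rloc_minus[of y] by simp

lemma Rloc_mono: "P \<subseteq> Q \<Longrightarrow> Rloc P \<subseteq> Rloc Q"
  unfolding Rloc_def P_number_def by blast

lemma Rloc_add_subgroup: "add_subgroup (Rloc P)"
  by (intro add_subgroupI) (auto intro: Rloc_add Rloc_minus)

locale rat_subgroup =
  fixes Q :: "rat set"
  assumes subgroup: "add_subgroup Q"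
begin

lemma int_mult: "x \<in> Q \<Longrightarrow> of_int k * x \<in> Q"
  using add_subgroup_zmul[OF subgroup] by (simp add: zmul_rat)

text \<open>Bezout: \<open>x / b\<close> is an integral combination of \<open>a * x / b\<close> and
  \<open>x\<close>.\<close>

lemma coprime_divide:
  assumes "coprime a b" "b \<noteq> 0" "x \<in> Q" "of_int a * x / of_int b \<in> Q"
  shows "x / of_int b \<in> Q"
proof -
  obtain u w where "u * a + w * b = 1"
    using bezout_int[of a b] assms(1) by auto
  then have 1: "of_int u * of_int a + of_int w * of_int b = (1::rat)"
    by (simp flip: of_int_mult of_int_add)
  have "x / of_int b = (of_int u * of_int a + of_int w * of_int b) * (x / of_int b)"
    unfolding 1 by simp
  also have "\<dots> = of_int u * (of_int a * x / of_int b) + of_int w * x"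
    using assms(2) by (simp add: field_simps)
  also have "\<dots> \<in> Q" using assms by (intro add_subgroup_add[OF subgroup] int_mult)
  finally show ?thesis .
qed

end

lemma rat_subgroup_Rloc: "rat_subgroup (Rloc P)"
  by (simp add: rat_subgroup_def Rloc_add_subgroup)



text \<open>The bridge from membership in the rings to congruences in the integers: denominators
  built from \<open>P\<close> are coprime to \<open>m\<close> and cancel.\<close>

lemma Rloc_divide_iff:
  assumes "m \<noteq> 0" "\<And>p. prime p \<Longrightarrow> p \<in> P \<Longrightarrow> \<not> int p dvd m"
  shows "of_int a / of_int m \<in> Rloc P \<longleftrightarrow> m dvd a"
proof
  assume "of_int a / of_int m \<in> Rloc P"
  then obtain c b where b: "(of_int a :: rat) / of_int m = of_int c / of_int b" "P_number P b"
    by (auto simp: Rloc_def)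
  then have "(of_int (a * b) :: rat) = of_int (c * m)"
    using assms(1) by (simp add: P_number_def field_simps)
  then have "a * b = c * m" by (simp only: of_int_eq_iff)
  moreover have "coprime m b" using P_number_coprime[OF b(2) assms] .
  ultimately show "m dvd a" by (metis coprime_dvd_mult_left_iff dvd_triv_right)
next
  assume "m dvd a"
  then show "of_int a / of_int m \<in> Rloc P" using assms(1) by auto
qed

lemma power_dvd_all_imp_zero:
  fixes a :: int
  assumes "prime p" "\<And>k. int p ^ k dvd a" shows "a = 0"
proof (rule ccontr)
  assume "a \<noteq> 0"
  have "nat \<bar>a\<bar> < 2 ^ nat \<bar>a\<bar>" by (rule less_exp)
  also have "\<dots> \<le> p ^ nat \<bar>a\<bar>" using prime_ge_2_nat[OF assms(1)] by (intro power_mono) auto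
  finally have "int (nat \<bar>a\<bar>) < int (p ^ nat \<bar>a\<bar>)" by (simp only: of_nat_less_iff)
  then have "int p ^ nat \<bar>a\<bar> > \<bar>a\<bar>" by simp
  moreover have "\<bar>int p ^ nat \<bar>a\<bar>\<bar> \<le> \<bar>a\<bar>"
    using assms(2) \<open>a \<noteq> 0\<close> dvd_imp_le_int by blast
  ultimately show False by simp
qed

text \<open>For \<open>p\<close> outside \<open>P\<close>, every power of \<open>p\<close> would
  divide one fixed nonzero integer. The factor \<open>N\<close> allows for groups that exceed the
  ring by bounded denominators.\<close>

lemma Rloc_divisible:
  assumes "prime p" "N \<noteq> 0" "x \<noteq> 0" "\<And>k. of_int N * (x / of_nat p ^ k) \<in> Rloc P"
  shows "p \<in> P"
proof (rule ccontr)
  assume "p \<notin> P"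
  obtain a b where ab: "x = of_int a / of_int b" "b \<noteq> 0" by (rule rational_fraction)
  have "int p ^ k dvd N * a" for k
  proof -
    have "of_int b * (of_int N * (x / of_nat p ^ k)) \<in> Rloc P"
      by (intro Rloc_mult assms) auto
    also have "of_int b * (of_int N * (x / of_nat p ^ k)) = of_int (N * a) / of_int (int p ^ k)"
      using ab by (simp add: field_simps)
    finally show ?thesis
    proof (subst (asm) Rloc_divide_iff)
      fix q assume q: "prime q" "q \<in> P"
      show "\<not> int q dvd int p ^ k"
      proof
        assume "int q dvd int p ^ k"
        then show False using prime_dvd_prime_power_eq[OF q(1) assms(1)] q(2) \<open>p \<notin> P\<close> by blast
      qed
    qed (use assms(1) in auto)
  qed
  then have "N * a = 0" by (intro power_dvd_all_imp_zero[OF assms(1)])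
  then show False using assms ab by simp
qed

lemma Rloc_inverse_power: "p \<in> P \<Longrightarrow> prime p \<Longrightarrow> 1 / of_nat p ^ k \<in> Rloc P"
proof -
  assume p: "p \<in> P" "prime p"
  then have "P_number P (int p ^ k)"
    by (auto simp: P_number_def dest: prime_dvd_prime_power_eq)
  then show ?thesis unfolding Rloc_def
    by (simp, intro exI[of _ 1] exI[of _ "int p ^ k"]) simp
qed

section \<open>Bilinear maps on groups of rational vectors\<close>

text \<open>Stands in for \<open>Mult G\<close> once the tensor product is eliminated.
  Extensionality makes a map equal to its values on \<open>G \<times> G\<close>.\<close>

definition Bil :: "'a::ab_group_add set \<Rightarrow> ('a \<times> 'a \<Rightarrow> 'a) monoid" where
  "Bil G = \<lparr>carrier = {\<mu> \<in> extensional (G \<times> G).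
       (\<forall>x\<in>G. \<forall>y\<in>G. \<mu> (x, y) \<in> G) \<and>
       (\<forall>x\<in>G. \<forall>x'\<in>G. \<forall>y\<in>G. \<mu> (x + x', y) = \<mu> (x, y) + \<mu> (x', y)) \<and>
       (\<forall>x\<in>G. \<forall>y\<in>G. \<forall>y'\<in>G. \<mu> (x, y + y') = \<mu> (x, y) + \<mu> (x, y'))},
     monoid.mult = (\<lambda>\<mu> \<nu>. \<lambda>p\<in>G \<times> G. \<mu> p + \<nu> p), one = (\<lambda>p\<in>G \<times> G. 0)\<rparr>"

lemma BilI:
  assumes "\<And>x y. x \<in> G \<Longrightarrow> y \<in> G \<Longrightarrow> f x y \<in> G"
    and "\<And>x x' y. x \<in> G \<Longrightarrow> x' \<in> G \<Longrightarrow> y \<in> G \<Longrightarrow> f (x + x') y = f x y + f x' y"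
    and "\<And>x y y'. x \<in> G \<Longrightarrow> y \<in> G \<Longrightarrow> y' \<in> G \<Longrightarrow> f x (y + y') = f x y + f x y'"
    and "add_subgroup G"
  shows "(\<lambda>p\<in>G \<times> G. f (fst p) (snd p)) \<in> carrier (Bil G)"
  using assms by (auto simp: Bil_def add_subgroup_add)

lemma
  assumes "\<mu> \<in> carrier (Bil G)"
  shows Bil_closed: "x \<in> G \<Longrightarrow> y \<in> G \<Longrightarrow> \<mu> (x, y) \<in> G"
    and Bil_add_left: "x \<in> G \<Longrightarrow> x' \<in> G \<Longrightarrow> y \<in> G \<Longrightarrow> \<mu> (x + x', y) = \<mu> (x, y) + \<mu> (x', y)"
    and Bil_add_right: "x \<in> G \<Longrightarrow> y \<in> G \<Longrightarrow> y' \<in> G \<Longrightarrow> \<mu> (x, y + y') = \<mu> (x, y) + \<mu> (x, y')"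
    and Bil_extensional: "\<mu> \<in> extensional (G \<times> G)"
  using assms by (auto simp: Bil_def)

lemma Bil_mult: "\<mu> \<otimes>\<^bsub>Bil G\<^esub> \<nu> = (\<lambda>p\<in>G \<times> G. \<mu> p + \<nu> p)"
  by (simp add: Bil_def)

lemma Bil_eqI:
  assumes "\<mu> \<in> carrier (Bil G)" "\<nu> \<in> carrier (Bil G)"
    and "\<And>x y. x \<in> G \<Longrightarrow> y \<in> G \<Longrightarrow> \<mu> (x, y) = \<nu> (x, y)"
  shows "\<mu> = \<nu>"
  by (rule extensionalityI[of _ "G \<times> G"]) (use assms Bil_extensional in auto)

lemma Bil_iso_cong:
  assumes "add_group G \<cong> add_group K" "add_subgroup G"
  shows "Bil G \<cong> Bil K"
proof -
  obtain h where h: "additive_on G h" "bij_betw h G K"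
    using assms by (rule iso_add_groupE)
  interpret h: additive_on G h by (rule h)
  have K: "K = h ` G" and inj: "inj_on h G" using h(2) by (auto simp: bij_betw_def)
  have subK: "add_subgroup K" unfolding K by (rule h.subgroup_image)
  define g where "g = inv_into G h"
  have g: "g y \<in> G" "h (g y) = y" if "y \<in> K" for y
    using that unfolding g_def K by (auto intro: inv_into_into f_inv_into_f)
  have gh: "g (h x) = x" if "x \<in> G" for x
    using that inj unfolding g_def by simp
  have hK: "h x \<in> K" if "x \<in> G" for x using that K by blast
  have g_add: "g (x + y) = g x + g y" if "x \<in> K" "y \<in> K" for x y
  proof -
    have "g (h (g x + g y)) = g x + g y"
      by (intro gh add_subgroup_add[OF assms(2)] g that)
    then show ?thesis using that g by (simp add: h.add)
  qed
  define \<Phi> where "\<Phi> \<mu> = (\<lambda>p\<in>K \<times> K. h (\<mu> (g (fst p), g (snd p))))" for \<mu> :: "'a \<times> 'a \<Rightarrow> 'a"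
  define \<Psi> where "\<Psi> \<nu> = (\<lambda>p\<in>G \<times> G. g (\<nu> (h (fst p), h (snd p))))" for \<nu> :: "'b \<times> 'b \<Rightarrow> 'b"
  have \<Phi>: "\<Phi> \<mu> \<in> carrier (Bil K)" if "\<mu> \<in> carrier (Bil G)" for \<mu>
    unfolding \<Phi>_def using that
    by (intro BilI[of K "\<lambda>x y. h (\<mu> (g x, g y))"] subK)
      (auto simp: hK Bil_closed g g_add Bil_add_left Bil_add_right h.add)
  have \<Psi>: "\<Psi> \<nu> \<in> carrier (Bil G)" if "\<nu> \<in> carrier (Bil K)" for \<nu>
    unfolding \<Psi>_def using that
    by (intro BilI[of G "\<lambda>x y. g (\<nu> (h x, h y))"] assms(2))
      (auto simp: hK Bil_closed g g_add Bil_add_left Bil_add_right h.add)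
  have "\<Phi> \<in> iso (Bil G) (Bil K)"
  proof (rule isoI)
    show "\<Phi> \<in> hom (Bil G) (Bil K)"
      by (rule homI) (auto simp: \<Phi> Bil_mult, auto simp: \<Phi>_def fun_eq_iff g Bil_closed h.add)
    show "bij_betw \<Phi> (carrier (Bil G)) (carrier (Bil K))"
    proof (rule bij_betwI[where g = \<Psi>])
      show "\<Psi> (\<Phi> \<mu>) = \<mu>" if "\<mu> \<in> carrier (Bil G)" for \<mu>
        by (rule Bil_eqI[OF \<Psi>[OF \<Phi>[OF that]] that])
          (use that in \<open>auto simp: \<Psi>_def \<Phi>_def hK gh Bil_closed\<close>)
      show "\<Phi> (\<Psi> \<nu>) = \<nu>" if "\<nu> \<in> carrier (Bil K)" for \<nu>
        by (rule Bil_eqI[OF \<Phi>[OF \<Psi>[OF that]] that])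
          (use that in \<open>auto simp: \<Psi>_def \<Phi>_def hK g Bil_closed\<close>)
    qed (auto simp: \<Phi> \<Psi>)
  qed
  then show ?thesis by (rule is_isoI)
qed

section \<open>Groups of rational vectors and their additive functionals\<close>

definition single :: "'i \<Rightarrow> rat \<Rightarrow> 'i \<Rightarrow> rat" where
  "single i r = (\<lambda>j. if j = i then r else 0)"

lemma single_apply: "single i r j = (if j = i then r else 0)"
  by (simp add: single_def)



text \<open>Vectors are functions on the whole index type that vanish off \<open>I\<close>, so
  addition and equality are those of the function type.\<close>

locale coord_subgroup =
  fixes I :: "'i set" and P :: "'i \<Rightarrow> nat set" and K :: "('i \<Rightarrow> rat) set"
  assumes finite: "finite I"
    and prime: "p \<in> P i \<Longrightarrow> prime p"
    and subgroup: "add_subgroup K"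
    and support: "c \<in> K \<Longrightarrow> i \<notin> I \<Longrightarrow> c i = 0"
    and single: "i \<in> I \<Longrightarrow> r \<in> Rloc (P i) \<Longrightarrow> single i r \<in> K"
begin



text \<open>For \<open>i\<close> other than \<open>j\<close> the unit vector at \<open>i\<close> can
  be divided within \<open>K\<close> by all powers of primes in \<open>P i\<close>. A nonzero value
  of the bounded functional there would therefore force \<open>P i \<subseteq> P j\<close>.\<close>

lemma additive_functional:
  assumes \<psi>: "additive_on K \<psi>" and j: "j \<in> I" "\<And>i. i \<in> I \<Longrightarrow> P i \<subseteq> P j \<Longrightarrow> i = j"
    and N: "N \<noteq> 0" "\<And>c. c \<in> K \<Longrightarrow> of_int N * \<psi> c \<in> Rloc (P j)" and c: "c \<in> K"
  shows "\<psi> c = \<psi> (single j 1) * c j"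
proof -
  interpret \<psi>: additive_on K \<psi> by (rule \<psi>)
  have 0: "\<psi> (single i 1) = 0" if i: "i \<in> I" "i \<noteq> j" for i
  proof (rule ccontr)
    assume nz: "\<psi> (single i 1) \<noteq> 0"
    have "p \<in> P j" if p: "p \<in> P i" for p
    proof (rule Rloc_divisible[OF prime[OF p] N(1) nz])
      fix k
      have mem: "single i (1 / of_nat p ^ k) \<in> K"
        by (intro single i Rloc_inverse_power p prime[OF p])
      have "zmul (int p ^ k) (single i (1 / of_nat p ^ k)) = single i 1"
        using prime[OF p] by (auto simp: fun_eq_iff zmul_fun zmul_rat single_apply)
      from this[symmetric] have "\<psi> (single i 1) = of_nat p ^ k * \<psi> (single i (1 / of_nat p ^ k))"
        using \<psi>.zmul[OF mem, of "int p ^ k"] by (simp add: zmul_rat)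
      then have "\<psi> (single i 1) / of_nat p ^ k = \<psi> (single i (1 / of_nat p ^ k))"
        using prime[OF p] by auto
      then show "of_int N * (\<psi> (single i 1) / of_nat p ^ k) \<in> Rloc (P j)"
        using N(2)[OF mem] by simp
    qed
    then show False using j(2)[of i] i by blast
  qed
  \<comment> \<open>\<open>M\<close> times \<open>c\<close> is an integral combination of unit
    vectors, all in \<open>K\<close>, so additivity alone determines the value at
    \<open>c\<close>.\<close>
  obtain M a where M: "M > 0" and a: "\<And>i. i \<in> I \<Longrightarrow> of_int M * c i = of_int (a i)"
    using common_denominator[OF finite, of c] by metis
  have "zmul M c = (\<Sum>i\<in>I. zmul (a i) (single i 1))"
    using finite support[OF c] a
    by (auto simp: fun_eq_iff sum_fun_apply zmul_fun zmul_rat single_apply if_distrib[of "(*) _"] cong: if_cong)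
  moreover have "single i 1 \<in> K" if "i \<in> I" for i using single[OF that] by simp
  ultimately have "of_int M * \<psi> c = (\<Sum>i\<in>I. of_int (a i) * \<psi> (single i 1))"
    using \<psi>.zmul[OF c, of M] \<psi>.sum[of I "\<lambda>i. zmul (a i) (single i 1)"] \<psi>.zmul[of "single _ 1"]
    by (simp add: zmul_rat add_subgroup_zmul[OF subgroup])
  also have "\<dots> = (\<Sum>i\<in>I. if i = j then of_int (a j) * \<psi> (single j 1) else 0)"
    by (intro sum.cong) (auto simp: 0)
  also have "\<dots> = of_int M * (\<psi> (single j 1) * c j)"
    using finite j(1) a[OF j(1)] by simp
  finally show ?thesis using M by simp
qed

end

text \<open>If two blocks coincide, there is a product mapping the first block into the second besides
  the products living on a single coordinate, so the bilinear maps have larger rank than \<open>K\<close>.\<close>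

lemma (in coord_subgroup) not_iso_Bil:
  assumes xy: "x \<in> I" "y \<in> I" "x \<noteq> y" "P x = P y"
    and N: "N \<noteq> 0" "\<And>c i. c \<in> K \<Longrightarrow> i \<in> I \<Longrightarrow> of_int N * c i \<in> Rloc (P i)"
  shows "\<not> add_group K \<cong> Bil K"
proof
  assume "add_group K \<cong> Bil K"
  then obtain H where H: "H \<in> iso (add_group K) (Bil K)" by (auto simp: is_iso_def)
  \<comment> \<open>\<open>None\<close> indexes the extra product from block \<open>x\<close> into
    block \<open>y\<close>, and \<open>Some i\<close> the product living on \<open>i\<close>
    alone.\<close>
  define src where "src j = (case j of None \<Rightarrow> x | Some i \<Rightarrow> i)" for j :: "'i option"
  define tgt where "tgt j = (case j of None \<Rightarrow> y | Some i \<Rightarrow> i)" for j :: "'i option"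
  define J where "J = insert None (Some ` I)"
  have J: "src j \<in> I" "tgt j \<in> I" "P (src j) = P (tgt j)" if "j \<in> J" for j
    using that xy by (auto simp: J_def src_def tgt_def)
  \<comment> \<open>Each factor \<open>N\<close> moves a coordinate of a vector in \<open>K\<close>
    into the ring, where products stay.\<close>
  define f where "f j c c' = single (tgt j) (of_int N * c (src j) * (of_int N * c' (src j)))"
    for j and c c' :: "'i \<Rightarrow> rat"
  define \<mu> where "\<mu> j = (\<lambda>p\<in>K \<times> K. f j (fst p) (snd p))" for j
  have \<mu>: "\<mu> j \<in> carrier (Bil K)" if "j \<in> J" for j
    unfolding \<mu>_def
  proof (rule BilI)
    fix c c' assume "c \<in> K" "c' \<in> K"
    then have "of_int N * c (src j) \<in> Rloc (P (tgt j))" "of_int N * c' (src j) \<in> Rloc (P (tgt j))"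
      using N(2) J[OF that] by metis+
    then show "f j c c' \<in> K" unfolding f_def by (rule single[OF J(2)[OF that] Rloc_mult])
  qed (auto simp: subgroup f_def single_apply fun_eq_iff algebra_simps)
  have surj: "H ` K = carrier (Bil K)" and hom: "H \<in> hom (add_group K) (Bil K)"
    using H by (auto simp: iso_def bij_betw_def)
  have "\<forall>j\<in>J. \<exists>v. v \<in> K \<and> H v = \<mu> j" using \<mu> surj by (metis imageE)
  then obtain v where v: "\<And>j. j \<in> J \<Longrightarrow> v j \<in> K" "\<And>j. j \<in> J \<Longrightarrow> H (v j) = \<mu> j" by metis
  have finJ: "finite J" using finite by (simp add: J_def)
  have "card J = Suc (card I)"
    using finite by (simp add: J_def card_image)
  then obtain k :: "'i option \<Rightarrow> int" where k: "\<exists>j\<in>J. k j \<noteq> 0"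
      "\<And>i. i \<in> I \<Longrightarrow> (\<Sum>j\<in>J. of_int (k j) * v j i) = 0"
    using integer_relation[OF finite finJ, of v] by (metis lessI)
  have rel: "(\<Sum>j\<in>J. zmul (k j) (v j)) = 0"
  proof
    fix i show "(\<Sum>j\<in>J. zmul (k j) (v j)) i = 0 i"
      using k(2)[of i] support[OF v(1), of _ i]
      by (cases "i \<in> I") (auto simp: sum_fun_apply zmul_fun zmul_rat)
  qed
  have ev: "(\<Sum>j\<in>J. of_int (k j) * \<mu> j (c, c') l) = 0" if "c \<in> K" "c' \<in> K" for c c' l
  proof -
    have "additive_on K (\<lambda>z. H z (c, c') l)"
      using hom that by (auto simp: additive_on_def subgroup hom_def Bil_mult)
    then interpret additive_on K "\<lambda>z. H z (c, c') l" .
    have "(\<Sum>j\<in>J. of_int (k j) * \<mu> j (c, c') l) = (\<Sum>j\<in>J. H (zmul (k j) (v j)) (c, c') l)"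
      by (intro sum.cong) (auto simp: zmul v zmul_rat)
    also have "\<dots> = H (\<Sum>j\<in>J. zmul (k j) (v j)) (c, c') l"
      by (rule sum[symmetric]) (auto simp: add_subgroup_zmul[OF subgroup] v)
    finally show ?thesis by (simp add: rel zero)
  qed
  have s1: "single i 1 \<in> K" if "i \<in> I" for i using single[OF that] by simp
  \<comment> \<open>No two indices in \<open>J\<close> share both source and target, so evaluating
    at the unit vector of the source and reading the target coordinate isolates one
    coefficient.\<close>
  have "k j = 0" if j: "j \<in> J" for j
  proof -
    have "\<mu> j' (single (src j) 1, single (src j) 1) (tgt j) = (if j' = j then of_int (N * N) else 0)"
      if "j' \<in> J" for j'
      using that j xy s1 J(1)[OF j]
      by (auto simp: \<mu>_def f_def single_apply src_def tgt_def J_def)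
    then show ?thesis
      using ev[of "single (src j) 1" "single (src j) 1" "tgt j"] s1 J(1)[OF j] finJ j N(1)
      by (simp add: if_distrib[of "(*) _"] cong: if_cong)
  qed
  then show False using k(1) by blast
qed

section \<open>Rigid groups in coordinates\<close>

definition std_group :: "'i set \<Rightarrow> ('i \<Rightarrow> nat set) \<Rightarrow> ('i \<Rightarrow> int) \<Rightarrow> ('i \<Rightarrow> int) \<Rightarrow> ('i \<Rightarrow> rat) set" where
  "std_group I P m s = {c. (\<forall>i. i \<notin> I \<longrightarrow> c i = 0) \<and>
     (\<exists>k. \<forall>i\<in>I. c i - of_int (k * s i) / of_int (m i) \<in> Rloc (P i))}"

lemma std_groupI:
  assumes "\<And>i. i \<notin> I \<Longrightarrow> c i = 0"
    and "\<And>i. i \<in> I \<Longrightarrow> c i - of_int (k * s i) / of_int (m i) \<in> Rloc (P i)"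
  shows "c \<in> std_group I P m s"
  using assms unfolding std_group_def by blast

lemma std_groupE:
  assumes "c \<in> std_group I P m s"
  obtains k where "\<And>i. i \<notin> I \<Longrightarrow> c i = 0"
    "\<And>i. i \<in> I \<Longrightarrow> c i - of_int (k * s i) / of_int (m i) \<in> Rloc (P i)"
  using assms unfolding std_group_def by blast

text \<open>The last assumption says that every coordinate block is pure in \<open>std_group I P m s\<close>;
  it does not depend on \<open>s\<close>.\<close>

locale std_data =
  fixes I :: "'i set" and P :: "'i \<Rightarrow> nat set" and m :: "'i \<Rightarrow> int"
  assumes finite: "finite I"
    and prime: "p \<in> P i \<Longrightarrow> prime p"
    and incomparable: "i \<in> I \<Longrightarrow> j \<in> I \<Longrightarrow> P i \<subseteq> P j \<Longrightarrow> i = j"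
    and m_nonzero: "i \<in> I \<Longrightarrow> m i \<noteq> 0"
    and m_coprime: "i \<in> I \<Longrightarrow> p \<in> P i \<Longrightarrow> \<not> int p dvd m i"
    and pure: "i \<in> I \<Longrightarrow> (\<And>j. j \<in> I \<Longrightarrow> j \<noteq> i \<Longrightarrow> m j dvd k) \<Longrightarrow> m i dvd k"
begin

abbreviation K :: "('i \<Rightarrow> int) \<Rightarrow> ('i \<Rightarrow> rat) set" where
  "K s \<equiv> std_group I P m s"

lemma coord_subgroup: "coord_subgroup I P (K s)"
proof (rule coord_subgroup.intro)
  show "add_subgroup (K s)"
  proof (rule add_subgroupI)
    show "0 \<in> K s" by (auto simp: std_group_def intro!: exI[of _ 0])
  next
    fix c c' assume cc': "c \<in> K s" "c' \<in> K s"
    obtain k where c: "\<And>i. i \<notin> I \<Longrightarrow> c i = 0"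
      and k: "\<And>i. i \<in> I \<Longrightarrow> c i - of_int (k * s i) / of_int (m i) \<in> Rloc (P i)"
      using std_groupE[OF cc'(1)] by metis
    obtain k' where c': "\<And>i. i \<notin> I \<Longrightarrow> c' i = 0"
      and k': "\<And>i. i \<in> I \<Longrightarrow> c' i - of_int (k' * s i) / of_int (m i) \<in> Rloc (P i)"
      using std_groupE[OF cc'(2)] by metis
    have "c i + c' i - of_int ((k + k') * s i) / of_int (m i) \<in> Rloc (P i)" if "i \<in> I" for i
      using Rloc_add[OF k[OF that] k'[OF that]]
      by (simp add: algebra_simps add_divide_distrib)
    then show "c + c' \<in> K s" using c c' by (intro std_groupI[where k = "k + k'"]) auto
  next
    fix c assume "c \<in> K s"
    then obtain k where c: "\<And>i. i \<notin> I \<Longrightarrow> c i = 0"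
      and k: "\<And>i. i \<in> I \<Longrightarrow> c i - of_int (k * s i) / of_int (m i) \<in> Rloc (P i)"
      by (rule std_groupE) blast
    have "- c i - of_int (- k * s i) / of_int (m i) \<in> Rloc (P i)" if "i \<in> I" for i
      using Rloc_minus[OF k[OF that]] by simp
    then show "- c \<in> K s" using c by (intro std_groupI[where k = "- k"]) auto
  qed
  show "single i r \<in> K s" if "i \<in> I" "r \<in> Rloc (P i)" for i r
    using that by (auto simp: std_group_def single_apply intro!: exI[of _ 0])
qed (auto simp: finite std_group_def intro: prime)

lemma bounded:
  assumes "c \<in> K s" "i \<in> I" shows "of_int (m i) * c i \<in> Rloc (P i)"
proof -
  obtain k where k: "c i - of_int (k * s i) / of_int (m i) \<in> Rloc (P i)"
    using std_groupE[OF assms(1)] assms(2) by metis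
  have "of_int (m i) * c i = of_int (m i) * (c i - of_int (k * s i) / of_int (m i)) + of_int (k * s i)"
    using m_nonzero[OF assms(2)] by (simp add: field_simps)
  also have "\<dots> \<in> Rloc (P i)" using k by (intro Rloc_add Rloc_mult Rloc_intI)
  finally show ?thesis .
qed

lemma divide_m_iff: "i \<in> I \<Longrightarrow> of_int a / of_int (m i) \<in> Rloc (P i) \<longleftrightarrow> m i dvd a"
  using Rloc_divide_iff[OF m_nonzero m_coprime] by blast

text \<open>Where \<open>c\<close> vanishes, \<open>m j\<close> divides \<open>k * s j\<close> and
  hence the multiplier \<open>k\<close>, as \<open>s j\<close> is invertible; the assumption
  \<open>pure\<close> then settles the remaining coordinate.\<close>

lemma block_pure:
  assumes c: "c \<in> K s" and s: "\<And>j. j \<in> I \<Longrightarrow> coprime (s j) (m j)"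
    and i: "i \<in> I" and 0: "\<And>j. j \<in> I \<Longrightarrow> j \<noteq> i \<Longrightarrow> c j = 0"
  shows "c i \<in> Rloc (P i)"
proof -
  obtain k where k: "\<And>j. j \<in> I \<Longrightarrow> c j - of_int (k * s j) / of_int (m j) \<in> Rloc (P j)"
    using std_groupE[OF c] by metis
  have "m j dvd k" if j: "j \<in> I" "j \<noteq> i" for j
  proof -
    have "of_int (k * s j) / of_int (m j) \<in> Rloc (P j)"
      using Rloc_minus[OF k[OF j(1)]] 0[OF j] by simp
    then have "m j dvd k * s j" using divide_m_iff[OF j(1)] by blast
    then show ?thesis using s[OF j(1)] by (metis coprime_commute coprime_dvd_mult_left_iff)
  qed
  then have "m i dvd k * s i" using pure[OF i] by auto
  then have "of_int (k * s i) / of_int (m i) \<in> Rloc (P i)" using divide_m_iff[OF i] by blast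
  from Rloc_add[OF k[OF i] this] show ?thesis by simp
qed

text \<open>Each coordinate of an additive map is a bounded functional, hence a multiple of the same
  coordinate. The bound depends on \<open>m\<close> only, so \<open>s\<close> and \<open>s'\<close>
  may differ.\<close>

lemma additive_coord:
  assumes \<phi>: "additive_on (K s) \<phi>" "\<phi> ` K s \<subseteq> K s'" and c: "c \<in> K s" and i: "i \<in> I"
  shows "\<phi> c i = \<phi> (single i 1) i * c i"
proof -
  interpret coord_subgroup I P "K s" by (rule coord_subgroup)
  show ?thesis
  proof (rule additive_functional[where \<psi> = "\<lambda>c. \<phi> c i" and N = "m i"])
    show "additive_on (K s) (\<lambda>c. \<phi> c i)" using \<phi>(1) by (auto simp: additive_on_def)
    show "of_int (m i) * \<phi> c i \<in> Rloc (P i)" if "c \<in> K s" for c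
      using bounded[of "\<phi> c" s' i] that \<phi>(2) i by blast
  qed (use i c m_nonzero incomparable in auto)
qed

text \<open>The congruence says that the diagonal map \<open>y / x\<close> carries the generator
  \<open>s / m\<close> to \<open>k\<close> times the generator \<open>s' / m\<close>, modulo the
  rings; multipliers are thus multiplied by \<open>k\<close>.\<close>

lemma scale_mem:
  assumes c: "c \<in> K s" and x: "\<And>i. i \<in> I \<Longrightarrow> P_number (P i) (x i)"
    and cong: "\<And>i. i \<in> I \<Longrightarrow> [y i * s i = k * x i * s' i] (mod m i)"
  shows "(\<lambda>i. of_int (y i) / of_int (x i) * c i) \<in> K s'"
proof -
  obtain l where c0: "\<And>i. i \<notin> I \<Longrightarrow> c i = 0"
    and l: "\<And>i. i \<in> I \<Longrightarrow> c i - of_int (l * s i) / of_int (m i) \<in> Rloc (P i)"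
    using std_groupE[OF c] by metis
  have "of_int (y i) / of_int (x i) * c i - of_int (l * k * s' i) / of_int (m i) \<in> Rloc (P i)"
    if i: "i \<in> I" for i
  proof -
    obtain t where t: "y i * s i = k * x i * s' i + m i * t"
      using cong[OF i] by (metis cong_iff_lin cong_sym)
    have t': "(of_int (y i) * of_int (s i) :: rat) = of_int k * of_int (x i) * of_int (s' i) + of_int (m i) * of_int t"
      using arg_cong[OF t, of "of_int :: int \<Rightarrow> rat"] by simp
    have nz: "x i \<noteq> 0" "m i \<noteq> 0" using x[OF i] m_nonzero[OF i] by (auto simp: P_number_def)
    have div: "of_int a / of_int (x i) \<in> Rloc (P i)" for a
      using x[OF i] unfolding Rloc_def by blast
    have "of_int (y i) / of_int (x i) * c i - of_int (l * k * s' i) / of_int (m i)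
       = of_int (y i) / of_int (x i) * (c i - of_int (l * s i) / of_int (m i))
         + of_int l * (of_int (y i) * of_int (s i) - of_int k * of_int (x i) * of_int (s' i)) / (of_int (x i) * of_int (m i))"
      using nz by (simp add: field_simps)
    also have "\<dots> = of_int (y i) / of_int (x i) * (c i - of_int (l * s i) / of_int (m i))
         + of_int (l * t) / of_int (x i)"
      unfolding t' using nz by (simp add: field_simps)
    also have "\<dots> \<in> Rloc (P i)" using l[OF i] by (intro Rloc_add Rloc_mult div)
    finally show ?thesis .
  qed
  then show ?thesis using c0 by (intro std_groupI[where k = "l * k"]) auto
qed

lemma generator_mem: "(\<lambda>i. if i \<in> I then of_int (s i) / of_int (m i) else 0) \<in> K s"
  by (rule std_groupI[where k = 1]) auto

text \<open>Writing both factors as fractions, the numerator of \<open>u\<close> divides a product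
  of two \<open>Q\<close>-numbers, so it is a \<open>Q\<close>-number like the denominator.\<close>

lemma unit_fraction:
  assumes "u \<in> Rloc Q" "v \<in> Rloc Q" "u * v = 1"
  obtains x y where "P_number Q x" "P_number Q y" "u = of_int y / of_int x"
proof -
  obtain a b a' b' where *: "u = of_int a / of_int b" "v = of_int a' / of_int b'" "P_number Q b" "P_number Q b'"
    using assms(1,2) by (auto simp: Rloc_def)
  then have "(of_int (a * a') :: rat) = of_int (b * b')"
    using assms(3) by (simp add: P_number_def field_simps)
  then have "a * a' = b * b'" by (simp only: of_int_eq_iff)
  moreover have "P_number Q (b * b')" using * by (intro P_number_mult)
  ultimately have "P_number Q a" by (auto simp: P_number_def dest!: dvd_mult2[of _ a a'])
  with * that show thesis by blast
qed

lemma P_number_coprime_m: "i \<in> I \<Longrightarrow> P_number (P i) x \<Longrightarrow> coprime (m i) x"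
  by (rule P_number_coprime) (auto simp: m_nonzero dest: m_coprime)

text \<open>An isomorphism and its inverse are diagonal, and purity of the blocks puts the entries
  of both into the rings. So the entries are units \<open>y / x\<close>, and the multiplier of the
  image of the generator is the required \<open>k\<close>.\<close>

lemma iso_iff:
  assumes s: "\<And>i. i \<in> I \<Longrightarrow> coprime (s i) (m i)" and s': "\<And>i. i \<in> I \<Longrightarrow> coprime (s' i) (m i)"
  shows "add_group (K s) \<cong> add_group (K s') \<longleftrightarrow>
    (\<exists>x y k. \<forall>i\<in>I. P_number (P i) (x i) \<and> P_number (P i) (y i) \<and> coprime k (m i) \<and>
       [y i * s i = k * x i * s' i] (mod m i))" (is "_ \<longleftrightarrow> ?R")
proof
  assume iso: "add_group (K s) \<cong> add_group (K s')"
  interpret Ks: coord_subgroup I P "K s" by (rule coord_subgroup)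
  interpret Ks': coord_subgroup I P "K s'" by (rule coord_subgroup)
  obtain h where h: "additive_on (K s) h" "bij_betw h (K s) (K s')"
    using iso Ks.subgroup by (rule iso_add_groupE)
  define g where "g = inv_into (K s) h"
  have him: "h ` K s \<subseteq> K s'" and gim: "g ` K s' \<subseteq> K s" and hg: "\<And>c. c \<in> K s' \<Longrightarrow> h (g c) = c"
    and gh: "\<And>c. c \<in> K s \<Longrightarrow> g (h c) = c"
    using h(2) unfolding g_def by (auto simp: bij_betw_def inv_into_into f_inv_into_f)
  have g: "additive_on (K s') g"
  proof (unfold additive_on_def, intro conjI allI impI)
    fix x y assume xy: "x \<in> K s'" "y \<in> K s'"
    have "g (h (g x + g y)) = g x + g y" using gim xy
      by (intro gh add_subgroup_add[OF Ks.subgroup]) auto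
    moreover have "h (g x + g y) = x + y"
      using gim xy by (simp add: additive_on.add[OF h(1)] hg image_subset_iff)
    ultimately show "g (x + y) = g x + g y" by simp
  qed (rule Ks'.subgroup)
  define u where "u i = h (single i 1) i" for i
  define v where "v i = g (single i 1) i" for i
  have hc: "h c i = u i * c i" if "c \<in> K s" "i \<in> I" for c i
    unfolding u_def by (rule additive_coord[OF h(1) him that])
  have gc: "g c i = v i * c i" if "c \<in> K s'" "i \<in> I" for c i
    unfolding v_def by (rule additive_coord[OF g gim that])
  have s1: "single i 1 \<in> K s" "single i 1 \<in> K s'" if "i \<in> I" for i
    using Ks.single[OF that, of 1] Ks'.single[OF that, of 1] by auto
  have uR: "u i \<in> Rloc (P i)" if "i \<in> I" for i
    unfolding u_def using him s1[OF that]
    by (intro block_pure[of "h (single i 1)" s' i] s' that) (auto simp: hc single_apply)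
  have vR: "v i \<in> Rloc (P i)" if "i \<in> I" for i
    unfolding v_def using gim s1[OF that]
    by (intro block_pure[of "g (single i 1)" s i] s that) (auto simp: gc single_apply)
  have uv: "u i * v i = 1" if "i \<in> I" for i
  proof -
    have "1 = h (g (single i 1)) i" using s1[OF that] by (simp add: hg single_apply)
    also have "\<dots> = u i * (v i * 1)"
      using gim s1[OF that] that by (subst hc) (auto simp: gc single_apply)
    finally show ?thesis by simp
  qed
  have "\<forall>i\<in>I. \<exists>x y. P_number (P i) x \<and> P_number (P i) y \<and> u i = of_int y / of_int x"
    using unit_fraction[OF uR vR uv] by metis
  then obtain x y where xy: "\<And>i. i \<in> I \<Longrightarrow> P_number (P i) (x i)" "\<And>i. i \<in> I \<Longrightarrow> P_number (P i) (y i)"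
    and u: "\<And>i. i \<in> I \<Longrightarrow> u i = of_int (y i) / of_int (x i)" by metis
  \<comment> \<open>Unit vectors detect only the entries of \<open>h\<close>; the common multiplier
    \<open>k\<close> is read off from the generator.\<close>
  define d where "d i = (if i \<in> I then of_int (s i) / of_int (m i) else 0 :: rat)" for i
  have d: "d \<in> K s" unfolding d_def by (rule generator_mem)
  then have "h d \<in> K s'" using him by blast
  then obtain k where k: "\<And>i. i \<in> I \<Longrightarrow> h d i - of_int (k * s' i) / of_int (m i) \<in> Rloc (P i)"
    by (rule std_groupE) blast
  have *: "[y i * s i = k * x i * s' i] (mod m i) \<and> coprime k (m i)" if i: "i \<in> I" for i
  proof -
    have nz: "x i \<noteq> 0" "m i \<noteq> 0" using xy(1)[OF i] m_nonzero[OF i] by (auto simp: P_number_def)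
    have "of_int (x i) * (h d i - of_int (k * s' i) / of_int (m i)) \<in> Rloc (P i)"
      by (intro Rloc_mult k i) auto
    also have "of_int (x i) * (h d i - of_int (k * s' i) / of_int (m i))
       = of_int (y i * s i - k * x i * s' i) / of_int (m i)"
      using nz i by (simp add: hc d u d_def field_simps)
    finally have "m i dvd y i * s i - k * x i * s' i" using divide_m_iff[OF i] by blast
    then have cong: "[y i * s i = k * x i * s' i] (mod m i)" by (simp only: cong_iff_dvd_diff)
    have "coprime (y i * s i) (m i)"
      using P_number_coprime_m[OF i xy(2)[OF i]] s[OF i] by (simp add: coprime_commute)
    then have "coprime (k * x i * s' i) (m i)"
      using cong by (metis cong_imp_coprime)
    then show ?thesis using cong by auto
  qed
  show ?R
    by (rule exI[of _ x], rule exI[of _ y], rule exI[of _ k]) (use * xy in blast)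
next
  assume ?R
  then obtain x y k where xy: "\<And>i. i \<in> I \<Longrightarrow> P_number (P i) (x i)" "\<And>i. i \<in> I \<Longrightarrow> P_number (P i) (y i)"
    and k: "\<And>i. i \<in> I \<Longrightarrow> coprime k (m i)"
    and cong: "\<And>i. i \<in> I \<Longrightarrow> [y i * s i = k * x i * s' i] (mod m i)" by blast
  \<comment> \<open>The inverse map also needs a single multiplier for all coordinates, so
    \<open>k\<close> is inverted modulo the product of the \<open>m i\<close>.\<close>
  have "coprime k (prod m I)" using k by (intro prod_coprime_right)
  then obtain k' where "[k * k' = 1] (mod prod m I)"
    using cong_solve_coprime_int by blast
  then have k': "[k * k' = 1] (mod m i)" if "i \<in> I" for i
    using that finite by (meson cong_dvd_modulus dvd_prodI)
  have cong': "[x i * s' i = k' * y i * s i] (mod m i)" if i: "i \<in> I" for i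
  proof -
    have "[k' * (y i * s i) = k' * (k * x i * s' i)] (mod m i)"
      by (intro cong_mult cong cong_refl i)
    also have "k' * (k * x i * s' i) = (k * k') * (x i * s' i)" by (simp add: ac_simps)
    also have "[(k * k') * (x i * s' i) = 1 * (x i * s' i)] (mod m i)"
      by (intro cong_mult k' cong_refl i)
    finally show ?thesis by (simp add: cong_sym_eq ac_simps)
  qed
  define h where "h c i = of_int (y i) / of_int (x i) * c i" for c :: "'i \<Rightarrow> rat" and i
  define g where "g c i = of_int (x i) / of_int (y i) * c i" for c :: "'i \<Rightarrow> rat" and i
  have nz: "x i \<noteq> 0" "y i \<noteq> 0" if "i \<in> I" for i using xy[OF that] by (auto simp: P_number_def)
  have h: "h c \<in> K s'" if "c \<in> K s" for c
    unfolding h_def by (rule scale_mem[OF that xy(1) cong])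
  have g: "g c \<in> K s" if "c \<in> K s'" for c
    unfolding g_def by (rule scale_mem[OF that xy(2) cong'])
  have inv: "g (h c) = c" "h (g c) = c" if "\<And>i. i \<notin> I \<Longrightarrow> c i = 0" for c
  proof -
    have "x i = 0 \<or> y i = 0 \<Longrightarrow> c i = 0" for i using nz[of i] that[of i] by blast
    then show "g (h c) = c" "h (g c) = c"
      by (auto simp: g_def h_def fun_eq_iff)
  qed
  have "h \<in> iso (add_group (K s)) (add_group (K s'))"
  proof (intro isoI homI)
    show "bij_betw h (carrier (add_group (K s))) (carrier (add_group (K s')))"
    proof (rule bij_betwI[where g = g])
      show "g (h c) = c" if "c \<in> carrier (add_group (K s))" for c
        using that by (intro inv) (auto simp: std_group_def)
      show "h (g c) = c" if "c \<in> carrier (add_group (K s'))" for c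
        using that by (intro inv) (auto simp: std_group_def)
    qed (auto simp: h g)
  qed (auto simp: h, auto simp: h_def fun_eq_iff ring_distribs add_divide_distrib)
  then show "add_group (K s) \<cong> add_group (K s')" by (rule is_isoI)
qed

text \<open>The numerators of three vectors over \<open>w\<close>, the first from the group of
  \<open>s'\<close>. Two of the three denominators are absorbed by the square of \<open>w\<close>,
  and \<open>s * s' = 1 + w * t\<close> leaves a fractional part proportional to
  \<open>s\<close>.\<close>

lemma product_expansion:
  fixes k :: rat
  assumes "w \<noteq> 0" "s * s' = 1 + w * t"
  shows "(k * s' + w * r) * (k1 * s + w * r1) * (k2 * s + w * r2) / w =
    k * k1 * k2 * s / w + (k * k1 * k2 * s * t + r * (k1 * s + w * r1) * (k2 * s + w * r2)
      + k * s' * r1 * (k2 * s + w * r2) + k * s' * k1 * s * r2)"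
proof -
  have "(k * s' + w * r) * (k1 * s + w * r1) * (k2 * s + w * r2) =
    k * k1 * k2 * s * (s * s') + w * (r * (k1 * s + w * r1) * (k2 * s + w * r2)
      + k * s' * r1 * (k2 * s + w * r2) + k * s' * k1 * s * r2)"
    by (simp add: algebra_simps)
  then show ?thesis using assms(1) unfolding assms(2) by (simp add: field_simps)
qed

text \<open>The multipliers of the three vectors multiply, because \<open>s' * s * s\<close> is
  congruent to \<open>s\<close>.\<close>

lemma diagonal_product_closed:
  assumes c: "c \<in> K s'" and x: "x \<in> K s" and y: "y \<in> K s"
    and inv: "\<And>i. i \<in> I \<Longrightarrow> [s i * s' i = 1] (mod m i)"
  shows "(\<lambda>i. (of_int (m i))\<^sup>2 * c i * x i * y i) \<in> K s"
proof -
  obtain k where c0: "\<And>i. i \<notin> I \<Longrightarrow> c i = 0"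
    and k: "\<And>i. i \<in> I \<Longrightarrow> c i - of_int (k * s' i) / of_int (m i) \<in> Rloc (P i)"
    using std_groupE[OF c] by metis
  obtain k1 where k1: "\<And>i. i \<in> I \<Longrightarrow> x i - of_int (k1 * s i) / of_int (m i) \<in> Rloc (P i)"
    using std_groupE[OF x] by metis
  obtain k2 where k2: "\<And>i. i \<in> I \<Longrightarrow> y i - of_int (k2 * s i) / of_int (m i) \<in> Rloc (P i)"
    using std_groupE[OF y] by metis
  have "(of_int (m i))\<^sup>2 * c i * x i * y i - of_int (k * k1 * k2 * s i) / of_int (m i) \<in> Rloc (P i)"
    if i: "i \<in> I" for i
  proof -
    define r r1 r2 where "r = c i - of_int (k * s' i) / of_int (m i)"
      and "r1 = x i - of_int (k1 * s i) / of_int (m i)"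
      and "r2 = y i - of_int (k2 * s i) / of_int (m i)"
    have r: "r \<in> Rloc (P i)" "r1 \<in> Rloc (P i)" "r2 \<in> Rloc (P i)"
      unfolding r_def r1_def r2_def by (intro k k1 k2 i)+
    obtain t where t: "s i * s' i = 1 + m i * t"
      using inv[OF i] by (metis cong_iff_lin cong_sym)
    have nz: "m i \<noteq> 0" by (rule m_nonzero[OF i])
    have c': "c i = (of_int k * of_int (s' i) + of_int (m i) * r) / of_int (m i)"
      "x i = (of_int k1 * of_int (s i) + of_int (m i) * r1) / of_int (m i)"
      "y i = (of_int k2 * of_int (s i) + of_int (m i) * r2) / of_int (m i)"
      using nz by (auto simp: r_def r1_def r2_def field_simps)
    have t': "of_int (s i) * of_int (s' i) = (1 :: rat) + of_int (m i) * of_int t"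
      using arg_cong[OF t, of "of_int :: int \<Rightarrow> rat"] by simp
    have "(of_int (m i))\<^sup>2 * c i * x i * y i =
      (of_int k * of_int (s' i) + of_int (m i) * r) * (of_int k1 * of_int (s i) + of_int (m i) * r1)
        * (of_int k2 * of_int (s i) + of_int (m i) * r2) / of_int (m i)"
      unfolding c' using nz by (simp add: power2_eq_square)
    also have "\<dots> = of_int (k * k1 * k2 * s i) / of_int (m i)
        + (of_int k * of_int k1 * of_int k2 * of_int (s i) * of_int t
          + r * (of_int k1 * of_int (s i) + of_int (m i) * r1) * (of_int k2 * of_int (s i) + of_int (m i) * r2)
          + of_int k * of_int (s' i) * r1 * (of_int k2 * of_int (s i) + of_int (m i) * r2)
          + of_int k * of_int (s' i) * of_int k1 * of_int (s i) * r2)"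
      using nz product_expansion[OF _ t'] by simp
    finally have "(of_int (m i))\<^sup>2 * c i * x i * y i - of_int (k * k1 * k2 * s i) / of_int (m i) =
        of_int k * of_int k1 * of_int k2 * of_int (s i) * of_int t
          + r * (of_int k1 * of_int (s i) + of_int (m i) * r1) * (of_int k2 * of_int (s i) + of_int (m i) * r2)
          + of_int k * of_int (s' i) * r1 * (of_int k2 * of_int (s i) + of_int (m i) * r2)
          + of_int k * of_int (s' i) * of_int k1 * of_int (s i) * r2"
      by (simp only: add_diff_cancel_left')
    also have "\<dots> \<in> Rloc (P i)"
      using r by (intro Rloc_add Rloc_mult Rloc_intI)
    finally show ?thesis .
  qed
  note * = this
  show ?thesis
  proof (rule std_groupI)
    show "(of_int (m i))\<^sup>2 * c i * x i * y i = 0" if "i \<notin> I" for i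
      using c0[OF that] by simp
  qed (rule *)
qed

text \<open>Diagonality in each argument leaves only coefficients \<open>a i\<close>. Membership of
  \<open>a i / (m i)^2\<close> in the group of \<open>s'\<close> is extracted from values at unit
  vectors and at the generator; \<open>diagonal_product_closed\<close> is the converse.\<close>

lemma Bil_iso:
  assumes s: "\<And>i. i \<in> I \<Longrightarrow> coprime (s i) (m i)"
    and inv: "\<And>i. i \<in> I \<Longrightarrow> [s i * s' i = 1] (mod m i)"
  shows "add_group (K s') \<cong> Bil (K s)"
proof -
  interpret Ks: coord_subgroup I P "K s" by (rule coord_subgroup)
  interpret Ks': coord_subgroup I P "K s'" by (rule coord_subgroup)
  define f where "f c x y i = (of_int (m i))\<^sup>2 * c i * x i * y i" for c x y :: "'i \<Rightarrow> rat" and i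
  define \<Phi> where "\<Phi> c = (\<lambda>p\<in>K s \<times> K s. f c (fst p) (snd p))" for c
  have f: "f c x y \<in> K s" if "c \<in> K s'" "x \<in> K s" "y \<in> K s" for c x y
    unfolding f_def by (intro diagonal_product_closed[OF that inv])
  have \<Phi>: "\<Phi> c \<in> carrier (Bil (K s))" if "c \<in> K s'" for c
    unfolding \<Phi>_def
  proof (rule BilI)
    show "f c x y \<in> K s" if "x \<in> K s" "y \<in> K s" for x y using f[OF \<open>c \<in> K s'\<close> that] .
  qed (auto simp: f_def fun_eq_iff algebra_simps Ks.subgroup)
  have s1: "single i 1 \<in> K s" if "i \<in> I" for i
    using Ks.single[OF that, of 1] by auto
  have "inj_on \<Phi> (K s')"
  proof (rule inj_onI)
    fix c c' assume cc': "c \<in> K s'" "c' \<in> K s'" "\<Phi> c = \<Phi> c'"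
    show "c = c'"
    proof
      fix i show "c i = c' i"
      proof (cases "i \<in> I")
        case True
        then have "\<Phi> c (single i 1, single i 1) i = \<Phi> c' (single i 1, single i 1) i"
          using cc' by simp
        then show ?thesis using s1[OF True] m_nonzero[OF True]
          by (simp add: \<Phi>_def f_def single_apply)
      next
        case False
        then show ?thesis using Ks'.support[OF cc'(1) False] Ks'.support[OF cc'(2) False] by simp
      qed
    qed
  qed
  moreover have "\<exists>c\<in>K s'. \<mu> = \<Phi> c" if \<mu>: "\<mu> \<in> carrier (Bil (K s))" for \<mu>
  proof -
    define a where "a i = \<mu> (single i 1, single i 1) i" for i
    have left: "additive_on (K s) (\<lambda>x. \<mu> (x, y))" "(\<lambda>x. \<mu> (x, y)) ` K s \<subseteq> K s" if "y \<in> K s" for y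
      using that by (auto simp: additive_on_def Ks.subgroup Bil_add_left[OF \<mu>] Bil_closed[OF \<mu>])
    have right: "additive_on (K s) (\<lambda>y. \<mu> (x, y))" "(\<lambda>y. \<mu> (x, y)) ` K s \<subseteq> K s" if "x \<in> K s" for x
      using that by (auto simp: additive_on_def Ks.subgroup Bil_add_right[OF \<mu>] Bil_closed[OF \<mu>])
    have \<mu>_eq: "\<mu> (x, y) i = a i * x i * y i" if "x \<in> K s" "y \<in> K s" "i \<in> I" for x y i
    proof -
      have "\<mu> (x, y) i = \<mu> (single i 1, y) i * x i"
        using additive_coord[OF left[OF that(2)] that(1,3)] .
      also have "\<mu> (single i 1, y) i = a i * y i"
        using additive_coord[OF right[OF s1[OF that(3)]] that(2,3)] unfolding a_def .
      finally show ?thesis by simp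
    qed
    define d where "d i = (if i \<in> I then of_int (s i) / of_int (m i) else 0 :: rat)" for i
    have d: "d \<in> K s" unfolding d_def by (rule generator_mem)
    have aR: "a i \<in> Rloc (P i)" if i: "i \<in> I" for i
      unfolding a_def
      by (rule block_pure[OF Bil_closed[OF \<mu> s1[OF i] s1[OF i]] s i])
        (auto simp: \<mu>_eq s1[OF i] single_apply)
    \<comment> \<open>The product of the generator with a unit vector is supported on one
      coordinate, so it lies in the ring although it carries the factor \<open>s i / m i\<close>;
      \<open>s i\<close> is then removed by coprimality.\<close>
    have b: "a i / of_int (m i) \<in> Rloc (P i)" if i: "i \<in> I" for i
    proof (rule rat_subgroup.coprime_divide[OF rat_subgroup_Rloc s[OF i] m_nonzero[OF i] aR[OF i]])
      have "\<mu> (d, single i 1) i \<in> Rloc (P i)"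
        by (rule block_pure[OF Bil_closed[OF \<mu> d s1[OF i]] s i])
          (auto simp: \<mu>_eq s1[OF i] d single_apply)
      then show "of_int (s i) * a i / of_int (m i) \<in> Rloc (P i)"
        using i by (simp add: \<mu>_eq d s1[OF i] single_apply d_def mult.commute)
    qed
    obtain k where k: "\<And>i. i \<in> I \<Longrightarrow> \<mu> (d, d) i - of_int (k * s i) / of_int (m i) \<in> Rloc (P i)"
      using std_groupE[OF Bil_closed[OF \<mu> d d]] by metis
    define c where "c i = (if i \<in> I then a i / (of_int (m i))\<^sup>2 else 0)" for i
    have "c i - of_int (k * s' i) / of_int (m i) \<in> Rloc (P i)" if i: "i \<in> I" for i
    proof -
      obtain t where t: "s i * s' i = 1 + m i * t"
        using inv[OF i] by (metis cong_iff_lin cong_sym)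
      have t': "of_int (s i) * of_int (s' i) = (1 :: rat) + of_int (m i) * of_int t"
        using arg_cong[OF t, of "of_int :: int \<Rightarrow> rat"] by simp
      have nz: "m i \<noteq> 0" by (rule m_nonzero[OF i])
      define b where "b = a i / of_int (m i)"
      have a: "a i = b * of_int (m i)" using nz by (simp add: b_def)
      \<comment> \<open>Multiplication by the square of \<open>s'\<close> cancels the two factors
        \<open>s i\<close> contributed by the generator and turns \<open>k * s i\<close> into
        \<open>k * s' i\<close>, up to ring elements.\<close>
      have "of_int (s' i) * of_int (s' i) * (\<mu> (d, d) i - of_int (k * s i) / of_int (m i)) =
        (b * (of_int (s i) * of_int (s' i)) * (of_int (s i) * of_int (s' i))
          - of_int k * of_int (s' i) * (of_int (s i) * of_int (s' i))) / of_int (m i)"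
        using nz i by (simp add: \<mu>_eq d d_def a field_simps)
      also have "\<dots> = (b - of_int k * of_int (s' i)) / of_int (m i)
          + (b * (2 * of_int t + of_int (m i) * of_int t * of_int t) - of_int k * of_int (s' i) * of_int t)"
        unfolding t' using nz by (simp add: field_simps)
      finally have "(b - of_int k * of_int (s' i)) / of_int (m i) =
          of_int (s' i) * of_int (s' i) * (\<mu> (d, d) i - of_int (k * s i) / of_int (m i))
          - (b * of_int (2 * t + m i * t * t) - of_int (k * s' i * t))"
        by (simp add: algebra_simps)
      also have "\<dots> \<in> Rloc (P i)"
        using b[OF i] unfolding b_def by (intro Rloc_diff Rloc_mult Rloc_intI k i)
      finally show ?thesis using nz i by (simp add: c_def a power2_eq_square field_simps)
    qed
    then have "c \<in> K s'" by (intro std_groupI[where k = k]) (auto simp: c_def)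
    moreover have "\<mu> = \<Phi> c"
    proof (rule Bil_eqI[OF \<mu> \<Phi>[OF \<open>c \<in> K s'\<close>]], rule ext)
      fix x y i assume xy: "x \<in> K s" "y \<in> K s"
      show "\<mu> (x, y) i = \<Phi> c (x, y) i"
      proof (cases "i \<in> I")
        case True
        then show ?thesis using xy m_nonzero[OF True]
          by (simp add: \<mu>_eq \<Phi>_def f_def c_def)
      next
        case False
        then show ?thesis using xy Ks.support[OF Bil_closed[OF \<mu> xy] False]
          by (simp add: \<Phi>_def f_def c_def)
      qed
    qed
    ultimately show ?thesis by blast
  qed
  ultimately have "bij_betw \<Phi> (K s') (carrier (Bil (K s)))"
    using \<Phi> by (auto simp: bij_betw_def)
  moreover have "\<Phi> (c + c') = \<Phi> c \<otimes>\<^bsub>Bil (K s)\<^esub> \<Phi> c'" for c c'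
    by (auto simp: \<Phi>_def Bil_mult f_def fun_eq_iff algebra_simps)
  ultimately have "\<Phi> \<in> iso (add_group (K s')) (Bil (K s))"
    using \<Phi> by (intro isoI homI) auto
  then show ?thesis by (rule is_isoI)
qed

end

section \<open>Multiplications as bilinear maps\<close>

lemma tensor_relatorsI:
  shows "x \<in> A \<Longrightarrow> x' \<in> A \<Longrightarrow> y \<in> B \<Longrightarrow>
      frag_of (x + x', y) - frag_of (x, y) - frag_of (x', y) \<in> tensor_relators A B"
    and "x \<in> A \<Longrightarrow> y \<in> B \<Longrightarrow> y' \<in> B \<Longrightarrow>
      frag_of (x, y + y') - frag_of (x, y) - frag_of (x, y') \<in> tensor_relators A B"
  unfolding tensor_relators_def by blast+

lemma tensor_relatorsE:
  assumes "r \<in> tensor_relators A B"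
  obtains (left) x x' y where "x \<in> A" "x' \<in> A" "y \<in> B"
      "r = frag_of (x + x', y) - frag_of (x, y) - frag_of (x', y)"
    | (right) x y y' where "x \<in> A" "y \<in> B" "y' \<in> B"
      "r = frag_of (x, y + y') - frag_of (x, y) - frag_of (x, y')"
  using assms unfolding tensor_relators_def by blast

lemma keys_tensor_relators:
  assumes "r \<in> tensor_relators G G" "add_subgroup G"
  shows "Poly_Mapping.keys r \<subseteq> G \<times> G"
proof -
  have "Poly_Mapping.keys (frag_of a - frag_of b - frag_of c) \<subseteq> {a, b, c}" for a b c :: "'a \<times> 'a"
    using keys_diff[of "frag_of a - frag_of b" "frag_of c"] keys_diff[of "frag_of a" "frag_of b"]
    by auto
  then have key: "Poly_Mapping.keys (frag_of a - frag_of b - frag_of c) \<subseteq> G \<times> G"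
    if "a \<in> G \<times> G" "b \<in> G \<times> G" "c \<in> G \<times> G" for a b c :: "'a \<times> 'a"
    using that by blast
  from assms(1) show ?thesis
    by (cases rule: tensor_relatorsE) (simp_all add: key add_subgroup_add[OF assms(2)])
qed

lemma group_tensor:
  assumes "add_subgroup G" shows "group (tensor G G)"
proof -
  interpret F: comm_group "free_Abelian_group (G \<times> G)" by (rule abelian_free_Abelian_group)
  have "tensor_relators G G \<subseteq> carrier (free_Abelian_group (G \<times> G))"
    using keys_tensor_relators[OF _ assms] by auto
  then show ?thesis unfolding tensor_def
    by (intro normal.factorgroup_is_group F.subgroup_imp_normal F.generate_is_subgroup)
qed

text \<open>The universal property of the tensor product. Injectivity holds since the classes of the
  free generators generate the quotient; for surjectivity a bilinear map is extended to the free
  group, where it kills the relators.\<close>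

lemma Mult_iso_Bil:
  fixes G :: "'a::ab_group_add set"
  assumes G: "add_subgroup G"
  shows "Mult G \<cong> Bil G"
proof -
  define F where "F = free_Abelian_group (G \<times> G)"
  define N where "N = generate F (tensor_relators G G)"
  \<comment> \<open>The pure tensor of the pair \<open>p\<close>.\<close>
  define cls where "cls p = N #>\<^bsub>F\<^esub> frag_of p" for p
  interpret F: comm_group F unfolding F_def by (rule abelian_free_Abelian_group)
  have rel: "tensor_relators G G \<subseteq> carrier F"
    unfolding F_def using keys_tensor_relators[OF _ G] by auto
  have N: "subgroup N F" unfolding N_def by (rule F.generate_is_subgroup[OF rel])
  have normal: "N \<lhd> F" using N by (rule F.subgroup_imp_normal)
  have T: "tensor G G = F Mod N" by (simp add: tensor_def F_def N_def)
  have cosF: "(\<lambda>x. N #>\<^bsub>F\<^esub> x) \<in> hom F (F Mod N)"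
    by (rule normal.r_coset_hom_Mod[OF normal])
  have FG: "group (F Mod N)" using group_tensor[OF G] by (simp only: T)
  have cls_carrier: "cls p \<in> carrier (F Mod N)" if "p \<in> G \<times> G" for p
    unfolding cls_def using that by (auto simp: carrier_FactGroup F_def)
  have cls_eq: "cls a = cls b \<otimes>\<^bsub>F Mod N\<^esub> cls c"
    if "frag_of a - frag_of b - frag_of c \<in> tensor_relators G G" "a \<in> G \<times> G" "b \<in> G \<times> G" "c \<in> G \<times> G"
    for a b c
  proof -
    have bc: "frag_of b + frag_of c \<in> carrier F" using that keys_add[of "frag_of b" "frag_of c"] by (auto simp: F_def)
    have a: "frag_of a \<in> carrier F" using that by (auto simp: F_def)
    have "inv\<^bsub>F\<^esub> (frag_of b + frag_of c) = - (frag_of b + frag_of c)"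
      using bc unfolding F_def by (intro inv_free_Abelian_group) simp
    then have "frag_of a \<otimes>\<^bsub>F\<^esub> inv\<^bsub>F\<^esub> (frag_of b + frag_of c) = frag_of a - frag_of b - frag_of c"
      by (simp add: F_def)
    also have "\<dots> \<in> N" unfolding N_def using that(1) by (rule generate.incl)
    finally have "frag_of a \<in> N #>\<^bsub>F\<^esub> (frag_of b + frag_of c)"
      using subgroup.rcos_module_rev[OF N F.is_group bc a] by simp
    then have "N #>\<^bsub>F\<^esub> (frag_of b + frag_of c) = cls a"
      unfolding cls_def by (rule F.repr_independence[OF _ bc N])
    moreover have "N #>\<^bsub>F\<^esub> (frag_of b \<otimes>\<^bsub>F\<^esub> frag_of c) = cls b \<otimes>\<^bsub>F Mod N\<^esub> cls c"
      unfolding cls_def using that by (intro hom_mult[OF cosF]) (auto simp: F_def)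
    ultimately show ?thesis by (simp add: F_def)
  qed
  have cls_left: "cls (x + x', y) = cls (x, y) \<otimes>\<^bsub>F Mod N\<^esub> cls (x', y)"
    if "x \<in> G" "x' \<in> G" "y \<in> G" for x x' y
    using that by (intro cls_eq tensor_relatorsI) (auto simp: add_subgroup_add[OF G])
  have cls_right: "cls (x, y + y') = cls (x, y) \<otimes>\<^bsub>F Mod N\<^esub> cls (x, y')"
    if "x \<in> G" "y \<in> G" "y' \<in> G" for x y y'
    using that by (intro cls_eq tensor_relatorsI) (auto simp: add_subgroup_add[OF G])
  define \<Phi> where "\<Phi> f = (\<lambda>p\<in>G \<times> G. f (cls p))" for f :: "('a \<times> 'a \<Rightarrow>\<^sub>0 int) set \<Rightarrow> 'a"
  have car: "carrier (Mult G) = hom (F Mod N) (add_group G) \<inter> extensional (carrier (F Mod N))"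
    by (simp add: Mult_def Hom_def T)
  have mult: "f \<otimes>\<^bsub>Mult G\<^esub> g = (\<lambda>x\<in>carrier (F Mod N). f x + g x)" for f g
    by (simp add: Mult_def Hom_def T)
  have f_mult: "f (u \<otimes>\<^bsub>F Mod N\<^esub> v) = f u + f v"
    if "f \<in> carrier (Mult G)" "u \<in> carrier (F Mod N)" "v \<in> carrier (F Mod N)" for f u v
    using that unfolding car hom_def by (auto simp: Pi_def)
  have f_closed: "f u \<in> G" if "f \<in> carrier (Mult G)" "u \<in> carrier (F Mod N)" for f u
    using that unfolding car hom_def by (auto simp: Pi_def)
  have \<Phi>: "\<Phi> f \<in> carrier (Bil G)" if "f \<in> carrier (Mult G)" for f
  proof -
    have "(\<lambda>p\<in>G \<times> G. f (cls (fst p, snd p))) \<in> carrier (Bil G)"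
      by (rule BilI[of G "\<lambda>x y. f (cls (x, y))", OF _ _ _ G])
        (use that in \<open>simp_all add: cls_left cls_right f_mult f_closed cls_carrier del: mult_FactGroup\<close>)
    then show ?thesis by (simp add: \<Phi>_def)
  qed
  have inj: "inj_on \<Phi> (carrier (Mult G))"
  proof (rule inj_onI)
    fix f g assume f: "f \<in> carrier (Mult G)" and g: "g \<in> carrier (Mult G)" and eq: "\<Phi> f = \<Phi> g"
    interpret f: group_hom "F Mod N" "add_group G" f
      using f FG group_add_group[OF G]
      by (auto simp: car group_hom_def group_hom_axioms_def)
    interpret g: group_hom "F Mod N" "add_group G" g
      using g FG group_add_group[OF G]
      by (auto simp: car group_hom_def group_hom_axioms_def)
    interpret c: group_hom F "F Mod N" "\<lambda>x. N #>\<^bsub>F\<^esub> x"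
      using cosF FG F.is_group by (auto simp: group_hom_def group_hom_axioms_def)
    have "f (N #>\<^bsub>F\<^esub> x) = g (N #>\<^bsub>F\<^esub> x)" if "Poly_Mapping.keys x \<subseteq> G \<times> G" for x
    proof (rule free_Abelian_group_induct[OF that])
      have "N #>\<^bsub>F\<^esub> 0 = \<one>\<^bsub>F Mod N\<^esub>" using c.hom_one by (simp add: F_def)
      then show "f (N #>\<^bsub>F\<^esub> 0) = g (N #>\<^bsub>F\<^esub> 0)" using f.hom_one g.hom_one by simp
    next
      fix x y assume keys: "Poly_Mapping.keys x \<subseteq> G \<times> G" "Poly_Mapping.keys y \<subseteq> G \<times> G"
        and eq: "f (N #>\<^bsub>F\<^esub> x) = g (N #>\<^bsub>F\<^esub> x)" "f (N #>\<^bsub>F\<^esub> y) = g (N #>\<^bsub>F\<^esub> y)"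
      have xy: "x \<in> carrier F" "y \<in> carrier F" using keys by (auto simp: F_def)
      have "x - y = x \<otimes>\<^bsub>F\<^esub> inv\<^bsub>F\<^esub> y" using keys(2) by (simp add: F_def)
      then have "N #>\<^bsub>F\<^esub> (x - y) = (N #>\<^bsub>F\<^esub> x) \<otimes>\<^bsub>F Mod N\<^esub> inv\<^bsub>F Mod N\<^esub> (N #>\<^bsub>F\<^esub> y)"
        using xy by (simp only: c.hom_mult c.hom_inv F.inv_closed)
      then show "f (N #>\<^bsub>F\<^esub> (x - y)) = g (N #>\<^bsub>F\<^esub> (x - y))" using eq xy c.hom_closed
        by (simp only: f.hom_mult g.hom_mult f.hom_inv g.hom_inv f.G.inv_closed)
    next
      fix p assume "p \<in> G \<times> G"
      then show "f (N #>\<^bsub>F\<^esub> frag_of p) = g (N #>\<^bsub>F\<^esub> frag_of p)" using fun_cong[OF eq, of p] by (simp add: \<Phi>_def cls_def)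
    qed
    then have "f u = g u" if "u \<in> carrier (F Mod N)" for u
      using that by (auto simp: carrier_FactGroup F_def)
    then show "f = g" using f g by (auto simp: car intro: extensionalityI)
  qed
  have surj: "\<exists>f\<in>carrier (Mult G). \<Phi> f = \<mu>" if \<mu>: "\<mu> \<in> carrier (Bil G)" for \<mu>
  proof -
    interpret A: comm_group "add_group G" by (rule comm_group_add_group[OF G])
    obtain h where h: "h \<in> hom F (add_group G)" "\<And>p. p \<in> G \<times> G \<Longrightarrow> h (frag_of p) = \<mu> p"
      using A.free_Abelian_group_universal[of \<mu> "G \<times> G"] Bil_closed[OF \<mu>] unfolding F_def by auto
    interpret h: group_hom F "add_group G" h
      using h F.is_group A.is_group by (auto simp: group_hom_def group_hom_axioms_def)
    have h_diff: "h (x - y) = h x - h y" if "x \<in> carrier F" "y \<in> carrier F" for x y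
    proof -
      have "x - y = x \<otimes>\<^bsub>F\<^esub> inv\<^bsub>F\<^esub> y" using that by (simp add: F_def)
      also have "h \<dots> = h x - h y"
        using that h.hom_closed[OF that(2)]
        by (simp only: h.hom_mult h.hom_inv F.inv_closed) (simp add: inv_add_group[OF G])
      finally show ?thesis .
    qed
    have h_rel: "h (frag_of a - frag_of b - frag_of c) = \<mu> a - \<mu> b - \<mu> c"
      if "a \<in> G \<times> G" "b \<in> G \<times> G" "c \<in> G \<times> G" for a b c
    proof -
      have "frag_of a - frag_of b \<in> carrier F"
        using that keys_diff[of "frag_of a" "frag_of b"] by (auto simp: F_def)
      moreover have "frag_of a \<in> carrier F" "frag_of b \<in> carrier F" "frag_of c \<in> carrier F"
        using that by (auto simp: F_def)
      ultimately show ?thesis using that by (simp only: h_diff h(2))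
    qed
    have "h r = 0" if "r \<in> tensor_relators G G" for r
      using that by (cases rule: tensor_relatorsE)
        (simp_all add: h_rel Bil_add_left[OF \<mu>] Bil_add_right[OF \<mu>] add_subgroup_add[OF G])
    then have "tensor_relators G G \<subseteq> kernel F (add_group G) h"
      using rel unfolding kernel_def by auto
    then have "N \<subseteq> kernel F (add_group G) h"
      unfolding N_def by (rule F.generate_subgroup_incl[OF _ h.subgroup_kernel])
    then obtain g where g: "g \<in> hom (F Mod N) (add_group G)" "\<And>x. x \<in> carrier F \<Longrightarrow> g (N #>\<^bsub>F\<^esub> x) = h x"
      using h.FactGroup_universal_kernel[OF normal] by metis
    define f where "f = restrict g (carrier (F Mod N))"
    have "f \<in> carrier (Mult G)"
      using g(1) FG by (auto simp: car f_def hom_def group.is_monoid monoid.m_closed simp del: mult_FactGroup)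
    moreover have "\<Phi> f = \<mu>"
    proof (rule Bil_eqI[OF \<Phi>[OF calculation] \<mu>])
      fix x y assume xy: "x \<in> G" "y \<in> G"
      then have "f (cls (x, y)) = g (N #>\<^bsub>F\<^esub> frag_of (x, y))"
        using cls_carrier[of "(x, y)"] by (simp add: f_def cls_def)
      also have "\<dots> = \<mu> (x, y)" using g(2)[of "frag_of (x, y)"] h(2)[of "(x, y)"] xy by (simp add: F_def)
      finally show "\<Phi> f (x, y) = \<mu> (x, y)" using xy by (simp add: \<Phi>_def)
    qed
    ultimately show ?thesis by blast
  qed
  have "\<Phi> \<in> iso (Mult G) (Bil G)"
  proof (intro isoI homI)
    show "bij_betw \<Phi> (carrier (Mult G)) (carrier (Bil G))"
      using inj \<Phi> surj unfolding bij_betw_def by blast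
    show "\<Phi> (f \<otimes>\<^bsub>Mult G\<^esub> g) = \<Phi> f \<otimes>\<^bsub>Bil G\<^esub> \<Phi> g" for f g
      by (auto simp: \<Phi>_def Bil_mult mult fun_eq_iff cls_carrier)
  qed (rule \<Phi>)
  then show ?thesis by (rule is_isoI)
qed

text \<open>For the inverse bijection to be a homomorphism it is enough that \<open>Mult G\<close>
  is closed under its operation; its group laws need not be established.\<close>

lemma Bil_iso_Mult:
  assumes G: "add_subgroup G" shows "Bil G \<cong> Mult G"
proof -
  obtain \<Phi> where \<Phi>: "\<Phi> \<in> iso (Mult G) (Bil G)" using Mult_iso_Bil[OF G] by (auto simp: is_iso_def)
  have hom: "\<Phi> (f \<otimes>\<^bsub>Mult G\<^esub> g) = \<Phi> f \<otimes>\<^bsub>Bil G\<^esub> \<Phi> g"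
    if "f \<in> carrier (Mult G)" "g \<in> carrier (Mult G)" for f g
    using \<Phi> that by (auto simp: iso_def hom_def)
  have bij: "bij_betw \<Phi> (carrier (Mult G)) (carrier (Bil G))" using \<Phi> by (auto simp: iso_def)
  interpret T: group "tensor G G" by (rule group_tensor[OF G])
  have closed: "f \<otimes>\<^bsub>Mult G\<^esub> g \<in> carrier (Mult G)"
    if "f \<in> carrier (Mult G)" "g \<in> carrier (Mult G)" for f g
    using that by (auto simp: Mult_def Hom_def hom_def Pi_def add_subgroup_add[OF G])
  define \<Psi> where "\<Psi> = inv_into (carrier (Mult G)) \<Phi>"
  have \<Psi>: "\<Psi> \<mu> \<in> carrier (Mult G)" "\<Phi> (\<Psi> \<mu>) = \<mu>" if "\<mu> \<in> carrier (Bil G)" for \<mu>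
    using that bij unfolding \<Psi>_def by (auto simp: bij_betw_def inv_into_into f_inv_into_f)
  have \<Psi>\<Phi>: "\<Psi> (\<Phi> f) = f" if "f \<in> carrier (Mult G)" for f
    using that bij unfolding \<Psi>_def by (simp add: bij_betw_def)
  have "\<Psi> \<in> iso (Bil G) (Mult G)"
  proof (intro isoI homI)
    fix \<mu> \<nu> assume \<mu>\<nu>: "\<mu> \<in> carrier (Bil G)" "\<nu> \<in> carrier (Bil G)"
    have "\<Psi> (\<Phi> (\<Psi> \<mu> \<otimes>\<^bsub>Mult G\<^esub> \<Psi> \<nu>)) = \<Psi> \<mu> \<otimes>\<^bsub>Mult G\<^esub> \<Psi> \<nu>"
      by (intro \<Psi>\<Phi> closed \<Psi> \<mu>\<nu>)
    then show "\<Psi> (\<mu> \<otimes>\<^bsub>Bil G\<^esub> \<nu>) = \<Psi> \<mu> \<otimes>\<^bsub>Mult G\<^esub> \<Psi> \<nu>"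
      using \<mu>\<nu> by (simp add: hom \<Psi>)
  next
    show "bij_betw \<Psi> (carrier (Bil G)) (carrier (Mult G))"
      unfolding \<Psi>_def by (rule bij_betw_inv_into[OF bij])
  qed (rule \<Psi>)
  then show ?thesis by (rule is_isoI)
qed

section \<open>Idempotent types\<close>

lemma enat_eqI:
  assumes "\<And>k. enat k \<le> a \<longleftrightarrow> enat k \<le> b" shows "a = b"
proof (rule antisym)
  show "a \<le> b" using assms by (cases a; cases b) (auto dest: spec[of _ "Suc _"] simp: not_le[symmetric], metis Suc_n_not_le_n enat_ord_simps(1))
  show "b \<le> a" using assms by (cases a; cases b) (auto simp: not_le[symmetric], metis Suc_n_not_le_n enat_ord_simps(1))
qed

lemma height_iso:
  assumes "additive_on X \<phi>" "inj_on \<phi> X" "x \<in> X"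
  shows "height (\<phi> ` X) (\<phi> x) = height X x"
proof
  fix p
  interpret additive_on X \<phi> by fact
  have "(\<exists>y\<in>\<phi> ` X. zmul k y = \<phi> x) \<longleftrightarrow> (\<exists>y\<in>X. zmul k y = x)" for k
    using assms(2,3) by (auto simp: inj_on_eq_iff add_subgroup_zmul[OF subgroup] simp flip: zmul)
  then show "height (\<phi> ` X) (\<phi> x) p = height X x p" by (simp add: height_def)
qed

lemma type_of_iso:
  assumes "additive_on X \<phi>" "inj_on \<phi> X"
  shows "type_of (\<phi> ` X) = type_of X"
proof -
  interpret additive_on X \<phi> by fact
  have "\<phi> x = 0 \<longleftrightarrow> x = 0" if "x \<in> X" for x
    using inj_on_eq_iff[OF assms(2) that add_subgroup_zero[OF subgroup]] by (simp add: zero)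
  then show ?thesis using height_iso[OF assms] by (auto simp: type_of_def)
qed

lemma coprime_prime_power:
  assumes "prime p" "\<not> int p dvd a" shows "coprime a (int p ^ k)"
proof -
  have "coprime (int p) a" using assms by (intro prime_imp_coprime) auto
  then show ?thesis by (simp add: coprime_commute)
qed

lemma prime_power_decompose:
  assumes "prime p" "a \<noteq> 0"
  obtains c where "a = int p ^ multiplicity (int p) a * c" "\<not> int p dvd c"
proof -
  have "\<not> is_unit (int p)" using assms(1) by auto
  with assms(2) show thesis using multiplicity_decompose'[of a "int p"] that by blast
qed

lemma char_equiv_refl: "char_equiv \<chi> \<chi>"
  by (simp add: char_equiv_def)

lemma char_equiv_sym: "char_equiv \<chi> \<psi> \<Longrightarrow> char_equiv \<psi> \<chi>"
  unfolding char_equiv_def by (simp add: eq_commute)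

lemma char_equiv_trans:
  assumes "char_equiv \<chi> \<psi>" "char_equiv \<psi> \<rho>" shows "char_equiv \<chi> \<rho>"
proof -
  have "{p. prime p \<and> \<chi> p \<noteq> \<rho> p} \<subseteq> {p. prime p \<and> \<chi> p \<noteq> \<psi> p} \<union> {p. prime p \<and> \<psi> p \<noteq> \<rho> p}"
    by auto
  then have "finite {p. prime p \<and> \<chi> p \<noteq> \<rho> p}"
    using assms unfolding char_equiv_def by (meson finite_UnI finite_subset)
  then show ?thesis using assms unfolding char_equiv_def by metis
qed

lemma char_equiv_infinite: "char_equiv \<chi> \<psi> \<Longrightarrow> prime p \<Longrightarrow> \<chi> p = \<infinity> \<longleftrightarrow> \<psi> p = \<infinity>"
  unfolding char_equiv_def by metis

section \<open>Heights in subgroups of the rationals\<close>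

context rat_subgroup
begin

lemma divide_coprime_mult:
  assumes "coprime a b" "a \<noteq> 0" "b \<noteq> 0" "x / of_int a \<in> Q" "x / of_int b \<in> Q"
  shows "x / of_int (a * b) \<in> Q"
proof -
  obtain u w where "u * a + w * b = 1"
    using bezout_int[of a b] assms(1) by auto
  then have 1: "of_int u * of_int a + of_int w * of_int b = (1::rat)"
    by (simp flip: of_int_mult of_int_add)
  have "x / of_int (a * b) = (of_int u * of_int a + of_int w * of_int b) * (x / of_int (a * b))"
    unfolding 1 by simp
  also have "\<dots> = of_int u * (x / of_int b) + of_int w * (x / of_int a)"
    using assms(2,3) by (simp add: field_simps)
  also have "\<dots> \<in> Q" using assms by (intro add_subgroup_add[OF subgroup] int_mult)
  finally show ?thesis .
qed

text \<open>The admissible exponents form an initial segment, so a supremum of at least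
  \<open>k\<close> already makes \<open>k\<close> admissible, even when it is infinite.\<close>

lemma enat_le_height:
  assumes p: "prime p" and x: "x \<in> Q"
  shows "enat k \<le> height Q x p \<longleftrightarrow> x / of_nat p ^ k \<in> Q"
proof -
  have p0: "p \<noteq> 0" using p by auto
  have set: "{enat k | k. \<exists>y\<in>Q. zmul (int (p ^ k)) y = x} = enat ` {k. x / of_nat p ^ k \<in> Q}"
  proof -
    have "(\<exists>y\<in>Q. zmul (int (p ^ k)) y = x) \<longleftrightarrow> x / of_nat p ^ k \<in> Q" for k
    proof
      assume "\<exists>y\<in>Q. zmul (int (p ^ k)) y = x"
      then obtain y where "y \<in> Q" "of_nat p ^ k * y = x" by (auto simp: zmul_rat)
      then show "x / of_nat p ^ k \<in> Q" using p0 by auto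
    next
      assume "x / of_nat p ^ k \<in> Q"
      then show "\<exists>y\<in>Q. zmul (int (p ^ k)) y = x"
        using p0 by (intro bexI[of _ "x / of_nat p ^ k"]) (auto simp: zmul_rat)
    qed
    then show ?thesis by auto
  qed
  show ?thesis
  proof
    assume "x / of_nat p ^ k \<in> Q"
    then show "enat k \<le> height Q x p" unfolding height_def set by (intro Sup_upper) auto
  next
    assume le: "enat k \<le> height Q x p"
    show "x / of_nat p ^ k \<in> Q"
    proof (rule ccontr)
      assume not: "x / of_nat p ^ k \<notin> Q"
      \<comment> \<open>\<open>x\<close> itself lies in \<open>Q\<close>, so \<open>k\<close> is
        positive and \<open>k - 1\<close> is a true predecessor.\<close>
      then have "k \<noteq> 0" using x by (intro notI) simp
      have "k' \<le> k - 1" if "x / of_nat p ^ k' \<in> Q" for k'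
      proof (rule ccontr)
        assume "\<not> k' \<le> k - 1"
        then have "k \<le> k'" by simp
        then obtain j where "k' = k + j" using le_Suc_ex by blast
        then have "of_int (int p ^ j) * (x / of_nat p ^ k') = x / of_nat p ^ k"
          using p0 by (simp add: power_add)
        then show False using not int_mult[OF that, of "int p ^ j"] by simp
      qed
      then have "height Q x p \<le> enat (k - 1)" unfolding height_def set by (intro Sup_least) auto
      then have "enat k \<le> enat (k - 1)" using le by (rule order_trans[rotated])
      then show False using \<open>k \<noteq> 0\<close> by simp
    qed
  qed
qed

lemma height_eq_infinity:
  assumes "prime p" "x \<in> Q"
  shows "height Q x p = \<infinity> \<longleftrightarrow> (\<forall>k. x / of_nat p ^ k \<in> Q)"
  unfolding enat_le_height[OF assms, symmetric]
proof (cases "height Q x p")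
  case (enat n)
  then show "height Q x p = \<infinity> \<longleftrightarrow> (\<forall>k. enat k \<le> height Q x p)"
    by (auto intro!: exI[of _ "Suc n"])
qed auto

text \<open>A prime not dividing \<open>a\<close> sees no change. At the finitely many others it
  suffices that an infinite height neither appears nor disappears.\<close>

lemma height_mult:
  assumes a: "a \<noteq> 0" and x: "x \<in> Q"
  shows "char_equiv (height Q (of_int a * x)) (height Q x)"
proof -
  have ax: "of_int a * x \<in> Q" using x by (rule int_mult)
  have eq: "height Q (of_int a * x) p = height Q x p" if p: "prime p" "\<not> int p dvd a" for p
  proof (rule enat_eqI)
    fix k
    have "coprime a (int p ^ k)"
      using p by (rule coprime_prime_power)
    then have "of_int a * x / of_nat p ^ k \<in> Q \<Longrightarrow> x / of_nat p ^ k \<in> Q"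
      using coprime_divide[of a "int p ^ k" x] x p by auto
    moreover have "x / of_nat p ^ k \<in> Q \<Longrightarrow> of_int a * x / of_nat p ^ k \<in> Q"
      using int_mult[of "x / of_nat p ^ k" a] by simp
    ultimately show "enat k \<le> height Q (of_int a * x) p \<longleftrightarrow> enat k \<le> height Q x p"
      using p by (auto simp: enat_le_height x ax)
  qed
  have inf: "height Q (of_int a * x) p = \<infinity> \<longleftrightarrow> height Q x p = \<infinity>" if p: "prime p" for p
  proof
    assume "height Q x p = \<infinity>"
    then have "\<forall>k. x / of_nat p ^ k \<in> Q" using p x by (simp add: height_eq_infinity)
    then have "\<forall>k. of_int a * x / of_nat p ^ k \<in> Q"
      using int_mult[of "x / of_nat p ^ _" a] by simp
    then show "height Q (of_int a * x) p = \<infinity>" using p ax by (simp add: height_eq_infinity)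
  next
    assume "height Q (of_int a * x) p = \<infinity>"
    then have all: "of_int a * x / of_nat p ^ k \<in> Q" for k using p ax by (simp add: height_eq_infinity)
    obtain b l where b: "a = int p ^ l * b" "\<not> int p dvd b"
      using prime_power_decompose[OF p a] by blast
    have "x / of_nat p ^ k \<in> Q" for k
    proof -
      have "of_int a * x / of_nat p ^ (l + k) = of_int b * x / of_int (int p ^ k)"
        using p by (simp add: b(1) power_add prime_gt_0_nat)
      then have "of_int b * x / of_int (int p ^ k) \<in> Q" using all[of "l + k"] by simp
      moreover have "coprime b (int p ^ k)"
        using p b(2) by (rule coprime_prime_power)
      ultimately have "x / of_int (int p ^ k) \<in> Q" using coprime_divide[of b "int p ^ k" x] x p by simp
      then show ?thesis by simp
    qed
    then show "height Q x p = \<infinity>" using p x by (simp add: height_eq_infinity)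
  qed
  have "{p. prime p \<and> height Q (of_int a * x) p \<noteq> height Q x p} \<subseteq> {..nat \<bar>a\<bar>}"
  proof
    fix p assume "p \<in> {p. prime p \<and> height Q (of_int a * x) p \<noteq> height Q x p}"
    then have "int p dvd a" using eq by auto
    then show "p \<in> {..nat \<bar>a\<bar>}" using dvd_imp_le_int[OF a] by force
  qed
  then show ?thesis using finite_subset inf unfolding char_equiv_def by (metis finite_atMost)
qed

text \<open>Two nonzero rationals have a common nonzero integral multiple, to which
  \<open>height_mult\<close> compares both.\<close>

lemma height_equiv:
  assumes "x \<in> Q" "y \<in> Q" "x \<noteq> 0" "y \<noteq> 0"
  shows "char_equiv (height Q x) (height Q y)"
proof -
  obtain a b where ab: "x = of_int a / of_int b" "b \<noteq> 0" by (rule rational_fraction)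
  obtain c d where cd: "y = of_int c / of_int d" "d \<noteq> 0" by (rule rational_fraction)
  have nz: "a \<noteq> 0" "c \<noteq> 0" using assms ab cd by auto
  have "of_int (b * c) * x = of_int (a * d) * y" using ab cd by simp
  then show ?thesis using height_mult[of "b * c" x] height_mult[of "a * d" y] assms nz ab cd
    by (metis char_equiv_sym char_equiv_trans mult_eq_0_iff)
qed

lemma type_of_eq:
  assumes "x \<in> Q" "x \<noteq> 0" shows "type_of Q = {\<chi>. char_equiv \<chi> (height Q x)}"
  using assms height_equiv char_equiv_trans unfolding type_of_def by blast

lemma P_inf_type_of:
  assumes "x \<in> Q" "x \<noteq> 0"
  shows "P_inf (type_of Q) = {p. prime p \<and> (\<forall>k. x / of_nat p ^ k \<in> Q)}"
proof -
  have "(\<exists>\<chi>\<in>type_of Q. \<chi> p = \<infinity>) \<longleftrightarrow> height Q x p = \<infinity>" if "prime p" for p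
    unfolding type_of_eq[OF assms] using that char_equiv_infinite char_equiv_refl by blast
  then show ?thesis unfolding P_inf_def using height_eq_infinity[OF _ assms(1)] by auto
qed

text \<open>Induction on the absolute value of \<open>b\<close>: the full power of one prime is
  split off, which leaves a coprime and smaller cofactor.\<close>

lemma divide_P_number:
  assumes x: "x \<in> Q" and P: "\<And>p k. p \<in> P \<Longrightarrow> x / of_nat p ^ k \<in> Q" and b: "P_number P b"
  shows "x / of_int b \<in> Q"
  using b
proof (induction "nat \<bar>b\<bar>" arbitrary: b rule: less_induct)
  case less
  have b0: "b \<noteq> 0" using less.prems by (simp add: P_number_def)
  show ?case
  proof (cases "is_unit b")
    case True
    then have "b = 1 \<or> b = - 1" by auto
    then show ?thesis using x add_subgroup_minus[OF subgroup x] by auto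
  next
    case False
    then obtain q where "prime q" "q dvd b" using b0 by (metis prime_divisorE)
    then have "prime (nat q)" "int (nat q) dvd b"
      by (simp_all only: prime_int_nat_transfer int_nat_eq if_True)
    then obtain p where p: "prime p" "int p dvd b" by blast
    obtain c where c: "b = int p ^ multiplicity (int p) b * c" "\<not> int p dvd c"
      using prime_power_decompose[OF p(1) b0] .
    define l where "l = multiplicity (int p) b"
    have l: "l > 0" using p b0 by (simp add: l_def prime_multiplicity_gt_zero_iff)
    have bc: "b = int p ^ l * c" using c(1) by (simp add: l_def)
    have c0: "c \<noteq> 0" using b0 bc by auto
    have "P_number P c" using less.prems c0 unfolding P_number_def bc by auto
    moreover have "nat \<bar>c\<bar> < nat \<bar>b\<bar>"
    proof -
      have "1 < int p ^ l" using l prime_gt_1_nat[OF p(1)] by (intro one_less_power) auto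
      then have "\<bar>c\<bar> < \<bar>b\<bar>" using c0 mult_strict_right_mono[of 1 "int p ^ l" "\<bar>c\<bar>"] by (simp add: bc abs_mult)
      then show ?thesis by simp
    qed
    ultimately have "x / of_int c \<in> Q" using less.hyps by blast
    moreover have "x / of_int (int p ^ l) \<in> Q"
      using P[of p l] less.prems p by (simp add: P_number_def)
    moreover have "coprime (int p ^ l) c"
      using coprime_prime_power[OF p(1) c(2)] by (simp add: coprime_commute)
    ultimately show ?thesis unfolding bc using p(1) c0 by (intro divide_coprime_mult) auto
  qed
qed

text \<open>With \<open>y / f\<close> in lowest terms, Bezout makes \<open>f\<close> divisible in
  \<open>Q\<close> by the denominator, hence by each of its primes.\<close>

lemma mem_imp_Rloc:
  assumes f: "f \<in> Q" "f \<noteq> 0" and P: "\<And>p. prime p \<Longrightarrow> f / of_nat p \<in> Q \<Longrightarrow> p \<in> P"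
    and y: "y \<in> Q"
  obtains r where "r \<in> Rloc P" "y = r * f"
proof
  obtain a b where ab: "quotient_of (y / f) = (a, b)" by fastforce
  have b: "b > 0" "coprime a b" "y / f = of_int a / of_int b"
    using ab quotient_of_denom_pos quotient_of_coprime quotient_of_div by auto
  have "f / of_int b \<in> Q"
  proof (rule coprime_divide[OF b(2)])
    have "of_int a * f / of_int b = y" using b f by (simp add: field_simps)
    then show "of_int a * f / of_int b \<in> Q" using y by simp
  qed (use b f in auto)
  have "p \<in> P" if p: "prime p" "int p dvd b" for p
  proof (rule P[OF p(1)])
    obtain c where c: "b = int p * c" using p(2) by blast
    have "c \<noteq> 0" "p \<noteq> 0" using b(1) c p(1) by auto
    then have "of_int c * (f / of_int b) = f / of_nat p" by (simp add: c)
    then show "f / of_nat p \<in> Q" using int_mult[OF \<open>f / of_int b \<in> Q\<close>] by metis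
  qed
  then show "y / f \<in> Rloc P" unfolding Rloc_def using b by (auto simp: P_number_def)
  show "y = y / f * f" using f by simp
qed

text \<open>Doubling the height of \<open>x\<close> gives an equivalent characteristic, so only
  finitely many primes have finite nonzero height. Dividing \<open>x\<close> by these prime powers
  gives an \<open>f\<close> whose heights are all zero or infinite; such an element generates
  \<open>Q\<close> over the localization.\<close>

lemma idempotent_type_generator:
  assumes x: "x \<in> Q" "x \<noteq> 0" and idem: "idempotent_type (type_of Q)"
  obtains f where "f \<in> Q" "f \<noteq> 0" "Q = (\<lambda>r. r * f) ` Rloc (P_inf (type_of Q))"
proof -
  define h where "h = height Q x"
  define P where "P = P_inf (type_of Q)"
  have hT: "h \<in> type_of Q" unfolding type_of_eq[OF x] h_def by (simp add: char_equiv_refl)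
  then have "(\<lambda>p. h p + h p) \<in> type_of Q"
    using idem char_equiv_refl unfolding idempotent_type_def type_mult_def by blast
  then have "char_equiv (\<lambda>p. h p + h p) h" unfolding type_of_eq[OF x] h_def by simp
  moreover define F where "F = {p. prime p \<and> h p \<noteq> 0 \<and> h p \<noteq> \<infinity>}"
  have "h p + h p \<noteq> h p" if "p \<in> F" for p
    using that by (cases "h p") (auto simp: F_def zero_enat_def)
  then have "F \<subseteq> {p. prime p \<and> h p + h p \<noteq> h p}" by (auto simp: F_def)
  ultimately have F: "finite F" unfolding char_equiv_def using finite_subset by blast
  define v where "v p = the_enat (h p)" for p
  have v: "h p = enat (v p)" if "p \<in> F" for p using that by (auto simp: F_def v_def)
  have primeF: "prime p" if "p \<in> F" for p using that by (simp add: F_def)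
  define N where "N S = (\<Prod>p\<in>S. int p ^ v p)" for S
  have N0: "N S \<noteq> 0" if "S \<subseteq> F" for S
  proof -
    have "int p ^ v p \<noteq> 0" if "p \<in> S" for p
      using primeF[OF subsetD[OF \<open>S \<subseteq> F\<close> that]] by (auto intro: ccontr)
    then show ?thesis using finite_subset[OF that F] unfolding N_def by (simp only: prod_zero_iff) blast
  qed
  have "x / of_int (N S) \<in> Q" if "S \<subseteq> F" for S
    using finite_subset[OF that F] that
  proof (induction S rule: finite_induct)
    case empty
    then show ?case using x by (simp add: N_def)
  next
    case (insert p S)
    have p: "prime p" "p \<in> F" using insert.prems primeF by auto
    have "coprime (int p ^ v p) (N S)"
    proof -
      have "coprime (int p ^ v p) (int q ^ v q)" if "q \<in> S" for q
        using that insert primeF p primes_coprime[of p q] by auto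
      then show ?thesis unfolding N_def by (intro prod_coprime_right)
    qed
    moreover have "x / of_int (int p ^ v p) \<in> Q"
      using enat_le_height[OF p(1) x(1), of "v p"] v[OF p(2)] by (simp add: h_def)
    moreover have "x / of_int (N S) \<in> Q" using insert by simp
    ultimately have "x / of_int (int p ^ v p * N S) \<in> Q"
      using p N0[of S] insert.prems by (intro divide_coprime_mult) auto
    then show ?case using insert by (simp add: N_def)
  qed
  then have fQ: "x / of_int (N F) \<in> Q" by simp
  define f where "f = x / of_int (N F)"
  have f: "f \<in> Q" "f \<noteq> 0" using fQ x N0 by (auto simp: f_def)
  have Pf: "p \<in> P \<longleftrightarrow> prime p \<and> (\<forall>k. f / of_nat p ^ k \<in> Q)" for p
    unfolding P_def P_inf_type_of[OF f] by simp
  have Px: "p \<in> P \<longleftrightarrow> prime p \<and> h p = \<infinity>" for p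
    unfolding P_def P_inf_type_of[OF x] h_def using height_eq_infinity[OF _ x(1)] by auto
  have PP: "p \<in> P" if p: "prime p" "f / of_nat p \<in> Q" for p
  proof (rule ccontr)
    assume "p \<notin> P"
    then have hp: "h p \<noteq> \<infinity>" using p Px by simp
    \<comment> \<open>The exact height of \<open>x\<close> at \<open>p\<close>. Divisibility of
      \<open>f\<close> by \<open>p\<close> would push it to \<open>Suc w\<close>.\<close>
    define w where "w = (if p \<in> F then v p else 0)"
    obtain M where M: "N F = int p ^ w * M"
    proof (cases "p \<in> F")
      case True
      then have "N F = int p ^ v p * N (F - {p})" using F by (simp add: N_def prod.remove)
      then show ?thesis using True by (intro that[of "N (F - {p})"]) (simp add: w_def)
    next
      case False
      then show ?thesis using that[of "N F"] by (simp add: w_def)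
    qed
    have "of_int M * (f / of_nat p) = x / of_nat p ^ Suc w"
      using N0[of F] M by (simp add: f_def)
    then have "x / of_nat p ^ Suc w \<in> Q" using int_mult[OF p(2)] by metis
    then have "enat (Suc w) \<le> h p" using enat_le_height[OF p(1) x(1)] by (simp add: h_def)
    moreover have "h p = enat w"
    proof (cases "p \<in> F")
      case False
      then have "h p = 0" using p(1) hp by (simp add: F_def)
      then show ?thesis using False by (simp add: w_def zero_enat_def)
    qed (simp add: v w_def)
    ultimately show False by simp
  qed
  have "Q \<subseteq> (\<lambda>r. r * f) ` Rloc P"
  proof
    fix y assume y: "y \<in> Q"
    obtain r where r: "r \<in> Rloc P" "y = r * f"
    proof (rule mem_imp_Rloc[of f P y])
      show "p \<in> P" if "prime p" "f / of_nat p \<in> Q" for p by (rule PP[OF that])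
    qed (use f y in blast)+
    show "y \<in> (\<lambda>r. r * f) ` Rloc P" unfolding r(2) by (rule imageI[OF r(1)])
  qed
  moreover have "r * f \<in> Q" if r: "r \<in> Rloc P" for r
  proof -
    obtain a b where ab: "r = of_int a / of_int b" "P_number P b" using r by (auto simp: Rloc_def)
    have "f / of_int b \<in> Q"
      by (rule divide_P_number[OF f(1) _ ab(2)]) (simp add: Pf)
    from int_mult[OF this, of a] show ?thesis using ab by simp
  qed
  ultimately show thesis using that[OF f] unfolding P_def by blast
qed

end

lemma type_le_Rloc: assumes "P \<subseteq> P'" shows "type_le (type_of (Rloc P)) (type_of (Rloc P'))"
proof -
  have "height (Rloc P) 1 \<in> type_of (Rloc P)" for P
    using rat_subgroup.type_of_eq[OF rat_subgroup_Rloc, of 1 P] char_equiv_refl by auto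
  moreover have "height (Rloc P) 1 p \<le> height (Rloc P') 1 p" for p
    unfolding height_def using Rloc_mono[OF assms] by (intro Sup_subset_mono) blast
  ultimately show ?thesis unfolding type_le_def by blast
qed

text \<open>The hypothesis gives existence. Uniqueness: closure under products turns
  \<open>1 / p\<close> into all its powers, so a unital ring of this type contains exactly the
  inverses of the primes in \<open>P_inf \<tau>\<close> and is the localization.\<close>

lemma R_ring_eq:
  assumes "type_of (Rloc (P_inf \<tau>)) = \<tau>"
  shows "R_ring \<tau> = Rloc (P_inf \<tau>)"
  unfolding R_ring_def
proof (rule the_equality)
  show "1 \<in> Rloc (P_inf \<tau>) \<and> (\<forall>x\<in>Rloc (P_inf \<tau>). \<forall>y\<in>Rloc (P_inf \<tau>). x - y \<in> Rloc (P_inf \<tau>) \<and> x * y \<in> Rloc (P_inf \<tau>)) \<and>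
      type_of (Rloc (P_inf \<tau>)) = \<tau>"
    using assms by (auto intro: Rloc_diff Rloc_mult)
next
  fix R :: "rat set"
  assume R: "1 \<in> R \<and> (\<forall>x\<in>R. \<forall>y\<in>R. x - y \<in> R \<and> x * y \<in> R) \<and> type_of R = \<tau>"
  have 0: "0 \<in> R" using R by (metis diff_self)
  have minus: "- x \<in> R" if "x \<in> R" for x using R 0 that by (metis diff_0)
  have "x + y \<in> R" if "x \<in> R" "y \<in> R" for x y using R minus[OF that(2)] that by (metis diff_minus_eq_add)
  then interpret rat_subgroup R using 0 minus by (simp add: rat_subgroup_def add_subgroup_iff)
  have P: "P_inf \<tau> = {p. prime p \<and> (\<forall>k. 1 / of_nat p ^ k \<in> R)}"
    using P_inf_type_of[of 1] R by simp
  have "1 / of_nat p ^ k \<in> R" if "1 / of_nat p \<in> R" for p k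
  proof (induction k)
    case (Suc k)
    then have "1 / of_nat p * (1 / of_nat p ^ k) \<in> R" using R that by blast
    then show ?case by simp
  qed (use R in simp)
  then have "p \<in> P_inf \<tau>" if "prime p" "1 / of_nat p \<in> R" for p using that by (simp add: P)
  then have "R \<subseteq> Rloc (P_inf \<tau>)" using mem_imp_Rloc[of 1 "P_inf \<tau>"] R by (metis mult.right_neutral subsetI zero_neq_one)
  moreover have "r \<in> R" if r: "r \<in> Rloc (P_inf \<tau>)" for r
  proof -
    obtain a b where ab: "r = of_int a / of_int b" "P_number (P_inf \<tau>) b" using r by (auto simp: Rloc_def)
    have "1 / of_int b \<in> R" using divide_P_number[of 1 "P_inf \<tau>" b] ab(2) R by (auto simp: P)
    from int_mult[OF this, of a] show ?thesis using ab by simp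
  qed
  ultimately show "R = Rloc (P_inf \<tau>)" by blast
qed

section \<open>Regulators with cyclic quotient\<close>

lemma normal_add_group:
  assumes "add_subgroup G" "add_subgroup H" "H \<subseteq> G"
  shows "H \<lhd> add_group G"
proof -
  interpret comm_group "add_group G" by (rule comm_group_add_group[OF assms(1)])
  have "subgroup H (add_group G)"
    by (rule subgroup.intro)
      (use assms in \<open>auto simp: inv_add_group[OF assms(1)] add_subgroup_iff subset_iff\<close>)
  then show ?thesis by (rule subgroup_imp_normal)
qed

lemma coset_eq: "coset G H x = (\<lambda>h. h + x) ` H"
  by (auto simp: coset_def r_coset_def)

lemma coset_eq_iff:
  assumes "add_subgroup H" shows "coset G H x = coset G H y \<longleftrightarrow> x - y \<in> H"
proof
  assume "coset G H x = coset G H y"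
  moreover have "x \<in> coset G H x"
    using add_subgroup_zero[OF assms] by (auto simp: coset_eq intro!: image_eqI[of _ _ 0])
  ultimately show "x - y \<in> H" by (auto simp: coset_eq)
next
  assume xy: "x - y \<in> H"
  have "h + x \<in> coset G H y" if "h \<in> H" for h
    using add_subgroup_add[OF assms that xy] by (auto simp: coset_eq intro!: image_eqI[of _ _ "h + (x - y)"])
  moreover have "h + y \<in> coset G H x" if "h \<in> H" for h
    using add_subgroup_diff[OF assms that xy] by (auto simp: coset_eq intro!: image_eqI[of _ _ "h - (x - y)"])
  ultimately show "coset G H x = coset G H y" by (auto simp: coset_eq)
qed

lemma carrier_quot: "carrier (quot G H) = coset G H ` G"
  by (simp add: quot_def carrier_FactGroup coset_def)

lemma quot_hom:
  assumes "add_subgroup G" "add_subgroup H" "H \<subseteq> G"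
  shows "group_hom (add_group G) (quot G H) (coset G H)"
proof -
  have n: "H \<lhd> add_group G" by (rule normal_add_group[OF assms])
  have "coset G H \<in> hom (add_group G) (quot G H)"
    using normal.r_coset_hom_Mod[OF n] by (simp add: quot_def coset_def[abs_def])
  then show ?thesis
    using normal.factorgroup_is_group[OF n] group_add_group[OF assms(1)]
    by (simp add: quot_def group_hom_def group_hom_axioms_def)
qed

lemma int_pow_add_group:
  assumes "add_subgroup G" "x \<in> G" shows "x [^]\<^bsub>add_group G\<^esub> (k :: int) = zmul k x"
proof -
  interpret comm_group "add_group G" by (rule comm_group_add_group[OF assms(1)])
  show ?thesis
  proof (induction k rule: int_induct_add)
    case (add1 k)
    have "x [^]\<^bsub>add_group G\<^esub> (k + 1) = x [^]\<^bsub>add_group G\<^esub> k \<otimes>\<^bsub>add_group G\<^esub> x [^]\<^bsub>add_group G\<^esub> (1 :: int)"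
      by (rule int_pow_mult) (use assms in simp)
    then show ?case using add1 int_pow_1[of x] assms by (simp add: zmul_add_left)
  next
    case (minus k)
    have "x [^]\<^bsub>add_group G\<^esub> (- k) = inv\<^bsub>add_group G\<^esub> (x [^]\<^bsub>add_group G\<^esub> k)"
      by (rule int_pow_neg) (use assms in simp)
    then show ?case using minus
      by (simp add: inv_add_group[OF assms(1)] add_subgroup_zmul[OF assms] zmul_minus_left)
  qed (use assms in \<open>simp add: int_pow_def2\<close>)
qed

lemma coset_zmul:
  assumes "add_subgroup G" "add_subgroup H" "H \<subseteq> G" "x \<in> G"
  shows "coset G H (zmul k x) = coset G H x [^]\<^bsub>quot G H\<^esub> (k :: int)"
proof -
  interpret group_hom "add_group G" "quot G H" "coset G H" by (rule quot_hom[OF assms(1-3)])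
  show ?thesis using hom_int_pow[of x k] assms by (simp add: int_pow_add_group)
qed

text \<open>Generation of a cyclic quotient in terms of elements; in this form it passes at once
  from \<open>H\<close> to any larger subgroup.\<close>

definition generates_mod :: "'a::ab_group_add set \<Rightarrow> 'a set \<Rightarrow> 'a \<Rightarrow> bool" where
  "generates_mod G H x \<longleftrightarrow> x \<in> G \<and> (\<forall>g\<in>G. \<exists>j. g - zmul j x \<in> H)"

lemma generates_modI:
  assumes "add_subgroup G" "add_subgroup H" "H \<subseteq> G" "x \<in> G"
    and gen: "subgroup_generated (quot G H) {coset G H x} = quot G H"
  shows "generates_mod G H x"
  unfolding generates_mod_def
proof (intro conjI ballI)
  fix g assume "g \<in> G"
  interpret group_hom "add_group G" "quot G H" "coset G H" by (rule quot_hom[OF assms(1-3)])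
  have "coset G H g \<in> carrier (subgroup_generated (quot G H) {coset G H x})"
    unfolding gen carrier_quot using \<open>g \<in> G\<close> by blast
  also have "\<dots> = range (\<lambda>n::int. coset G H x [^]\<^bsub>quot G H\<^esub> n)"
    by (rule H.carrier_subgroup_generated_by_singleton) (use assms(4) in \<open>simp add: carrier_quot\<close>)
  finally obtain n where "coset G H g = coset G H (zmul n x)"
    using coset_zmul[OF assms(1-4)] by auto
  then show "\<exists>j. g - zmul j x \<in> H" unfolding coset_eq_iff[OF assms(2)] by blast
qed (rule assms(4))

lemma cyclic_quotE:
  assumes "add_subgroup G" "add_subgroup H" "H \<subseteq> G" "cyclic_group (quot G H)"
  obtains x where "generates_mod G H x"
proof -
  obtain X where X: "X \<in> carrier (quot G H)" "subgroup_generated (quot G H) {X} = quot G H"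
    using assms(4) by (auto simp: cyclic_group_def)
  then obtain x where "x \<in> G" "X = coset G H x" unfolding carrier_quot by blast
  then show thesis using that generates_modI[OF assms(1-3)] X(2) by blast
qed

lemma zmul_mem_iff_order_dvd:
  assumes "add_subgroup G" "add_subgroup H" "H \<subseteq> G" "generates_mod G H x"
    and fin: "finite (carrier (quot G H))"
  shows "zmul j x \<in> H \<longleftrightarrow> int (order (quot G H)) dvd j" and "order (quot G H) > 0"
proof -
  interpret group_hom "add_group G" "quot G H" "coset G H" by (rule quot_hom[OF assms(1-3)])
  have x: "x \<in> G" "coset G H x \<in> carrier (quot G H)" using assms(4) by (auto simp: generates_mod_def carrier_quot)
  have "carrier (quot G H) \<subseteq> generate (quot G H) {coset G H x}"
  proof
    fix Y assume "Y \<in> carrier (quot G H)"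
    then obtain g where g: "g \<in> G" "Y = coset G H g" unfolding carrier_quot by blast
    then obtain j where "g - zmul j x \<in> H" using assms(4) by (auto simp: generates_mod_def)
    then have "Y = coset G H x [^]\<^bsub>quot G H\<^esub> j"
      using g coset_eq_iff[OF assms(2)] coset_zmul[OF assms(1-3) x(1)] by metis
    then show "Y \<in> generate (quot G H) {coset G H x}"
      unfolding H.generate_pow[OF x(2)] by blast
  qed
  then have "generate (quot G H) {coset G H x} = carrier (quot G H)"
    using H.generate_incl[of "{coset G H x}"] x by auto
  then have "H.ord (coset G H x) = order (quot G H)"
    using H.generate_pow_card[OF x(2)] by (simp add: order_def)
  then have "coset G H x [^]\<^bsub>quot G H\<^esub> j = \<one>\<^bsub>quot G H\<^esub> \<longleftrightarrow> int (order (quot G H)) dvd j"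
    using H.int_pow_eq_id[OF x(2)] by simp
  moreover have "\<one>\<^bsub>quot G H\<^esub> = coset G H 0" using hom_one by simp
  ultimately show "zmul j x \<in> H \<longleftrightarrow> int (order (quot G H)) dvd j"
    using coset_eq_iff[OF assms(2), of G "zmul j x" 0] coset_zmul[OF assms(1-3) x(1), of j] by simp
  show "order (quot G H) > 0" using fin H.order_gt_0_iff_finite by simp
qed

lemma finite_quot_mono:
  assumes "add_subgroup H" "add_subgroup H'" "H \<subseteq> H'" "finite (carrier (quot G H))"
  shows "finite (carrier (quot G H'))"
proof -
  define F where "F C = coset G H' (SOME x. coset G H x = C)" for C
  have "coset G H' x = F (coset G H x)" for x
  proof -
    have "coset G H (SOME y. coset G H y = coset G H x) = coset G H x" by (rule someI) (rule refl)
    then have "(SOME y. coset G H y = coset G H x) - x \<in> H'"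
      using assms(3) unfolding coset_eq_iff[OF assms(1)] by blast
    then show ?thesis unfolding F_def using coset_eq_iff[OF assms(2)] by metis
  qed
  then have "carrier (quot G H') = F ` carrier (quot G H)"
    unfolding carrier_quot image_image by (rule image_cong[OF refl])
  then show ?thesis using assms(4) by simp
qed

text \<open>Modulo \<open>H\<close> every element is a multiple of \<open>x\<close>, and the
  multiples of \<open>x\<close> in a subgroup above \<open>H\<close> are those divisible by its
  index.\<close>

lemma subgroups_same_index:
  assumes G: "add_subgroup G" and A: "add_subgroup A" "A \<subseteq> G" "finite (carrier (quot G A))"
    and B: "add_subgroup B" "B \<subseteq> G" "finite (carrier (quot G B))"
    and x: "generates_mod G H x" and H: "H \<subseteq> A" "H \<subseteq> B"
    and le: "order (quot G B) dvd order (quot G A)"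
  shows "A \<subseteq> B"
proof
  fix g assume g: "g \<in> A"
  have gen: "generates_mod G A x" "generates_mod G B x"
    using x H unfolding generates_mod_def by blast+
  obtain j where j: "g - zmul j x \<in> H" using x g A(2) unfolding generates_mod_def by blast
  then have "g - (g - zmul j x) \<in> A" using add_subgroup_diff[OF A(1) g] H(1) by blast
  then have "int (order (quot G A)) dvd j"
    using zmul_mem_iff_order_dvd(1)[OF G A(1,2) gen(1) A(3)] by simp
  then have "int (order (quot G B)) dvd j" using le by (meson dvd_trans of_nat_dvd_iff)
  then have "zmul j x \<in> B"
    using zmul_mem_iff_order_dvd(1)[OF G B(1,2) gen(2) B(3)] by simp
  moreover have "g - zmul j x \<in> B" using j H by blast
  ultimately show "g \<in> B" using add_subgroup_add[OF B(1)] by fastforce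
qed

locale crq_group =
  fixes G :: "'a::ab_group_add set"
  assumes acd: "acd G" and cyclic: "cyclic_group (quot G (Reg G))"
begin

lemma G: "add_subgroup G" "torsion_free G"
  using acd by (auto simp: acd_def)

text \<open>The completely decomposable subgroups of least index all contain the regulator, and subgroups
  of equal finite index of the cyclic quotient coincide; hence there is only one.\<close>

lemma Reg_regulating:
  shows "cd_finite_index G (Reg G)"
    and "cd_finite_index G B \<Longrightarrow> order (quot G (Reg G)) \<le> order (quot G B)"
proof -
  define S where "S = {A. cd_finite_index G A \<and>
                (\<forall>B. cd_finite_index G B \<longrightarrow> order (quot G A) \<le> order (quot G B))}"
  have Reg: "Reg G = \<Inter>S" unfolding Reg_def S_def ..
  obtain A0 where "cd_finite_index G A0" using acd by (auto simp: acd_def)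
  then obtain A where A: "A \<in> S"
    using ex_has_least_nat[of "cd_finite_index G" A0 "\<lambda>A. order (quot G A)"] unfolding S_def by blast
  have sub: "add_subgroup B" "B \<subseteq> G" "finite (carrier (quot G B))" if "B \<in> S" for B
    using that by (auto simp: S_def cd_finite_index_def)
  have RegG: "Reg G \<subseteq> G" unfolding Reg using sub A by blast
  have Regs: "add_subgroup (Reg G)" unfolding Reg
    by (rule add_subgroupI) (use sub in \<open>auto intro: add_subgroup_zero add_subgroup_add add_subgroup_minus\<close>)
  obtain x where x: "generates_mod G (Reg G) x"
    using cyclic_quotE[OF G(1) Regs RegG cyclic] .
  have "A \<subseteq> B" if B: "B \<in> S" for B
  proof (rule subgroups_same_index[OF G(1) sub[OF A] sub[OF B] x])
    have "order (quot G B) = order (quot G A)"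
      using A B unfolding S_def by (auto intro: antisym)
    then show "order (quot G B) dvd order (quot G A)" by simp
  qed (use A B Reg in auto)
  then have "Reg G = A" unfolding Reg using A by blast
  then show "cd_finite_index G (Reg G)"
    "cd_finite_index G B \<Longrightarrow> order (quot G (Reg G)) \<le> order (quot G B)"
    using A by (auto simp: S_def)
qed

lemma Reg: "add_subgroup (Reg G)" "Reg G \<subseteq> G" "finite (carrier (quot G (Reg G)))"
  using Reg_regulating(1) by (auto simp: cd_finite_index_def)

text \<open>The index of a larger subgroup divides that of the regulator, and minimality makes the
  two equal. This is what prevents the summands of the regulator from being enlarged.\<close>

lemma Reg_maximal:
  assumes A: "cd_finite_index G A" and le: "Reg G \<subseteq> A"
  shows "A = Reg G"
proof -
  have A': "add_subgroup A" "A \<subseteq> G" "finite (carrier (quot G A))"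
    using A by (auto simp: cd_finite_index_def)
  obtain x where x: "generates_mod G (Reg G) x"
    using cyclic_quotE[OF G(1) Reg(1,2) cyclic] .
  have xA: "generates_mod G A x" using x le unfolding generates_mod_def by blast
  have "zmul (int (order (quot G (Reg G)))) x \<in> A"
    using zmul_mem_iff_order_dvd(1)[OF G(1) Reg(1,2) x Reg(3), of "int (order (quot G (Reg G)))"] le by auto
  then have "order (quot G A) dvd order (quot G (Reg G))"
    using zmul_mem_iff_order_dvd(1)[OF G(1) A'(1,2) xA A'(3)] by (simp add: of_nat_dvd_iff)
  moreover have "order (quot G (Reg G)) > 0" by (rule zmul_mem_iff_order_dvd(2)[OF G(1) Reg(1,2) x Reg(3)])
  ultimately have "order (quot G A) \<le> order (quot G (Reg G))" by (rule dvd_imp_le)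
  then have "order (quot G (Reg G)) = order (quot G A)"
    using Reg_regulating(2)[OF A] by (rule antisym[rotated])
  then have "A \<subseteq> Reg G"
    by (intro subgroups_same_index[OF G(1) A' Reg x le subset_refl]) simp
  then show ?thesis using le by blast
qed

end

section \<open>Direct sums and coordinates in the divisible hull\<close>

lemma to_hull_add: "to_hull (x + y) = to_hull x + to_hull y"
  by transfer (auto intro!: hull_relI)

lemma additive_to_hull: "add_subgroup H \<Longrightarrow> additive_on H to_hull"
  by (simp add: additive_on_def to_hull_add)

lemma to_hull_0 [simp]: "to_hull 0 = 0"
  using to_hull_add[of 0 0] by simp

lemma to_hull_sum: "to_hull (sum f I) = (\<Sum>i\<in>I. to_hull (f i))"
  by (induction I rule: infinite_finite_induct) (auto simp: to_hull_add)

lemma zmul_hull: "zmul k u = hull_scale (of_int k) u"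
  by (induction k rule: int_induct_add)
    (auto simp: zmul_add_left zmul_minus_left hull.scale_left_distrib)

lemma to_hull_zmul: "to_hull (zmul k x) = hull_scale (of_int k) (to_hull x)"
  using additive_on.zmul[OF additive_to_hull, of UNIV x k] by (simp add: add_subgroup_iff zmul_hull)

lemma torsion_freeD: "torsion_free H \<Longrightarrow> x \<in> H \<Longrightarrow> k \<noteq> 0 \<Longrightarrow> zmul k x = 0 \<Longrightarrow> x = 0"
  by (auto simp: torsion_free_def)

lemma torsion_free_subset: "torsion_free G \<Longrightarrow> H \<subseteq> G \<Longrightarrow> torsion_free H"
  by (auto simp: torsion_free_def)

lemma to_hull_eq_0_iff:
  assumes "add_subgroup G" "torsion_free G" "x \<in> G" shows "to_hull x = 0 \<longleftrightarrow> x = 0"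
  using inj_on_eq_iff[OF inj_on_to_hull[OF assms(1,2)] assms(3) add_subgroup_zero[OF assms(1)]] by simp

lemma to_hull_eqD:
  assumes "add_subgroup G" "torsion_free G" "x \<in> G" "y \<in> G" "to_hull x = to_hull y" shows "x = y"
  using inj_onD[OF inj_on_to_hull[OF assms(1,2)]] assms by blast

text \<open>The working form of a direct sum: families need not be extensional, and injectivity is
  reduced to the uniqueness of zero.\<close>

lemma internal_dsum_iff:
  "internal_dsum A I X \<longleftrightarrow> finite I \<and> (\<forall>i\<in>I. add_subgroup (X i)) \<and>
     A = {\<Sum>i\<in>I. x i | x. \<forall>i\<in>I. x i \<in> X i} \<and>
     (\<forall>x. (\<forall>i\<in>I. x i \<in> X i) \<and> (\<Sum>i\<in>I. x i) = 0 \<longrightarrow> (\<forall>i\<in>I. x i = 0))"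
  (is "_ \<longleftrightarrow> ?fin \<and> ?sub \<and> ?img \<and> ?ind")
proof -
  have img: "(\<lambda>x. \<Sum>i\<in>I. x i) ` (\<Pi>\<^sub>E i\<in>I. X i) = {\<Sum>i\<in>I. x i | x. \<forall>i\<in>I. x i \<in> X i}"
  proof (intro equalityI subsetI)
    fix a assume "a \<in> {\<Sum>i\<in>I. x i | x. \<forall>i\<in>I. x i \<in> X i}"
    then obtain x where "\<forall>i\<in>I. x i \<in> X i" "a = (\<Sum>i\<in>I. x i)" by blast
    then have "restrict x I \<in> (\<Pi>\<^sub>E i\<in>I. X i)" "a = (\<Sum>i\<in>I. restrict x I i)" by auto
    then show "a \<in> (\<lambda>x. \<Sum>i\<in>I. x i) ` (\<Pi>\<^sub>E i\<in>I. X i)" by blast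
  qed (auto simp: PiE_iff)
  have inj: "inj_on (\<lambda>x. \<Sum>i\<in>I. x i) (\<Pi>\<^sub>E i\<in>I. X i) \<longleftrightarrow> ?ind" if sub: ?sub
  proof
    assume inj: "inj_on (\<lambda>x. \<Sum>i\<in>I. x i) (\<Pi>\<^sub>E i\<in>I. X i)"
    show ?ind
    proof (intro allI impI)
      fix x assume x: "(\<forall>i\<in>I. x i \<in> X i) \<and> (\<Sum>i\<in>I. x i) = 0"
      have "restrict x I = restrict (\<lambda>_. 0) I"
        by (rule inj_onD[OF inj]) (use x sub in \<open>auto simp: add_subgroup_zero\<close>)
      then show "\<forall>i\<in>I. x i = 0" by (metis restrict_apply')
    qed
  next
    assume ind: ?ind
    show "inj_on (\<lambda>x. \<Sum>i\<in>I. x i) (\<Pi>\<^sub>E i\<in>I. X i)"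
    proof (rule inj_onI)
      fix x y assume xy: "x \<in> (\<Pi>\<^sub>E i\<in>I. X i)" "y \<in> (\<Pi>\<^sub>E i\<in>I. X i)" "(\<Sum>i\<in>I. x i) = (\<Sum>i\<in>I. y i)"
      have "\<forall>i\<in>I. x i - y i \<in> X i"
        using xy sub by (auto intro!: add_subgroup_diff)
      moreover have "(\<Sum>i\<in>I. x i - y i) = 0" using xy by (simp add: sum_subtractf)
      ultimately have "\<forall>i\<in>I. x i - y i = 0" using ind[rule_format, of "\<lambda>i. x i - y i"] by blast
      then show "x = y" using xy by (intro PiE_ext) auto
    qed
  qed
  show ?thesis
  proof (cases ?sub)
    case True
    show ?thesis unfolding internal_dsum_def bij_betw_def img inj[OF True]
      by (rule iffI; elim conjE; intro conjI; (assumption | erule sym))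
  next
    case False
    then show ?thesis unfolding internal_dsum_def by (simp only: simp_thms)
  qed
qed

lemma
  assumes "internal_dsum A I X"
  shows internal_dsum_finite: "finite I"
    and internal_dsum_subgroup: "i \<in> I \<Longrightarrow> add_subgroup (X i)"
    and internal_dsum_eq: "A = {\<Sum>i\<in>I. x i | x. \<forall>i\<in>I. x i \<in> X i}"
    and internal_dsum_zero: "(\<And>i. i \<in> I \<Longrightarrow> x i \<in> X i) \<Longrightarrow> (\<Sum>i\<in>I. x i) = 0 \<Longrightarrow> i \<in> I \<Longrightarrow> x i = 0"
  using assms unfolding internal_dsum_iff by blast+

lemma internal_dsumE:
  assumes "internal_dsum A I X" "a \<in> A"
  obtains x where "\<And>i. i \<in> I \<Longrightarrow> x i \<in> X i" "a = (\<Sum>i\<in>I. x i)"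
  using assms(2) unfolding internal_dsum_eq[OF assms(1)] by blast

lemma internal_dsum_ex:
  assumes "internal_dsum A I X" "a \<in> A"
  shows "\<exists>x. (\<forall>i\<in>I. x i \<in> X i) \<and> a = (\<Sum>i\<in>I. x i)"
  using internal_dsumE[OF assms] by metis

lemma internal_dsum_memI:
  assumes "internal_dsum A I X" "\<And>i. i \<in> I \<Longrightarrow> x i \<in> X i" shows "(\<Sum>i\<in>I. x i) \<in> A"
  unfolding internal_dsum_eq[OF assms(1)] using assms(2) by blast

lemma internal_dsum_add_subgroup:
  assumes "internal_dsum A I X" shows "add_subgroup A"
proof (rule add_subgroupI)
  note sub = internal_dsum_subgroup[OF assms]
  show "0 \<in> A"
    using internal_dsum_memI[OF assms, of "\<lambda>_. 0"] sub by (simp add: add_subgroup_zero)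
  fix a b assume "a \<in> A" "b \<in> A"
  obtain x where x: "\<And>i. i \<in> I \<Longrightarrow> x i \<in> X i" "a = (\<Sum>i\<in>I. x i)" using internal_dsumE[OF assms \<open>a \<in> A\<close>] by metis
  obtain y where y: "\<And>i. i \<in> I \<Longrightarrow> y i \<in> X i" "b = (\<Sum>i\<in>I. y i)" using internal_dsumE[OF assms \<open>b \<in> A\<close>] by metis
  show "a + b \<in> A"
    using internal_dsum_memI[OF assms, of "\<lambda>i. x i + y i"] x y sub
    by (simp add: sum.distrib add_subgroup_add)
next
  fix a assume "a \<in> A"
  obtain x where x: "\<And>i. i \<in> I \<Longrightarrow> x i \<in> X i" "a = (\<Sum>i\<in>I. x i)" using internal_dsumE[OF assms \<open>a \<in> A\<close>] by metis
  then show "- a \<in> A"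
    using internal_dsum_memI[OF assms, of "\<lambda>i. - x i"] internal_dsum_subgroup[OF assms]
    by (simp add: sum_negf add_subgroup_minus)
qed

lemma internal_dsum_component:
  assumes "internal_dsum A I X" "i \<in> I" "x \<in> X i" shows "x \<in> A"
proof -
  define y where "y j = (if j = i then x else 0)" for j
  have "(\<Sum>j\<in>I. y j) = x" using assms(2) internal_dsum_finite[OF assms(1)] by (simp add: y_def)
  moreover have "\<forall>j\<in>I. y j \<in> X j"
    using assms internal_dsum_subgroup[OF assms(1)] by (auto simp: y_def add_subgroup_zero)
  ultimately show ?thesis using internal_dsum_memI[OF assms(1), of y] by simp
qed

lemma internal_dsum_disjoint:
  assumes "internal_dsum A I X" "i \<in> I" "j \<in> I" "i \<noteq> j" "x \<in> X i" "x \<in> X j"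
  shows "x = 0"
proof -
  define y where "y l = (if l = i then x else if l = j then - x else 0)" for l
  note fin = internal_dsum_finite[OF assms(1)]
  have "(\<Sum>l\<in>I. y l) = (\<Sum>l\<in>I. (if l = i then x else 0) + (if l = j then - x else 0))"
    using assms(4) by (intro sum.cong) (auto simp: y_def)
  also have "\<dots> = 0" using assms(2,3) fin by (simp add: sum.distrib)
  finally have sum0: "(\<Sum>l\<in>I. y l) = 0" .
  have "y l \<in> X l" if "l \<in> I" for l
    using assms(4-6) internal_dsum_subgroup[OF assms(1) that]
    by (auto simp: y_def add_subgroup_zero add_subgroup_minus)
  then have "y i = 0" using internal_dsum_zero[OF assms(1) _ sum0 assms(2)] by blast
  then show ?thesis by (simp add: y_def)
qed

text \<open>Passes between a decomposition given as a set of summands and one indexed by types or by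
  the original summands.\<close>

lemma internal_dsum_reindex:
  assumes "inj_on X I"
  shows "internal_dsum A (X ` I) (\<lambda>Y. Y) \<longleftrightarrow> internal_dsum A I X"
proof -
  have S: "(\<Sum>Y\<in>X ` I. y Y) = (\<Sum>i\<in>I. y (X i))" for y :: "'b set \<Rightarrow> 'b"
    using assms by (simp add: sum.reindex)
  have ex: "\<exists>y. \<forall>i\<in>I. y (X i) = x i" for x :: "'a \<Rightarrow> 'b"
    using assms by (intro exI[of _ "\<lambda>Y. x (inv_into I X Y)"]) auto
  have 1: "{\<Sum>Y\<in>X ` I. y Y | y. \<forall>Y\<in>X ` I. y Y \<in> Y} = {\<Sum>i\<in>I. x i | x. \<forall>i\<in>I. x i \<in> X i}"
  proof (intro equalityI subsetI)
    fix a assume "a \<in> {\<Sum>i\<in>I. x i | x. \<forall>i\<in>I. x i \<in> X i}"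
    then obtain x where x: "\<forall>i\<in>I. x i \<in> X i" "a = (\<Sum>i\<in>I. x i)" by blast
    obtain y where y: "\<forall>i\<in>I. y (X i) = x i" using ex by blast
    then have "a = (\<Sum>Y\<in>X ` I. y Y)" unfolding S x(2) by (intro sum.cong) auto
    then show "a \<in> {\<Sum>Y\<in>X ` I. y Y | y. \<forall>Y\<in>X ` I. y Y \<in> Y}" using x(1) y by auto
  qed (auto simp: S)
  have 2: "(\<forall>y. (\<forall>Y\<in>X ` I. y Y \<in> Y) \<and> (\<Sum>Y\<in>X ` I. y Y) = 0 \<longrightarrow> (\<forall>Y\<in>X ` I. y Y = 0)) \<longleftrightarrow>
    (\<forall>x. (\<forall>i\<in>I. x i \<in> X i) \<and> (\<Sum>i\<in>I. x i) = 0 \<longrightarrow> (\<forall>i\<in>I. x i = 0))" (is "?L \<longleftrightarrow> ?R")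
  proof
    assume L: ?L
    show ?R
    proof (intro allI impI)
      fix x assume x: "(\<forall>i\<in>I. x i \<in> X i) \<and> (\<Sum>i\<in>I. x i) = 0"
      obtain y where y: "\<forall>i\<in>I. y (X i) = x i" using ex by blast
      then have "(\<Sum>Y\<in>X ` I. y Y) = (\<Sum>i\<in>I. x i)" unfolding S by (intro sum.cong) auto
      then have "(\<forall>Y\<in>X ` I. y Y \<in> Y) \<and> (\<Sum>Y\<in>X ` I. y Y) = 0" using x y by simp
      then have "\<forall>Y\<in>X ` I. y Y = 0" using L by blast
      then show "\<forall>i\<in>I. x i = 0" using y by simp
    qed
  next
    assume R: ?R
    show ?L
    proof (intro allI impI)
      fix y assume y: "(\<forall>Y\<in>X ` I. y Y \<in> Y) \<and> (\<Sum>Y\<in>X ` I. y Y) = 0"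
      have "(\<forall>i\<in>I. y (X i) \<in> X i) \<and> (\<Sum>i\<in>I. y (X i)) = 0" using y unfolding S by simp
      then have "\<forall>i\<in>I. y (X i) = 0" by (rule spec[OF R, THEN mp])
      then show "\<forall>Y\<in>X ` I. y Y = 0" by simp
    qed
  qed
  show ?thesis unfolding internal_dsum_iff 1 2
    using finite_image_iff[OF assms] by auto
qed

section \<open>Groups of rank one and pure closures\<close>

lemma rank_1_multiple:
  assumes "rank S = 1" "x \<in> S" "to_hull x \<noteq> 0" "y \<in> S"
  obtains q where "to_hull y = hull_scale q (to_hull x)"
proof -
  obtain B where B: "to_hull ` S \<subseteq> hull.span B" "card B = 1"
    using hull.basis_exists[of "to_hull ` S"] assms(1) unfolding rank_def by metis
  then obtain b where "B = {b}" by (auto simp: card_1_singleton_iff)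
  then have "to_hull x \<in> range (\<lambda>k. hull_scale k b)" "to_hull y \<in> range (\<lambda>k. hull_scale k b)"
    using B(1) assms(2,4) by (auto simp: hull.span_singleton)
  then obtain k l where kl: "to_hull x = hull_scale k b" "to_hull y = hull_scale l b" by blast
  then have "k \<noteq> 0" using assms(3) by auto
  then have "to_hull y = hull_scale (l / k) (to_hull x)" by (simp add: kl)
  then show thesis by (rule that)
qed

lemma rank_oneI:
  assumes "add_subgroup X" "torsion_free X" "x \<in> X" "x \<noteq> 0"
    and "\<And>y. y \<in> X \<Longrightarrow> \<exists>q. to_hull y = hull_scale q (to_hull x)"
  shows "rank_one X"
proof -
  have "to_hull x \<noteq> 0" using assms by (simp add: to_hull_eq_0_iff)
  then have "hull.independent {to_hull x}" by (simp add: hull.dependent_single)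
  moreover have "to_hull ` X \<subseteq> hull.span {to_hull x}"
    using assms(5) by (auto simp: hull.span_singleton)
  ultimately have "hull.dim (to_hull ` X) = 1"
    using assms(3) by (intro hull.dim_unique[of "{to_hull x}"]) auto
  then show ?thesis using assms by (simp add: rank_one_def rank_def)
qed

lemma rank_one_nonzero:
  assumes "rank_one X" obtains x where "x \<in> X" "x \<noteq> 0"
proof -
  have "X \<noteq> {0}"
  proof
    assume "X = {0}"
    then have "rank X = 0" using hull.dim_le_card[of "to_hull ` X" "{}"] by (simp add: rank_def)
    then show False using assms by (simp add: rank_one_def)
  qed
  then show thesis using that assms add_subgroup_zero[of X] by (auto simp: rank_one_def)
qed

lemma rank_one_multiple:
  assumes "rank_one X" "x \<in> X" "x \<noteq> 0" "y \<in> X"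
  obtains a b where "b \<noteq> 0" "zmul b y = zmul a x"
proof -
  have X: "add_subgroup X" "torsion_free X" "rank X = 1" using assms(1) by (auto simp: rank_one_def)
  then obtain q where q: "to_hull y = hull_scale q (to_hull x)"
    using rank_1_multiple[of X x y] assms to_hull_eq_0_iff by metis
  obtain a b where ab: "q = of_int a / of_int b" "b \<noteq> 0" by (rule rational_fraction)
  have "to_hull (zmul b y) = to_hull (zmul a x)" using ab by (simp add: to_hull_zmul q)
  then have "zmul b y = zmul a x"
    using to_hull_eqD[OF X(1,2)] add_subgroup_zmul[OF X(1)] assms by blast
  then show thesis using that ab(2) by blast
qed

definition pure_closure :: "'a::ab_group_add set \<Rightarrow> 'a set \<Rightarrow> 'a set" where
  "pure_closure G X = {g \<in> G. \<exists>t. t \<noteq> 0 \<and> zmul t g \<in> X}"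

lemma pure_closure_add_subgroup:
  assumes "add_subgroup G" "add_subgroup X" shows "add_subgroup (pure_closure G X)"
proof (rule add_subgroupI)
  show "0 \<in> pure_closure G X"
    using add_subgroup_zero[OF assms(1)] add_subgroup_zero[OF assms(2)]
    by (auto simp: pure_closure_def intro!: exI[of _ 1])
  fix x y assume "x \<in> pure_closure G X" "y \<in> pure_closure G X"
  then obtain t u where *: "x \<in> G" "y \<in> G" "t \<noteq> 0" "u \<noteq> 0" "zmul t x \<in> X" "zmul u y \<in> X"
    by (auto simp: pure_closure_def)
  have "zmul (t * u) (x + y) = zmul u (zmul t x) + zmul t (zmul u y)"
    by (simp add: zmul_add_right zmul_zmul mult.commute)
  also have "\<dots> \<in> X"
    by (rule add_subgroup_add[OF assms(2) add_subgroup_zmul[OF assms(2) *(5)] add_subgroup_zmul[OF assms(2) *(6)]])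
  finally show "x + y \<in> pure_closure G X"
    using * add_subgroup_add[OF assms(1)] unfolding pure_closure_def by (auto intro!: exI[of _ "t * u"])
next
  fix x assume "x \<in> pure_closure G X"
  then show "- x \<in> pure_closure G X"
    using add_subgroup_minus[OF assms(1)] add_subgroup_minus[OF assms(2)]
    unfolding pure_closure_def by (auto simp: zmul_minus_right)
qed

lemma pure_closure_superset: "X \<subseteq> G \<Longrightarrow> X \<subseteq> pure_closure G X"
  by (auto simp: pure_closure_def intro!: exI[of _ 1])

lemma pure_closure_rank_one:
  assumes G: "add_subgroup G" "torsion_free G" and X: "rank_one X" "X \<subseteq> G"
  shows "rank_one (pure_closure G X)"
proof -
  obtain x where x: "x \<in> X" "x \<noteq> 0" using rank_one_nonzero[OF X(1)] .
  have X': "add_subgroup X" using X(1) by (simp add: rank_one_def)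
  show ?thesis
  proof (rule rank_oneI)
    show "add_subgroup (pure_closure G X)" by (rule pure_closure_add_subgroup[OF G(1) X'])
    show "torsion_free (pure_closure G X)"
      by (rule torsion_free_subset[OF G(2)]) (auto simp: pure_closure_def)
    show "x \<in> pure_closure G X" using pure_closure_superset[OF X(2)] x by blast
    fix y assume "y \<in> pure_closure G X"
    then obtain t where t: "t \<noteq> 0" "zmul t y \<in> X" by (auto simp: pure_closure_def)
    obtain a b where ab: "b \<noteq> 0" "zmul b (zmul t y) = zmul a x"
      using rank_one_multiple[OF X(1) x t(2)] .
    then have "to_hull (zmul (b * t) y) = to_hull (zmul a x)" by (simp add: zmul_zmul)
    then have *: "hull_scale (of_int (b * t)) (to_hull y) = hull_scale (of_int a) (to_hull x)"
      by (simp only: to_hull_zmul)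
    have "to_hull y = hull_scale (1 / of_int (b * t)) (hull_scale (of_int (b * t)) (to_hull y))"
      using ab(1) t(1) by simp
    also have "\<dots> = hull_scale (of_int a / of_int (b * t)) (to_hull x)" unfolding * by simp
    finally show "\<exists>q. to_hull y = hull_scale q (to_hull x)" by blast
  qed (rule x(2))
qed

text \<open>Multiplication by the product of all the \<open>t i\<close> turns a relation between the
  closures into one between the \<open>X i\<close>; torsion-freeness removes the factor.\<close>

lemma pure_closure_internal_dsum:
  assumes G: "add_subgroup G" "torsion_free G" and A: "internal_dsum A I X" "A \<subseteq> G"
  shows "internal_dsum {\<Sum>i\<in>I. x i | x. \<forall>i\<in>I. x i \<in> pure_closure G (X i)} I (\<lambda>i. pure_closure G (X i))"
  unfolding internal_dsum_iff
proof (intro conjI allI impI)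
  show "finite I" by (rule internal_dsum_finite[OF A(1)])
  show "\<forall>i\<in>I. add_subgroup (pure_closure G (X i))"
    using pure_closure_add_subgroup[OF G(1) internal_dsum_subgroup[OF A(1)]] by blast
  fix x assume x: "(\<forall>i\<in>I. x i \<in> pure_closure G (X i)) \<and> (\<Sum>i\<in>I. x i) = 0"
  then have "\<forall>i\<in>I. \<exists>t. t \<noteq> 0 \<and> zmul t (x i) \<in> X i" by (auto simp: pure_closure_def)
  then obtain t where t: "\<And>i. i \<in> I \<Longrightarrow> t i \<noteq> 0" "\<And>i. i \<in> I \<Longrightarrow> zmul (t i) (x i) \<in> X i" by metis
  have fin: "finite I" by (rule internal_dsum_finite[OF A(1)])
  have T: "zmul (prod t I) (x i) \<in> X i" if "i \<in> I" for i
  proof -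
    have "zmul (prod t I) (x i) = zmul (prod t (I - {i})) (zmul (t i) (x i))"
      using fin that by (simp add: zmul_zmul prod.remove mult.commute)
    then show ?thesis using add_subgroup_zmul[OF internal_dsum_subgroup[OF A(1) that] t(2)[OF that]] by simp
  qed
  have "(\<Sum>i\<in>I. zmul (prod t I) (x i)) = 0" using x by (simp flip: zmul_sum)
  then have "zmul (prod t I) (x i) = 0" if "i \<in> I" for i
    using internal_dsum_zero[OF A(1) T _ that] by simp
  moreover have "prod t I \<noteq> 0" using fin t(1) by simp
  ultimately show "\<forall>i\<in>I. x i = 0"
    using x torsion_freeD[OF G(2)] unfolding pure_closure_def by blast
qed simp

section \<open>Purity and types of the summands of the regulator\<close>

context crq_group
begin

lemma order_zmul:
  assumes "g \<in> G" shows "zmul (int (order (quot G (Reg G)))) g \<in> Reg G"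
proof -
  let ?N = "int (order (quot G (Reg G)))"
  obtain x where x: "generates_mod G (Reg G) x"
    using cyclic_quotE[OF G(1) Reg(1,2) cyclic] .
  obtain j where j: "g - zmul j x \<in> Reg G" using x assms by (auto simp: generates_mod_def)
  have "zmul (?N * j) x \<in> Reg G"
    using zmul_mem_iff_order_dvd(1)[OF G(1) Reg(1,2) x Reg(3)] by simp
  from add_subgroup_add[OF Reg(1) this add_subgroup_zmul[OF Reg(1) j, of ?N]] show ?thesis by (simp add: zmul_diff_right zmul_zmul)
qed

lemma order_pos: "order (quot G (Reg G)) > 0"
proof -
  obtain x where "generates_mod G (Reg G) x"
    using cyclic_quotE[OF G(1) Reg(1,2) cyclic] .
  then show ?thesis by (rule zmul_mem_iff_order_dvd(2)[OF G(1) Reg(1,2) _ Reg(3)])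
qed

text \<open>The pure closures of all summands together form a completely decomposable subgroup of
  finite index above the regulator, so they stay inside it. Hence \<open>g\<close> lies in the
  regulator, and its components can be compared.\<close>

lemma summand_pure:
  assumes D: "rank1_decomp (Reg G) D" and X: "X \<in> D" and g: "g \<in> G" "t \<noteq> 0" "zmul t g \<in> X"
  shows "g \<in> X"
proof -
  have dsum: "internal_dsum (Reg G) D (\<lambda>X. X)" and r1: "\<And>X. X \<in> D \<Longrightarrow> rank_one X"
    using D by (auto simp: rank1_decomp_def)
  have XG: "X \<subseteq> G" if "X \<in> D" for X
    using internal_dsum_component[OF dsum that] Reg(2) by blast
  define A where "A = {\<Sum>X\<in>D. x X | x. \<forall>X\<in>D. x X \<in> pure_closure G X}"
  have A: "internal_dsum A D (pure_closure G)"
    using pure_closure_internal_dsum[OF G dsum Reg(2)] unfolding A_def .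
  \<comment> \<open>A decomposition is a set of summands, so distinct summands must keep distinct
    closures.\<close>
  have "inj_on (pure_closure G) D"
  proof (rule inj_onI, rule ccontr)
    fix X Y assume XY: "X \<in> D" "Y \<in> D" "pure_closure G X = pure_closure G Y" "X \<noteq> Y"
    obtain x where x: "x \<in> X" "x \<noteq> 0" using rank_one_nonzero[OF r1[OF XY(1)]] .
    have "x \<in> pure_closure G X" using pure_closure_superset[OF XG[OF XY(1)]] x by blast
    then show False using internal_dsum_disjoint[OF A XY(1,2,4)] XY(3) x(2) by blast
  qed
  then have "internal_dsum A (pure_closure G ` D) (\<lambda>X. X)"
    using A by (simp add: internal_dsum_reindex)
  moreover have "rank_one (pure_closure G X)" if "X \<in> D" for X
    by (rule pure_closure_rank_one[OF G r1[OF that] XG[OF that]])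
  ultimately have "completely_decomposable A"
    unfolding completely_decomposable_def rank1_decomp_def by blast
  have subA: "add_subgroup A" by (rule internal_dsum_add_subgroup[OF A])
  have AG: "A \<subseteq> G"
    unfolding A_def by (auto simp: pure_closure_def intro!: add_subgroup_sum[OF G(1)])
  have RA: "Reg G \<subseteq> A"
  proof
    fix a assume "a \<in> Reg G"
    then obtain x where "\<And>X. X \<in> D \<Longrightarrow> x X \<in> X" "a = (\<Sum>X\<in>D. x X)" using internal_dsumE[OF dsum] by metis
    then show "a \<in> A" unfolding A_def using pure_closure_superset[OF XG] by blast
  qed
  have "cd_finite_index G A"
    unfolding cd_finite_index_def
    using subA AG \<open>completely_decomposable A\<close> finite_quot_mono[OF Reg(1) subA RA Reg(3)] by blast
  then have "A = Reg G" using RA by (rule Reg_maximal)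
  have "g \<in> pure_closure G X" using g by (auto simp: pure_closure_def)
  then have "g \<in> Reg G" using internal_dsum_component[OF A X] \<open>A = Reg G\<close> by blast
  then obtain x where x: "\<And>Y. Y \<in> D \<Longrightarrow> x Y \<in> Y" "g = (\<Sum>Y\<in>D. x Y)" using internal_dsumE[OF dsum] by metis
  \<comment> \<open>The difference of two decompositions of \<open>zmul t g\<close>: the multiple of
    that of \<open>g\<close>, and the one concentrated in \<open>X\<close>.\<close>
  define y where "y Y = zmul t (x Y) - (if Y = X then zmul t g else 0)" for Y
  note fin = internal_dsum_finite[OF dsum] and sub = internal_dsum_subgroup[OF dsum]
  have "(\<Sum>Y\<in>D. y Y) = 0"
    using fin X by (simp add: y_def sum_subtractf x(2) zmul_sum)
  moreover have "y Y \<in> Y" if "Y \<in> D" for Y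
    using x(1) sub that g(3) by (auto simp: y_def add_subgroup_zmul intro!: add_subgroup_diff)
  ultimately have "y X = 0" using internal_dsum_zero[OF dsum _ _ X] by blast
  then have "zmul t (x X - g) = 0" by (simp add: y_def zmul_diff_right)
  moreover have "x X - g \<in> G" using XG[OF X] x(1)[OF X] g by (intro add_subgroup_diff[OF G(1)]) auto
  ultimately have "x X = g" using torsion_freeD[OF G(2)] g(2) by fastforce
  then show ?thesis using x(1)[OF X] by simp
qed

lemma given_decomp: "rank1_decomp (Reg G) (given_decomp G)"
  using Reg_regulating(1) unfolding given_decomp_def cd_finite_index_def completely_decomposable_def
  by (blast intro: someI_ex)

lemma summands:
  shows "internal_dsum (Reg G) (given_decomp G) (\<lambda>X. X)" "X \<in> given_decomp G \<Longrightarrow> rank_one X"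
    "X \<in> given_decomp G \<Longrightarrow> X \<subseteq> Reg G"
proof -
  show *: "internal_dsum (Reg G) (given_decomp G) (\<lambda>X. X)" "X \<in> given_decomp G \<Longrightarrow> rank_one X"
    using given_decomp by (auto simp: rank1_decomp_def)
  show "X \<in> given_decomp G \<Longrightarrow> X \<subseteq> Reg G" using internal_dsum_component[OF *(1)] by blast
qed

lemma summand_subset_Reg_at:
  assumes X: "X \<in> given_decomp G" shows "X \<subseteq> Reg_at G (type_of X)"
proof
  fix x assume "x \<in> X"
  define f where "f Y = (if Y = X then x else 0)" for Y
  have "finite {Y \<in> given_decomp G. type_of Y = type_of X}"
    using internal_dsum_finite[OF summands(1)] by simp
  then have "x = (\<Sum>Y | Y \<in> given_decomp G \<and> type_of Y = type_of X. f Y)"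
    using X by (simp add: f_def)
  moreover have "\<forall>Y\<in>given_decomp G. f Y \<in> Y"
    using \<open>x \<in> X\<close> add_subgroup_zero[OF internal_dsum_subgroup[OF summands(1)]] by (auto simp: f_def)
  ultimately show "x \<in> Reg_at G (type_of X)" unfolding Reg_at_def by blast
qed

lemma T_of_eq: "T_of G = type_of ` given_decomp G"
proof (intro equalityI subsetI)
  fix \<tau> assume \<tau>: "\<tau> \<in> T_of G"
  show "\<tau> \<in> type_of ` given_decomp G"
  proof (rule ccontr)
    assume "\<tau> \<notin> type_of ` given_decomp G"
    then have none: "{X. X \<in> given_decomp G \<and> type_of X = \<tau>} = {}" by blast
    have "\<forall>Y\<in>given_decomp G. (\<lambda>_. 0) Y \<in> Y"
      using add_subgroup_zero[OF internal_dsum_subgroup[OF summands(1)]] by blast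
    then have "Reg_at G \<tau> = {0}" unfolding Reg_at_def none by auto
    then show False using \<tau> by (simp add: T_of_def)
  qed
next
  fix \<tau> assume "\<tau> \<in> type_of ` given_decomp G"
  then obtain X where X: "X \<in> given_decomp G" "\<tau> = type_of X" by blast
  obtain x where "x \<in> X" "x \<noteq> 0" using rank_one_nonzero[OF summands(2)[OF X(1)]] .
  then have "x \<in> Reg_at G \<tau>" "x \<noteq> 0" using summand_subset_Reg_at[OF X(1)] X(2) by auto
  then show "\<tau> \<in> T_of G" unfolding T_of_def by blast
qed

lemma Reg_at_unique:
  assumes X: "X \<in> given_decomp G" and inj: "inj_on type_of (given_decomp G)"
  shows "Reg_at G (type_of X) = X"
proof
  have "{Y. Y \<in> given_decomp G \<and> type_of Y = type_of X} = {X}"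
    using X inj by (auto dest: inj_onD)
  then show "Reg_at G (type_of X) \<subseteq> X" unfolding Reg_at_def using X by auto
qed (rule summand_subset_Reg_at[OF X])

text \<open>In a component of rank one any two summands would have a common nonzero multiple.
  Failure of the right-hand side is what yields two coordinates with equal prime sets.\<close>

lemma rigid_iff: "rigid G \<longleftrightarrow> block_rigid G \<and> inj_on type_of (given_decomp G)"
proof -
  have "(\<forall>\<tau>\<in>T_of G. rank (Reg_at G \<tau>) = 1) \<longleftrightarrow> inj_on type_of (given_decomp G)"
  proof
    assume r: "\<forall>\<tau>\<in>T_of G. rank (Reg_at G \<tau>) = 1"
    show "inj_on type_of (given_decomp G)"
    proof (rule inj_onI, rule ccontr)
      fix X Y assume XY: "X \<in> given_decomp G" "Y \<in> given_decomp G" "type_of X = type_of Y" "X \<noteq> Y"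
      obtain x where x: "x \<in> X" "x \<noteq> 0" using rank_one_nonzero[OF summands(2)[OF XY(1)]] .
      obtain y where y: "y \<in> Y" "y \<noteq> 0" using rank_one_nonzero[OF summands(2)[OF XY(2)]] .
      have xyG: "x \<in> G" "y \<in> G" using x y summands(3)[OF XY(1)] summands(3)[OF XY(2)] Reg(2) by auto
      have "rank (Reg_at G (type_of X)) = 1" using r XY(1) T_of_eq by blast
      moreover have "x \<in> Reg_at G (type_of X)" "y \<in> Reg_at G (type_of X)"
        using summand_subset_Reg_at[OF XY(1)] summand_subset_Reg_at[OF XY(2)] XY(3) x y by auto
      ultimately obtain q where q: "to_hull y = hull_scale q (to_hull x)"
        using rank_1_multiple[of "Reg_at G (type_of X)" x y] to_hull_eq_0_iff[OF G xyG(1)] x(2) by metis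
      obtain a b where ab: "q = of_int a / of_int b" "b \<noteq> 0" by (rule rational_fraction)
      have "to_hull (zmul b y) = to_hull (zmul a x)" using ab by (simp add: to_hull_zmul q)
      then have eq: "zmul b y = zmul a x"
        using to_hull_eqD[OF G] add_subgroup_zmul[OF G(1)] xyG by blast
      have "zmul b y \<in> Y" "zmul a x \<in> X"
        using add_subgroup_zmul internal_dsum_subgroup[OF summands(1)] XY x y by blast+
      then have "zmul b y = 0"
        using internal_dsum_disjoint[OF summands(1) XY(1,2,4)] eq by simp
      then show False using torsion_freeD[OF G(2) xyG(2) ab(2)] y(2) by blast
    qed
  next
    assume inj: "inj_on type_of (given_decomp G)"
    then show "\<forall>\<tau>\<in>T_of G. rank (Reg_at G \<tau>) = 1"
      using Reg_at_unique summands(2) unfolding T_of_eq rank_one_def by simp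
  qed
  then show ?thesis by (simp add: rigid_def)
qed

lemma rigid_Reg_at:
  assumes "rigid G"
  shows "internal_dsum (Reg G) (T_of G) (Reg_at G)"
    and "\<tau> \<in> T_of G \<Longrightarrow> rank_one (Reg_at G \<tau>)"
    and "\<tau> \<in> T_of G \<Longrightarrow> type_of (Reg_at G \<tau>) = \<tau>"
    and "\<tau> \<in> T_of G \<Longrightarrow> g \<in> G \<Longrightarrow> t \<noteq> 0 \<Longrightarrow> zmul t g \<in> Reg_at G \<tau> \<Longrightarrow> g \<in> Reg_at G \<tau>"
proof -
  have inj: "inj_on type_of (given_decomp G)" using assms by (simp add: rigid_iff)
  have X: "Reg_at G \<tau> \<in> given_decomp G" "type_of (Reg_at G \<tau>) = \<tau>" if "\<tau> \<in> T_of G" for \<tau>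
    using that Reg_at_unique[OF _ inj] unfolding T_of_eq by auto
  have "Reg_at G ` T_of G = given_decomp G"
    using Reg_at_unique[OF _ inj] unfolding T_of_eq by (simp add: image_image)
  moreover have "inj_on (Reg_at G) (T_of G)" using X(2) by (metis inj_onI)
  ultimately show "internal_dsum (Reg G) (T_of G) (Reg_at G)"
    using summands(1) internal_dsum_reindex by metis
  show "\<tau> \<in> T_of G \<Longrightarrow> rank_one (Reg_at G \<tau>)" "\<tau> \<in> T_of G \<Longrightarrow> type_of (Reg_at G \<tau>) = \<tau>"
    using X summands(2) by blast+
  show "\<tau> \<in> T_of G \<Longrightarrow> g \<in> G \<Longrightarrow> t \<noteq> 0 \<Longrightarrow> zmul t g \<in> Reg_at G \<tau> \<Longrightarrow> g \<in> Reg_at G \<tau>"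
    using summand_pure[OF given_decomp X(1)] by blast
qed

end



text \<open>A nonzero \<open>x\<close> identifies \<open>X\<close> with the group \<open>Q\<close>
  of its rational coefficients, to which \<open>idempotent_type_generator\<close> applies. The last
  conclusion supplies the existence that \<open>R_ring_eq\<close> asks for.\<close>

lemma rank_one_idempotent:
  assumes X: "rank_one X" and idem: "idempotent_type (type_of X)"
  obtains f where "f \<in> X" "f \<noteq> 0"
    "to_hull ` X = (\<lambda>r. hull_scale r (to_hull f)) ` Rloc (P_inf (type_of X))"
    "type_of (Rloc (P_inf (type_of X))) = type_of X"
proof -
  have sub: "add_subgroup X" and tf: "torsion_free X" and r1: "rank X = 1"
    using X by (auto simp: rank_one_def)
  have image: "type_of (to_hull ` X) = type_of X"
    by (rule type_of_iso[OF additive_to_hull[OF sub] inj_on_to_hull[OF sub tf]])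
  have scale: "additive_on Q (\<lambda>r. hull_scale r u)" "u \<noteq> 0 \<Longrightarrow> inj_on (\<lambda>r. hull_scale r u) Q"
    if "add_subgroup Q" for Q and u :: "'a div_hull"
    using that by (auto simp: additive_on_def hull.scale_left_distrib inj_on_def)
  obtain x where x: "x \<in> X" "x \<noteq> 0" using rank_one_nonzero[OF X] .
  have x0: "to_hull x \<noteq> 0" using x by (simp add: to_hull_eq_0_iff[OF sub tf])
  define Q where "Q = {q. hull_scale q (to_hull x) \<in> to_hull ` X}"
  have hX: "add_subgroup (to_hull ` X)" by (rule additive_on.subgroup_image[OF additive_to_hull[OF sub]])
  have subQ: "add_subgroup Q"
    by (rule add_subgroupI) (auto simp: Q_def hull.scale_left_distrib
        intro: add_subgroup_zero[OF hX] add_subgroup_add[OF hX] add_subgroup_minus[OF hX])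
  interpret rat_subgroup Q by (simp add: rat_subgroup_def subQ)
  have im: "(\<lambda>q. hull_scale q (to_hull x)) ` Q = to_hull ` X"
  proof (intro equalityI subsetI)
    fix u assume "u \<in> to_hull ` X"
    then obtain y where y: "y \<in> X" "u = to_hull y" by blast
    obtain q where q: "to_hull y = hull_scale q (to_hull x)"
      using rank_1_multiple[OF r1 x(1) x0 y(1)] .
    then have "q \<in> Q" using y(1) unfolding Q_def by (metis imageI mem_Collect_eq)
    then show "u \<in> (\<lambda>q. hull_scale q (to_hull x)) ` Q" unfolding y(2) q by (rule imageI)
  qed (auto simp: Q_def)
  have typeQ: "type_of Q = type_of X"
    using type_of_iso[OF scale(1)[OF subQ] scale(2)[OF subQ x0]] unfolding im image by simp
  have 1: "1 \<in> Q" using x by (simp add: Q_def)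
  obtain q where q: "q \<in> Q" "q \<noteq> 0" "Q = (\<lambda>r. r * q) ` Rloc (P_inf (type_of Q))"
    using idempotent_type_generator[OF 1] idem typeQ by auto
  obtain f where f: "f \<in> X" "to_hull f = hull_scale q (to_hull x)"
    using q(1) unfolding Q_def by (metis (mono_tags, lifting) imageE mem_Collect_eq)
  have f0: "to_hull f \<noteq> 0" using f q(2) x0 by simp
  have imf: "to_hull ` X = (\<lambda>r. hull_scale r (to_hull f)) ` Rloc (P_inf (type_of X))"
    unfolding im[symmetric] f(2) by (subst q(3)) (simp add: typeQ image_image)
  moreover have "type_of (Rloc (P_inf (type_of X))) = type_of X"
    using type_of_iso[OF scale(1)[OF Rloc_add_subgroup]
        scale(2)[OF Rloc_add_subgroup[of "P_inf (type_of X)"] f0]] image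
    by (simp flip: imf)
  ultimately show thesis using that[OF f(1)] f0 by fastforce
qed

section \<open>Coordinates with respect to generators of the summands\<close>

definition hull_comb :: "'i set \<Rightarrow> ('i \<Rightarrow> 'a::ab_group_add) \<Rightarrow> ('i \<Rightarrow> rat) \<Rightarrow> 'a div_hull" where
  "hull_comb I f c = (\<Sum>i\<in>I. hull_scale (c i) (to_hull (f i)))"

definition coord_group :: "'a::ab_group_add set \<Rightarrow> 'i set \<Rightarrow> ('i \<Rightarrow> 'a) \<Rightarrow> ('i \<Rightarrow> rat) set" where
  "coord_group G I f = {c. (\<forall>i. i \<notin> I \<longrightarrow> c i = 0) \<and> hull_comb I f c \<in> to_hull ` G}"

lemma hull_comb_add: "hull_comb I f (c + c') = hull_comb I f c + hull_comb I f c'"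
  by (simp add: hull_comb_def hull.scale_left_distrib sum.distrib)

lemma hull_comb_minus: "hull_comb I f (- c) = - hull_comb I f c"
  by (simp add: hull_comb_def sum_negf)

lemma hull_comb_0: "hull_comb I f 0 = 0"
  by (simp add: hull_comb_def)

lemma hull_comb_scale: "hull_scale r (hull_comb I f c) = hull_comb I f (\<lambda>i. r * c i)"
  by (simp add: hull_comb_def hull.scale_sum_right)

lemma hull_comb_single:
  assumes "finite I" "i \<in> I" shows "hull_comb I f (single i r) = hull_scale r (to_hull (f i))"
proof -
  have "hull_comb I f (single i r) = (\<Sum>j\<in>I. if j = i then hull_scale r (to_hull (f i)) else 0)"
    unfolding hull_comb_def by (intro sum.cong) (auto simp: single_apply)
  then show ?thesis using assms by simp
qed

lemma coord_group_add_subgroup: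
  assumes "add_subgroup G" shows "add_subgroup (coord_group G I f)"
proof -
  have hG: "add_subgroup (to_hull ` G)"
    by (rule additive_on.subgroup_image[OF additive_to_hull[OF assms]])
  show ?thesis
    by (rule add_subgroupI) (auto simp: coord_group_def hull_comb_add hull_comb_minus hull_comb_0
        intro: add_subgroup_zero[OF hG] add_subgroup_add[OF hG] add_subgroup_minus[OF hG])
qed

text \<open>The index is kept general because two kinds occur: the rank-one summands when types may
  repeat, and the types themselves in the rigid case.\<close>

locale frame =
  fixes G A :: "'a::ab_group_add set" and I :: "'i set" and X :: "'i \<Rightarrow> 'a set"
    and P :: "'i \<Rightarrow> nat set" and f :: "'i \<Rightarrow> 'a" and N :: int
  assumes G: "add_subgroup G" "torsion_free G"
    and dsum: "internal_dsum A I X" and AG: "A \<subseteq> G"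
    and N: "N \<noteq> 0" "g \<in> G \<Longrightarrow> zmul N g \<in> A"
    and f: "i \<in> I \<Longrightarrow> f i \<in> X i" "i \<in> I \<Longrightarrow> f i \<noteq> 0"
    and X: "i \<in> I \<Longrightarrow> to_hull ` X i = (\<lambda>r. hull_scale r (to_hull (f i))) ` Rloc (P i)"
    and prime: "p \<in> P i \<Longrightarrow> prime p"
begin

lemma fin: "finite I" by (rule internal_dsum_finite[OF dsum])

lemma XG: "i \<in> I \<Longrightarrow> X i \<subseteq> G"
  using internal_dsum_component[OF dsum] AG by blast

lemma independent:
  assumes "hull_comb I f c = 0" "i \<in> I" shows "c i = 0"
proof -
  obtain M a where M: "M > 0" and a: "\<And>i. i \<in> I \<Longrightarrow> of_int M * c i = of_int (a i)"
    using common_denominator[OF fin, of c] by metis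
  have mem: "zmul (a i) (f i) \<in> X i" if "i \<in> I" for i
    using add_subgroup_zmul[OF internal_dsum_subgroup[OF dsum that] f(1)[OF that]] .
  have "to_hull (\<Sum>i\<in>I. zmul (a i) (f i)) = hull_scale (of_int M) (hull_comb I f c)"
    unfolding hull_comb_scale by (simp add: to_hull_sum to_hull_zmul hull_comb_def flip: a)
  also have "\<dots> = 0" by (simp add: assms(1))
  finally have *: "to_hull (\<Sum>i\<in>I. zmul (a i) (f i)) = 0" .
  have "(\<Sum>i\<in>I. zmul (a i) (f i)) \<in> G" using mem XG by (intro add_subgroup_sum[OF G(1)]) blast
  then have sum0: "(\<Sum>i\<in>I. zmul (a i) (f i)) = 0" using * to_hull_eq_0_iff[OF G] by blast
  have "zmul (a i) (f i) = 0" using internal_dsum_zero[OF dsum _ sum0 assms(2)] mem by blast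
  moreover have "f i \<in> G" "f i \<noteq> 0" using f[OF assms(2)] XG[OF assms(2)] by auto
  ultimately have "a i = 0" using torsion_freeD[OF G(2)] by blast
  then show ?thesis using a[OF assms(2)] M by simp
qed

lemma comb_eq_iff: "hull_comb I f c = hull_comb I f c' \<longleftrightarrow> (\<forall>i\<in>I. c i = c' i)"
proof
  assume "hull_comb I f c = hull_comb I f c'"
  then have "hull_comb I f (c + - c') = 0" unfolding hull_comb_add hull_comb_minus by simp
  then show "\<forall>i\<in>I. c i = c' i" using independent by fastforce
qed (simp add: hull_comb_def)

lemma mem_A_iff: "hull_comb I f c \<in> to_hull ` A \<longleftrightarrow> (\<forall>i\<in>I. c i \<in> Rloc (P i))"
proof
  assume "hull_comb I f c \<in> to_hull ` A"
  then obtain x where x: "\<And>i. i \<in> I \<Longrightarrow> x i \<in> X i" "hull_comb I f c = to_hull (\<Sum>i\<in>I. x i)"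
    using internal_dsumE[OF dsum] by (metis (no_types, lifting) imageE)
  have "\<forall>i\<in>I. \<exists>r\<in>Rloc (P i). to_hull (x i) = hull_scale r (to_hull (f i))"
    using x(1) X by blast
  then obtain r where r: "\<And>i. i \<in> I \<Longrightarrow> r i \<in> Rloc (P i)"
    "\<And>i. i \<in> I \<Longrightarrow> to_hull (x i) = hull_scale (r i) (to_hull (f i))" by metis
  have "hull_comb I f c = hull_comb I f r"
    unfolding x(2) by (simp add: to_hull_sum hull_comb_def r(2))
  then show "\<forall>i\<in>I. c i \<in> Rloc (P i)" using r(1) by (simp add: comb_eq_iff)
next
  assume "\<forall>i\<in>I. c i \<in> Rloc (P i)"
  then have "\<forall>i\<in>I. \<exists>x\<in>X i. to_hull x = hull_scale (c i) (to_hull (f i))"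
    using X by (metis (no_types, lifting) imageE imageI)
  then obtain x where x: "\<And>i. i \<in> I \<Longrightarrow> x i \<in> X i" "\<And>i. i \<in> I \<Longrightarrow> to_hull (x i) = hull_scale (c i) (to_hull (f i))"
    by metis
  then have "hull_comb I f c = to_hull (\<Sum>i\<in>I. x i)" by (simp add: hull_comb_def to_hull_sum)
  moreover have "(\<Sum>i\<in>I. x i) \<in> A" unfolding internal_dsum_eq[OF dsum] using x(1) by blast
  ultimately show "hull_comb I f c \<in> to_hull ` A" by blast
qed

lemma coordinates:
  assumes "g \<in> G"
  obtains c where "to_hull g = hull_comb I f c" "\<And>i. i \<notin> I \<Longrightarrow> c i = 0"
proof -
  obtain x where x: "\<And>i. i \<in> I \<Longrightarrow> x i \<in> X i" "zmul N g = (\<Sum>i\<in>I. x i)"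
    using internal_dsumE[OF dsum N(2)[OF assms]] by metis
  have "\<forall>i\<in>I. \<exists>r\<in>Rloc (P i). to_hull (x i) = hull_scale r (to_hull (f i))"
    using x(1) X by blast
  then obtain r where r: "\<And>i. i \<in> I \<Longrightarrow> to_hull (x i) = hull_scale (r i) (to_hull (f i))" by metis
  define c where "c i = (if i \<in> I then r i / of_int N else 0)" for i
  have "to_hull (zmul N g) = hull_comb I f r"
    unfolding x(2) by (simp add: to_hull_sum hull_comb_def r)
  then have "hull_scale (1 / of_int N) (hull_scale (of_int N) (to_hull g)) = hull_scale (1 / of_int N) (hull_comb I f r)"
    by (simp add: to_hull_zmul)
  then have "to_hull g = hull_scale (1 / of_int N) (hull_comb I f r)" using N(1) by simp
  also have "\<dots> = hull_comb I f c" unfolding hull_comb_scale comb_eq_iff by (simp add: c_def)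
  finally show thesis using that by (simp add: c_def)
qed

lemma bounded:
  assumes "c \<in> coord_group G I f" "i \<in> I" shows "of_int N * c i \<in> Rloc (P i)"
proof -
  obtain g where g: "g \<in> G" "hull_comb I f c = to_hull g" using assms(1) by (auto simp: coord_group_def)
  have "hull_comb I f (\<lambda>i. of_int N * c i) = to_hull (zmul N g)"
    by (simp add: hull_comb_scale[symmetric] g(2) to_hull_zmul)
  then have "hull_comb I f (\<lambda>i. of_int N * c i) \<in> to_hull ` A" using N(2)[OF g(1)] by simp
  then show ?thesis using assms(2) by (simp add: mem_A_iff)
qed

lemma coord_subgroup: "coord_subgroup I P (coord_group G I f)"
proof (rule coord_subgroup.intro)
  fix i r assume ir: "i \<in> I" "r \<in> Rloc (P i)"
  then have "hull_comb I f (single i r) \<in> to_hull ` X i"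
    unfolding hull_comb_single[OF fin ir(1)] X[OF ir(1)] by blast
  then show "single i r \<in> coord_group G I f"
    using XG[OF ir(1)] ir(1) by (auto simp: coord_group_def single_apply)
qed (auto simp: fin prime coord_group_add_subgroup[OF G(1)], simp add: coord_group_def)

lemma iso_coord_group: "add_group G \<cong> add_group (coord_group G I f)"
proof -
  let ?K = "coord_group G I f"
  have subK: "add_subgroup ?K" by (rule coord_group_add_subgroup[OF G(1)])
  then interpret c: additive_on ?K "hull_comb I f" by (simp add: additive_on_def hull_comb_add)
  have "hull_comb I f ` ?K = to_hull ` G"
  proof (intro equalityI subsetI)
    fix u assume "u \<in> to_hull ` G"
    then obtain g where g: "g \<in> G" "u = to_hull g" by blast
    obtain c where c: "to_hull g = hull_comb I f c" "\<And>i. i \<notin> I \<Longrightarrow> c i = 0"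
      using coordinates[OF g(1)] by metis
    then have "c \<in> ?K" using g(1) by (auto simp: coord_group_def c(1)[symmetric])
    then show "u \<in> hull_comb I f ` ?K" using g(2) c(1) by blast
  qed (auto simp: coord_group_def)
  moreover have "inj_on (hull_comb I f) ?K"
  proof (rule inj_onI, rule ext)
    fix c c' i assume *: "c \<in> ?K" "c' \<in> ?K" "hull_comb I f c = hull_comb I f c'"
    show "c i = c' i"
      using * by (cases "i \<in> I") (auto simp: comb_eq_iff coord_group_def)
  qed
  ultimately have "add_group ?K \<cong> add_group (to_hull ` G)" using c.iso_image by simp
  then have "add_group (to_hull ` G) \<cong> add_group ?K" by (rule group.iso_sym[OF group_add_group[OF subK]])
  moreover have "add_group G \<cong> add_group (to_hull ` G)"
    by (rule additive_on.iso_image[OF additive_to_hull[OF G(1)] inj_on_to_hull[OF G]])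
  ultimately show ?thesis by (rule iso_trans[rotated])
qed

end

lemma (in frame) iso_Mult_iff:
  "add_group G \<cong> Mult G \<longleftrightarrow> add_group (coord_group G I f) \<cong> Bil (coord_group G I f)"
proof -
  let ?K = "coord_group G I f"
  have GK: "add_group G \<cong> add_group ?K" by (rule iso_coord_group)
  then have KG: "add_group ?K \<cong> add_group G" by (rule group.iso_sym[OF group_add_group[OF G(1)]])
  have subK: "add_subgroup ?K" by (rule coord_group_add_subgroup[OF G(1)])
  show ?thesis
    using GK KG Mult_iso_Bil[OF G(1)] Bil_iso_Mult[OF G(1)] Bil_iso_cong[OF GK G(1)] Bil_iso_cong[OF KG subK]
      iso_trans by metis
qed

lemma crq_groupI: "class_A0 G \<Longrightarrow> crq_group G"
  by (auto simp: class_A0_def block_rigid_def crq_group_def)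

section \<open>Frames for the regulator and the necessity of rigidity\<close>

context crq_group
begin

lemma frameI:
  assumes "internal_dsum (Reg G) I X" "\<And>i. i \<in> I \<Longrightarrow> f i \<in> X i" "\<And>i. i \<in> I \<Longrightarrow> f i \<noteq> 0"
    and "\<And>i. i \<in> I \<Longrightarrow> to_hull ` X i = (\<lambda>r. hull_scale r (to_hull (f i))) ` Rloc (P i)"
    and "\<And>i p. p \<in> P i \<Longrightarrow> prime p"
  shows "frame G (Reg G) I X P f (int (order (quot G (Reg G))))"
  using assms G Reg(2) order_zmul order_pos by (intro frame.intro) auto

lemma summand_generators:
  assumes "ring_type G"
  obtains f where "\<And>X. X \<in> given_decomp G \<Longrightarrow> f X \<in> X" "\<And>X. X \<in> given_decomp G \<Longrightarrow> f X \<noteq> 0"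
    "\<And>X. X \<in> given_decomp G \<Longrightarrow>
      to_hull ` X = (\<lambda>r. hull_scale r (to_hull (f X))) ` Rloc (P_inf (type_of X))"
proof -
  have "\<exists>f. f \<in> X \<and> f \<noteq> 0 \<and> to_hull ` X = (\<lambda>r. hull_scale r (to_hull f)) ` Rloc (P_inf (type_of X))"
    if "X \<in> given_decomp G" for X
  proof -
    have "idempotent_type (type_of X)" using assms that T_of_eq by (auto simp: ring_type_def)
    then show ?thesis using rank_one_idempotent[OF summands(2)[OF that]] by metis
  qed
  then show thesis using that by metis
qed

lemma type_of_Rloc_P_inf:
  assumes "ring_type G" "\<tau> \<in> T_of G" shows "type_of (Rloc (P_inf \<tau>)) = \<tau>"
proof -
  obtain X where X: "X \<in> given_decomp G" "\<tau> = type_of X" using assms(2) T_of_eq by blast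
  then show ?thesis
    using rank_one_idempotent[OF summands(2)[OF X(1)]] assms by (metis ring_type_def)
qed

text \<open>An idempotent type is that of the localization at its infinite primes, so an inclusion
  of prime sets would make the types comparable.\<close>

lemma P_inf_incomparable:
  assumes "block_rigid G" "ring_type G" "\<sigma> \<in> T_of G" "\<tau> \<in> T_of G" "P_inf \<sigma> \<subseteq> P_inf \<tau>"
  shows "\<sigma> = \<tau>"
proof (rule ccontr)
  assume "\<sigma> \<noteq> \<tau>"
  moreover have "type_le \<sigma> \<tau>"
    using type_le_Rloc[OF assms(5)] type_of_Rloc_P_inf[OF assms(2)] assms(3,4) by simp
  ultimately show False using assms unfolding block_rigid_def by blast
qed

text \<open>Indexing the coordinates by summands keeps two summands of one type apart; these are the
  equal blocks of \<open>not_iso_Bil\<close>.\<close>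

lemma iso_Mult_imp_rigid:
  assumes "block_rigid G" "ring_type G" "add_group G \<cong> Mult G"
  shows "rigid G"
proof (rule ccontr)
  assume "\<not> rigid G"
  then have "\<not> inj_on type_of (given_decomp G)" using assms(1) by (simp add: rigid_iff)
  then obtain X Y where XY: "X \<in> given_decomp G" "Y \<in> given_decomp G" "X \<noteq> Y" "type_of X = type_of Y"
    by (auto simp: inj_on_def)
  obtain f where f: "\<And>X. X \<in> given_decomp G \<Longrightarrow> f X \<in> X" "\<And>X. X \<in> given_decomp G \<Longrightarrow> f X \<noteq> 0"
    "\<And>X. X \<in> given_decomp G \<Longrightarrow>
      to_hull ` X = (\<lambda>r. hull_scale r (to_hull (f X))) ` Rloc (P_inf (type_of X))"
    using summand_generators[OF assms(2)] by metis
  interpret F: frame G "Reg G" "given_decomp G" "\<lambda>X. X" "\<lambda>X. P_inf (type_of X)" f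
    "int (order (quot G (Reg G)))"
    using f summands(1) by (intro frameI) (auto simp: P_inf_def)
  interpret K: coord_subgroup "given_decomp G" "\<lambda>X. P_inf (type_of X)" "coord_group G (given_decomp G) f"
    by (rule F.coord_subgroup)
  have "\<not> add_group (coord_group G (given_decomp G) f) \<cong> Bil (coord_group G (given_decomp G) f)"
    using K.not_iso_Bil[OF XY(1-3), of "int (order (quot G (Reg G)))"] F.N(1) F.bounded XY(4) by simp
  then show False using assms(3) F.iso_Mult_iff by simp
qed

end

lemma main_decomp_pure:
  assumes "main_decomp G G1 C" "add_subgroup G" "torsion_free G"
  shows "G1 \<subseteq> G" and "g \<in> G \<Longrightarrow> t \<noteq> 0 \<Longrightarrow> zmul t g \<in> G1 \<Longrightarrow> g \<in> G1"
proof -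
  have sub: "add_subgroup G1" "add_subgroup C" and bij: "bij_betw (\<lambda>(x, y). x + y) (G1 \<times> C) G"
    using assms(1) by (auto simp: main_decomp_def internal_dsum2_def)
  have mem: "x + y \<in> G" if "x \<in> G1" "y \<in> C" for x y
    using bij_betwE[OF bij] that by auto
  show G1: "G1 \<subseteq> G" using mem[OF _ add_subgroup_zero[OF sub(2)]] by auto
  have CG: "C \<subseteq> G" using mem[OF add_subgroup_zero[OF sub(1)]] by auto
  assume g: "g \<in> G" "t \<noteq> 0" "zmul t g \<in> G1"
  then obtain x y where xy: "x \<in> G1" "y \<in> C" "g = x + y"
    using bij by (auto simp: bij_betw_def image_iff)
  have "(\<lambda>(x, y). x + y) (zmul t x, zmul t y) = (\<lambda>(x, y). x + y) (zmul t g, 0)"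
    by (simp add: xy(3) zmul_add_right)
  moreover have "(zmul t x, zmul t y) \<in> G1 \<times> C" "(zmul t g, 0) \<in> G1 \<times> C"
    using xy g add_subgroup_zmul sub add_subgroup_zero by auto
  ultimately have "(zmul t x, zmul t y) = (zmul t g, 0)"
    using bij by (meson bij_betw_imp_inj_on inj_onD)
  then have "y = 0" using torsion_freeD[OF assms(3) _ g(2)] xy(2) CG by blast
  then show "g \<in> G1" using xy by simp
qed

section \<open>The standard representation of a rigid group\<close>

locale rigid_setting =
  fixes G G1 C :: "'a::ab_group_add set" and e :: "gtype \<Rightarrow> 'a" and d :: 'a and s :: "gtype \<Rightarrow> int"
  assumes A0: "class_A0 G" and main: "main_decomp G G1 C" and rc: "rc_basis G G1 e"
    and std: "std_repr G G1 e d s" and rigid: "rigid G"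
begin

sublocale crq_group G by (rule crq_groupI[OF A0])

sublocale G1: crq_group G1
  using main by (auto simp: main_decomp_def rigid_def block_rigid_def crq_group_def)

lemma ring_type: "ring_type G" and block_rigid: "block_rigid G"
  using A0 by (auto simp: class_A0_def)

lemma T0_subset: "T0 G \<subseteq> T_of G"
  by (auto simp: T0_def)

lemma T1_eq: "T1 G = T0 G"
  using rigid by (auto simp: T0_def T1_def rigid_def)

lemma T_of_G1: "T_of G1 = T0 G" and rigid_G1: "rigid G1"
  using main by (auto simp: main_decomp_def)

lemma R_ring: "\<tau> \<in> T_of G \<Longrightarrow> R_ring \<tau> = Rloc (P_inf \<tau>)"
  by (rule R_ring_eq[OF type_of_Rloc_P_inf[OF ring_type]])

lemma G1_pure: "G1 \<subseteq> G" "g \<in> G \<Longrightarrow> t \<noteq> 0 \<Longrightarrow> zmul t g \<in> G1 \<Longrightarrow> g \<in> G1"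
  using main_decomp_pure[OF main G] by blast+

lemma e_mem: "\<tau> \<in> T0 G \<Longrightarrow> e \<tau> \<in> Reg_at G1 \<tau>"
  using rc by (simp add: rc_basis_def)

lemma e_dsum: "internal_dsum (to_hull ` Reg G1) (T0 G) (\<lambda>\<tau>. {hull_scale r (to_hull (e \<tau>)) | r. r \<in> R_ring \<tau>})"
  using rc by (simp add: rc_basis_def)

lemma Reg_at_G1_dsum: "internal_dsum (Reg G1) (T0 G) (Reg_at G1)"
  using G1.rigid_Reg_at(1)[OF rigid_G1] by (simp add: T_of_G1)

lemma Reg_at_G1_G: "\<tau> \<in> T0 G \<Longrightarrow> Reg_at G1 \<tau> \<subseteq> G1"
  using internal_dsum_component[OF Reg_at_G1_dsum] G1.Reg(2) by blast

text \<open>The sum over the rc-basis refines the decomposition by types, because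
  \<open>e \<sigma>\<close> lies in the component at \<open>\<sigma>\<close>; comparing components
  leaves only the term at \<open>\<tau>\<close>.\<close>

lemma Reg_at_G1_subset:
  assumes \<tau>: "\<tau> \<in> T0 G" and y: "y \<in> Reg_at G1 \<tau>"
  obtains r where "r \<in> Rloc (P_inf \<tau>)" "to_hull y = hull_scale r (to_hull (e \<tau>))"
proof -
  have fin: "finite (T0 G)" by (rule internal_dsum_finite[OF e_dsum])
  have "to_hull y \<in> to_hull ` Reg G1"
    using internal_dsum_component[OF Reg_at_G1_dsum \<tau> y] by blast
  from internal_dsum_ex[OF e_dsum this]
  obtain u where u: "\<forall>\<sigma>\<in>T0 G. u \<sigma> \<in> {hull_scale r (to_hull (e \<sigma>)) | r. r \<in> R_ring \<sigma>}"
    "to_hull y = (\<Sum>\<sigma>\<in>T0 G. u \<sigma>)" by (elim exE conjE)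
  have "\<forall>\<sigma>\<in>T0 G. \<exists>r. u \<sigma> = hull_scale r (to_hull (e \<sigma>)) \<and> r \<in> R_ring \<sigma>" using u(1) by simp
  then obtain r where r: "\<And>\<sigma>. \<sigma> \<in> T0 G \<Longrightarrow> r \<sigma> \<in> R_ring \<sigma>"
    "\<And>\<sigma>. \<sigma> \<in> T0 G \<Longrightarrow> u \<sigma> = hull_scale (r \<sigma>) (to_hull (e \<sigma>))" by metis
  obtain M a where M: "M > 0" and a: "\<And>\<sigma>. \<sigma> \<in> T0 G \<Longrightarrow> of_int M * r \<sigma> = of_int (a \<sigma>)"
    using common_denominator[OF fin, of r] by metis
  have ae: "zmul (a \<sigma>) (e \<sigma>) \<in> Reg_at G1 \<sigma>" if "\<sigma> \<in> T0 G" for \<sigma>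
    using add_subgroup_zmul[OF internal_dsum_subgroup[OF Reg_at_G1_dsum that] e_mem[OF that]] .
  have My: "zmul M y \<in> Reg_at G1 \<tau>"
    using add_subgroup_zmul[OF internal_dsum_subgroup[OF Reg_at_G1_dsum \<tau>] y] .
  have "to_hull (zmul M y) = (\<Sum>\<sigma>\<in>T0 G. hull_scale (of_int M * r \<sigma>) (to_hull (e \<sigma>)))"
    by (simp add: to_hull_zmul u(2) r(2) hull.scale_sum_right)
  also have "\<dots> = to_hull (\<Sum>\<sigma>\<in>T0 G. zmul (a \<sigma>) (e \<sigma>))"
    by (simp add: to_hull_sum to_hull_zmul a)
  finally have eq: "to_hull (zmul M y) = to_hull (\<Sum>\<sigma>\<in>T0 G. zmul (a \<sigma>) (e \<sigma>))" .
  have "(\<Sum>\<sigma>\<in>T0 G. zmul (a \<sigma>) (e \<sigma>)) \<in> G1"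
    using ae Reg_at_G1_G by (intro add_subgroup_sum[OF G1.G(1)]) blast
  then have My_eq: "zmul M y = (\<Sum>\<sigma>\<in>T0 G. zmul (a \<sigma>) (e \<sigma>))"
    using to_hull_eqD[OF G1.G _ _ eq] My Reg_at_G1_G[OF \<tau>] by blast
  \<comment> \<open>The difference of two decompositions of \<open>zmul M y\<close>: along the
    rc-basis, and concentrated at \<open>\<tau>\<close>.\<close>
  define z where "z \<sigma> = zmul (a \<sigma>) (e \<sigma>) - (if \<sigma> = \<tau> then zmul M y else 0)" for \<sigma>
  have zsum: "(\<Sum>\<sigma>\<in>T0 G. z \<sigma>) = 0"
    using fin \<tau> by (simp add: z_def sum_subtractf My_eq)
  have zmem: "z \<sigma> \<in> Reg_at G1 \<sigma>" if "\<sigma> \<in> T0 G" for \<sigma>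
  proof -
    have "(if \<sigma> = \<tau> then zmul M y else 0) \<in> Reg_at G1 \<sigma>"
      using My add_subgroup_zero[OF internal_dsum_subgroup[OF Reg_at_G1_dsum that]] by auto
    then show ?thesis unfolding z_def
      by (intro add_subgroup_diff[OF internal_dsum_subgroup[OF Reg_at_G1_dsum that] ae[OF that]])
  qed
  have "z \<tau> = 0" using internal_dsum_zero[OF Reg_at_G1_dsum _ zsum \<tau>] zmem by blast
  then have "zmul (a \<tau>) (e \<tau>) = zmul M y" by (simp add: z_def)
  then have "to_hull (zmul M y) = to_hull (zmul (a \<tau>) (e \<tau>))" by simp
  then have "hull_scale (of_int M) (to_hull y) = hull_scale (of_int M) (hull_scale (r \<tau>) (to_hull (e \<tau>)))"
    by (simp add: to_hull_zmul a[OF \<tau>])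
  then have "to_hull y = hull_scale (r \<tau>) (to_hull (e \<tau>))"
    using M unfolding hull.scale_cancel_left by auto
  then show thesis using that r(1)[OF \<tau>] R_ring T0_subset \<tau> by blast
qed

lemma e_nonzero: assumes "\<tau> \<in> T0 G" shows "e \<tau> \<noteq> 0"
proof
  assume "e \<tau> = 0"
  obtain y where y: "y \<in> Reg_at G1 \<tau>" "y \<noteq> 0"
    using rank_one_nonzero G1.rigid_Reg_at(2)[OF rigid_G1] assms T_of_G1 by metis
  then have "to_hull y = 0" using Reg_at_G1_subset[OF assms y(1)] \<open>e \<tau> = 0\<close> by auto
  then show False using to_hull_eq_0_iff[OF G1.G] y Reg_at_G1_G[OF assms] by blast
qed

lemma Reg_at_generators:
  obtains f where "\<And>\<tau>. \<tau> \<in> T_of G \<Longrightarrow> f \<tau> \<in> Reg_at G \<tau>" "\<And>\<tau>. \<tau> \<in> T_of G \<Longrightarrow> f \<tau> \<noteq> 0"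
    "\<And>\<tau>. \<tau> \<in> T_of G \<Longrightarrow> to_hull ` Reg_at G \<tau> = (\<lambda>r. hull_scale r (to_hull (f \<tau>))) ` Rloc (P_inf \<tau>)"
proof -
  have "\<exists>f. f \<in> Reg_at G \<tau> \<and> f \<noteq> 0 \<and>
      to_hull ` Reg_at G \<tau> = (\<lambda>r. hull_scale r (to_hull f)) ` Rloc (P_inf \<tau>)"
    if "\<tau> \<in> T_of G" for \<tau>
  proof -
    have "idempotent_type (type_of (Reg_at G \<tau>))"
      using rigid_Reg_at(3)[OF rigid that] ring_type that by (simp add: ring_type_def)
    then show ?thesis
      using rank_one_idempotent[OF rigid_Reg_at(2)[OF rigid that]] rigid_Reg_at(3)[OF rigid that] by metis
  qed
  then show thesis using that by metis
qed

text \<open>A coordinate \<open>\<sigma>\<close> of \<open>e \<tau>\<close> is divisible in the bounded group \<open>\<pi>\<^sub>\<sigma>(G)\<close> by all powers of the primes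
  in \<open>P_inf \<tau>\<close>, so it can be nonzero only if \<open>\<tau> \<le> \<sigma>\<close>.\<close>

lemma e_mem_Reg_at: assumes \<tau>: "\<tau> \<in> T0 G" shows "e \<tau> \<in> Reg_at G \<tau>"
proof -
  obtain f where f: "\<And>\<tau>. \<tau> \<in> T_of G \<Longrightarrow> f \<tau> \<in> Reg_at G \<tau>" "\<And>\<tau>. \<tau> \<in> T_of G \<Longrightarrow> f \<tau> \<noteq> 0"
    "\<And>\<tau>. \<tau> \<in> T_of G \<Longrightarrow> to_hull ` Reg_at G \<tau> = (\<lambda>r. hull_scale r (to_hull (f \<tau>))) ` Rloc (P_inf \<tau>)"
    using Reg_at_generators by metis
  interpret F: frame G "Reg G" "T_of G" "Reg_at G" P_inf f "int (order (quot G (Reg G)))"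
    using f rigid_Reg_at(1)[OF rigid] by (intro frameI) (auto simp: P_inf_def)
  have \<tau>T: "\<tau> \<in> T_of G" using \<tau> T0_subset by blast
  have eG: "e \<tau> \<in> G" using e_mem[OF \<tau>] Reg_at_G1_G[OF \<tau>] G1_pure(1) by blast
  obtain c where c: "to_hull (e \<tau>) = hull_comb (T_of G) f c" "\<And>i. i \<notin> T_of G \<Longrightarrow> c i = 0"
    using F.coordinates[OF eG] by metis
  \<comment> \<open>The rc-basis makes all ring multiples of \<open>e \<tau>\<close> elements of
    \<open>G\<close>; this provides the division by prime powers.\<close>
  have re: "hull_scale r (to_hull (e \<tau>)) \<in> to_hull ` G" if "r \<in> Rloc (P_inf \<tau>)" for r
  proof -
    have "hull_scale r (to_hull (e \<tau>)) \<in> {hull_scale r (to_hull (e \<tau>)) | r. r \<in> R_ring \<tau>}"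
      using that R_ring[OF \<tau>T] by blast
    then have "hull_scale r (to_hull (e \<tau>)) \<in> to_hull ` Reg G1"
      using internal_dsum_component[OF e_dsum \<tau>] by blast
    then show ?thesis using G1.Reg(2) G1_pure(1) by blast
  qed
  have c0: "c \<sigma> = 0" if \<sigma>: "\<sigma> \<in> T_of G" "\<sigma> \<noteq> \<tau>" for \<sigma>
  proof (rule ccontr)
    assume nz: "c \<sigma> \<noteq> 0"
    have "p \<in> P_inf \<sigma>" if p: "p \<in> P_inf \<tau>" for p
    proof (rule Rloc_divisible[OF _ F.N(1) nz])
      show prime: "prime p" using p by (simp add: P_inf_def)
      fix k
      have "hull_comb (T_of G) f (\<lambda>i. 1 / of_nat p ^ k * c i) \<in> to_hull ` G"
        using re[OF Rloc_inverse_power[OF p prime, of k]] by (simp add: c(1) hull_comb_scale)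
      then have "(\<lambda>i. 1 / of_nat p ^ k * c i) \<in> coord_group G (T_of G) f"
        using c(2) by (simp add: coord_group_def)
      from F.bounded[OF this \<sigma>(1)]
      show "of_int (int (order (quot G (Reg G)))) * (c \<sigma> / of_nat p ^ k) \<in> Rloc (P_inf \<sigma>)" by simp
    qed
    then have "P_inf \<tau> \<subseteq> P_inf \<sigma>" by blast
    then have "\<tau> = \<sigma>" by (rule P_inf_incomparable[OF block_rigid ring_type \<tau>T \<sigma>(1)])
    then show False using \<sigma>(2) by simp
  qed
  have "c = single \<tau> (c \<tau>)" using c0 c(2) by (auto simp: fun_eq_iff single_apply)
  then have "to_hull (e \<tau>) = hull_scale (c \<tau>) (to_hull (f \<tau>))"
    using c(1) hull_comb_single[OF F.fin \<tau>T] by metis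
  moreover obtain a b where ab: "c \<tau> = of_int a / of_int b" "b \<noteq> 0" by (rule rational_fraction)
  ultimately have "to_hull (zmul b (e \<tau>)) = to_hull (zmul a (f \<tau>))" by (simp add: to_hull_zmul)
  moreover have "f \<tau> \<in> G" using f(1)[OF \<tau>T] F.XG[OF \<tau>T] by blast
  ultimately have "zmul b (e \<tau>) = zmul a (f \<tau>)"
    using to_hull_eqD[OF G add_subgroup_zmul[OF G(1) eG] add_subgroup_zmul[OF G(1)]] by blast
  \<comment> \<open>Vanishing of the other coordinates places only a nonzero multiple in the
    component; purity then places \<open>e \<tau>\<close> itself there.\<close>
  then have "zmul b (e \<tau>) \<in> Reg_at G \<tau>"
    using add_subgroup_zmul[OF internal_dsum_subgroup[OF F.dsum \<tau>T] f(1)[OF \<tau>T]] by simp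
  then show ?thesis by (rule rigid_Reg_at(4)[OF rigid \<tau>T eG ab(2)])
qed

text \<open>Both inclusions hold up to a nonzero integer, which purity removes: that of
  \<open>G1\<close> in \<open>G\<close> and of its component in \<open>G1\<close> for the first,
  that of the component in \<open>G\<close> for the second.\<close>

lemma Reg_at_eq:
  assumes \<tau>: "\<tau> \<in> T0 G"
  shows "to_hull ` Reg_at G \<tau> = (\<lambda>r. hull_scale r (to_hull (e \<tau>))) ` Rloc (P_inf \<tau>)"
proof (intro equalityI subsetI)
  have \<tau>T: "\<tau> \<in> T_of G" using \<tau> T0_subset by blast
  have XG: "Reg_at G \<tau> \<subseteq> G"
    using internal_dsum_component[OF rigid_Reg_at(1)[OF rigid] \<tau>T] Reg(2) by blast
  have sub: "add_subgroup (Reg_at G \<tau>)" by (rule internal_dsum_subgroup[OF rigid_Reg_at(1)[OF rigid] \<tau>T])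
  {
    fix u assume "u \<in> to_hull ` Reg_at G \<tau>"
    then obtain x where x: "x \<in> Reg_at G \<tau>" "u = to_hull x" by blast
    obtain a b where ab: "b \<noteq> 0" "zmul b x = zmul a (e \<tau>)"
      using rank_one_multiple[OF rigid_Reg_at(2)[OF rigid \<tau>T] e_mem_Reg_at[OF \<tau>] e_nonzero[OF \<tau>] x(1)] .
    have "zmul b x \<in> Reg_at G1 \<tau>"
      unfolding ab(2) by (rule add_subgroup_zmul[OF internal_dsum_subgroup[OF Reg_at_G1_dsum \<tau>] e_mem[OF \<tau>]])
    moreover from this have "x \<in> G1" using G1_pure(2)[of x b] Reg_at_G1_G[OF \<tau>] XG x(1) ab(1) by blast
    ultimately have "x \<in> Reg_at G1 \<tau>"
      using G1.rigid_Reg_at(4)[OF rigid_G1, of \<tau> x b] \<tau> T_of_G1 ab(1) by blast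
    then obtain r where "r \<in> Rloc (P_inf \<tau>)" "to_hull x = hull_scale r (to_hull (e \<tau>))"
      using Reg_at_G1_subset[OF \<tau>] by metis
    then show "u \<in> (\<lambda>r. hull_scale r (to_hull (e \<tau>))) ` Rloc (P_inf \<tau>)" using x(2) by blast
  next
    fix u assume "u \<in> (\<lambda>r. hull_scale r (to_hull (e \<tau>))) ` Rloc (P_inf \<tau>)"
    then obtain r where r: "r \<in> Rloc (P_inf \<tau>)" "u = hull_scale r (to_hull (e \<tau>))" by blast
    then have "u \<in> {hull_scale r (to_hull (e \<tau>)) | r. r \<in> R_ring \<tau>}" using R_ring[OF \<tau>T] by blast
    then have "u \<in> to_hull ` Reg G1" using internal_dsum_component[OF e_dsum \<tau>] by blast
    then obtain g where g: "g \<in> G" "u = to_hull g" using G1.Reg(2) G1_pure(1) by blast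
    obtain a b where ab: "r = of_int a / of_int b" "b \<noteq> 0" by (rule rational_fraction)
    have eG: "e \<tau> \<in> G" using e_mem_Reg_at[OF \<tau>] XG by blast
    have "to_hull (zmul b g) = to_hull (zmul a (e \<tau>))" using ab r(2) g(2) by (simp add: to_hull_zmul)
    then have "zmul b g = zmul a (e \<tau>)"
      using to_hull_eqD[OF G add_subgroup_zmul[OF G(1) g(1)] add_subgroup_zmul[OF G(1) eG]] by blast
    then have "zmul b g \<in> Reg_at G \<tau>" using add_subgroup_zmul[OF sub e_mem_Reg_at[OF \<tau>]] by simp
    then have "g \<in> Reg_at G \<tau>" by (rule rigid_Reg_at(4)[OF rigid \<tau>T g(1) ab(2)])
    then show "u \<in> to_hull ` Reg_at G \<tau>" using g(2) by blast
  }
qed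

end

section \<open>From the standard representation to congruences\<close>

context rigid_setting
begin

text \<open>The rc-basis extended to all of \<open>T_of G\<close>. Off \<open>T0 G\<close>, where
  \<open>d\<close> has no coordinate, any generator of the component serves.\<close>

definition b :: "gtype \<Rightarrow> 'a" where
  "b \<tau> = (if \<tau> \<in> T0 G then e \<tau> else (SOME f. f \<in> Reg_at G \<tau> \<and> f \<noteq> 0 \<and>
     to_hull ` Reg_at G \<tau> = (\<lambda>r. hull_scale r (to_hull f)) ` Rloc (P_inf \<tau>)))"

text \<open>For \<open>\<tau>\<close> outside \<open>T0 G\<close> the coordinate of \<open>d\<close> is \<open>0\<close>; modulo \<open>R\<^sub>\<tau>\<close> it may be written as \<open>1/1\<close>,
  which puts all coordinates on the same footing.\<close>

definition m :: "gtype \<Rightarrow> int" where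
  "m \<tau> = (if \<tau> \<in> T0 G then int (m_of G \<tau>) else 1)"

definition s' :: "gtype \<Rightarrow> int" where
  "s' \<tau> = (if \<tau> \<in> T0 G then s \<tau> else 1)"

lemma b: assumes "\<tau> \<in> T_of G"
  shows "b \<tau> \<in> Reg_at G \<tau> \<and> b \<tau> \<noteq> 0 \<and>
    to_hull ` Reg_at G \<tau> = (\<lambda>r. hull_scale r (to_hull (b \<tau>))) ` Rloc (P_inf \<tau>)"
proof (cases "\<tau> \<in> T0 G")
  case True
  then show ?thesis using e_mem_Reg_at e_nonzero Reg_at_eq by (simp add: b_def)
next
  case False
  have "\<exists>f. f \<in> Reg_at G \<tau> \<and> f \<noteq> 0 \<and>
     to_hull ` Reg_at G \<tau> = (\<lambda>r. hull_scale r (to_hull f)) ` Rloc (P_inf \<tau>)"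
    using Reg_at_generators assms by metis
  from someI_ex[OF this] show ?thesis using False by (simp add: b_def)
qed

sublocale F: frame G "Reg G" "T_of G" "Reg_at G" P_inf b "int (order (quot G (Reg G)))"
  by (rule frameI[OF rigid_Reg_at(1)[OF rigid]]) (use b in \<open>auto simp: P_inf_def\<close>)

lemma std_facts:
  shows "d \<in> G" "generates_mod G (Reg G) d"
    and "to_hull d = (\<Sum>\<tau>\<in>T0 G. hull_scale (of_int (s \<tau>) / of_nat (m_of G \<tau>)) (to_hull (e \<tau>)))"
    and "\<tau> \<in> T0 G \<Longrightarrow> P_number (P_zero \<tau>) (int (m_of G \<tau>))"
    and "\<tau> \<in> T0 G \<Longrightarrow> coprime (s \<tau>) (int (m_of G \<tau>))"
proof -
  show d: "d \<in> G" using std by (auto simp: std_repr_def generates_quot_def)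
  show "generates_mod G (Reg G) d"
    using std by (intro generates_modI[OF G(1) Reg(1,2) d]) (simp add: std_repr_def generates_quot_def)
qed (use std in \<open>auto simp: std_repr_def\<close>)

lemma m_nonzero: "m \<tau> \<noteq> 0"
  using std_facts(4) by (auto simp: m_def P_number_def)

lemma m_coprime:
  assumes "p \<in> P_inf \<tau>" shows "\<not> int p dvd m \<tau>"
proof -
  have p: "prime p" using assms by (simp add: P_inf_def)
  show ?thesis
  proof (cases "\<tau> \<in> T0 G")
    case True
    then show ?thesis using std_facts(4)[OF True] assms p by (auto simp: m_def P_number_def P_zero_def)
  next
    case False
    then show ?thesis using p by (auto simp: m_def)
  qed
qed

lemma s'_coprime: "coprime (s' \<tau>) (m \<tau>)"
  using std_facts(5) by (simp add: s'_def m_def)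

lemma divide_m_iff: "of_int a / of_int (m \<tau>) \<in> Rloc (P_inf \<tau>) \<longleftrightarrow> m \<tau> dvd a"
  by (rule Rloc_divide_iff[OF m_nonzero m_coprime])

definition dc :: "gtype \<Rightarrow> rat" where
  "dc \<tau> = (if \<tau> \<in> T0 G then of_int (s \<tau>) / of_nat (m_of G \<tau>) else 0)"

lemma to_hull_d: "to_hull d = hull_comb (T_of G) b dc"
proof -
  have "(\<Sum>\<tau>\<in>T_of G. hull_scale (dc \<tau>) (to_hull (b \<tau>))) = (\<Sum>\<tau>\<in>T0 G. hull_scale (dc \<tau>) (to_hull (b \<tau>)))"
    by (rule sum.mono_neutral_right[OF F.fin T0_subset]) (simp add: dc_def)
  also have "\<dots> = to_hull d" unfolding std_facts(3) by (rule sum.cong) (simp_all add: dc_def b_def)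
  finally show ?thesis by (simp add: hull_comb_def)
qed

text \<open>Off \<open>T0 G\<close> the two expressions differ by the integer \<open>j\<close>,
  which lies in the ring.\<close>

lemma dc_equiv: "x - of_int j * dc \<tau> \<in> Rloc (P_inf \<tau>) \<longleftrightarrow> x - of_int (j * s' \<tau>) / of_int (m \<tau>) \<in> Rloc (P_inf \<tau>)"
proof (cases "\<tau> \<in> T0 G")
  case False
  have "x \<in> Rloc (P_inf \<tau>) \<longleftrightarrow> x - of_int j \<in> Rloc (P_inf \<tau>)"
    using Rloc_diff[of x "P_inf \<tau>" "of_int j"] Rloc_add[of "x - of_int j" "P_inf \<tau>" "of_int j"] by auto
  then show ?thesis using False by (simp add: dc_def s'_def m_def)
qed (simp add: dc_def s'_def m_def)

text \<open>Every element of \<open>G\<close> is a multiple of \<open>d\<close> plus an element of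
  the regulator; the multiple is the common \<open>k\<close> of \<open>std_group\<close>.\<close>

lemma coord_group_eq: "coord_group G (T_of G) b = std_group (T_of G) P_inf m s'"
proof (intro equalityI subsetI)
  fix c assume "c \<in> coord_group G (T_of G) b"
  then obtain g where c: "\<And>i. i \<notin> T_of G \<Longrightarrow> c i = 0" and g: "g \<in> G" "hull_comb (T_of G) b c = to_hull g"
    by (auto simp: coord_group_def)
  obtain j where j: "g - zmul j d \<in> Reg G" using std_facts(2) g(1) by (auto simp: generates_mod_def)
  have "to_hull (g - zmul j d) = to_hull g - hull_scale (of_int j) (to_hull d)"
    using additive_on.diff[OF additive_to_hull[OF G(1)] g(1) add_subgroup_zmul[OF G(1) std_facts(1)]]
    by (simp add: to_hull_zmul)
  also have "\<dots> = hull_comb (T_of G) b (\<lambda>\<tau>. c \<tau> - of_int j * dc \<tau>)"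
    unfolding g(2)[symmetric] to_hull_d hull_comb_scale
    by (simp add: hull_comb_def hull.scale_left_diff_distrib sum_subtractf)
  finally have "hull_comb (T_of G) b (\<lambda>\<tau>. c \<tau> - of_int j * dc \<tau>) \<in> to_hull ` Reg G" using j by (metis imageI)
  then show "c \<in> std_group (T_of G) P_inf m s'"
    using c by (intro std_groupI[where k = j]) (auto simp: F.mem_A_iff dc_equiv simp del: of_int_mult)
next
  fix c assume c: "c \<in> std_group (T_of G) P_inf m s'"
  obtain j where c0: "\<And>i. i \<notin> T_of G \<Longrightarrow> c i = 0"
    and j: "\<And>i. i \<in> T_of G \<Longrightarrow> c i - of_int (j * s' i) / of_int (m i) \<in> Rloc (P_inf i)"
    using std_groupE[OF c] by metis
  have "hull_comb (T_of G) b (\<lambda>\<tau>. c \<tau> - of_int j * dc \<tau>) \<in> to_hull ` Reg G"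
    using j by (simp add: F.mem_A_iff dc_equiv del: of_int_mult)
  then obtain a where a: "a \<in> Reg G" "hull_comb (T_of G) b (\<lambda>\<tau>. c \<tau> - of_int j * dc \<tau>) = to_hull a" by blast
  have "hull_comb (T_of G) b c = hull_comb (T_of G) b (\<lambda>\<tau>. c \<tau> - of_int j * dc \<tau>) + hull_scale (of_int j) (to_hull d)"
    unfolding to_hull_d hull_comb_scale
    by (simp add: hull_comb_def hull.scale_left_diff_distrib sum_subtractf)
  also have "\<dots> = to_hull (a + zmul j d)" by (simp add: a(2) to_hull_add to_hull_zmul)
  finally have "hull_comb (T_of G) b c \<in> to_hull ` G"
    using add_subgroup_add[OF G(1) _ add_subgroup_zmul[OF G(1) std_facts(1)]] a(1) Reg(2) by blast
  then show "c \<in> coord_group G (T_of G) b" using c0 by (simp add: coord_group_def)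
qed

text \<open>If all other \<open>m \<sigma>\<close> divide \<open>k\<close>, then \<open>G\<close>
  contains the vector with the single coordinate \<open>k * s' \<tau> / m \<tau>\<close>. Purity
  puts it into the component, so the coordinate is in the ring and \<open>m \<tau>\<close> divides
  \<open>k\<close>.\<close>

lemma m_pure:
  assumes \<tau>: "\<tau> \<in> T_of G" and dvd: "\<And>\<sigma>. \<sigma> \<in> T_of G \<Longrightarrow> \<sigma> \<noteq> \<tau> \<Longrightarrow> m \<sigma> dvd k"
  shows "m \<tau> dvd k"
proof -
  define c where "c = single \<tau> (of_int (k * s' \<tau>) / of_int (m \<tau>))"
  have "c \<in> std_group (T_of G) P_inf m s'"
  proof (rule std_groupI)
    fix \<sigma> assume \<sigma>: "\<sigma> \<in> T_of G"
    show "c \<sigma> - of_int (k * s' \<sigma>) / of_int (m \<sigma>) \<in> Rloc (P_inf \<sigma>)"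
    proof (cases "\<sigma> = \<tau>")
      case False
      then have "of_int (k * s' \<sigma>) / of_int (m \<sigma>) \<in> Rloc (P_inf \<sigma>)"
        unfolding divide_m_iff using dvd[OF \<sigma> False] by simp
      from Rloc_minus[OF this] show ?thesis using False by (simp add: c_def single_apply)
    qed (simp add: c_def single_apply)
  qed (use \<tau> in \<open>auto simp: c_def single_apply\<close>)
  then have "c \<in> coord_group G (T_of G) b" by (simp add: coord_group_eq)
  then obtain g where g: "g \<in> G" "hull_comb (T_of G) b c = to_hull g" by (auto simp: coord_group_def)
  have gc: "to_hull g = hull_scale (of_int (k * s' \<tau>) / of_int (m \<tau>)) (to_hull (b \<tau>))"
    unfolding g(2)[symmetric] c_def by (rule hull_comb_single[OF F.fin \<tau>])
  have bG: "b \<tau> \<in> G" using b[OF \<tau>] F.XG[OF \<tau>] by blast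
  have "to_hull (zmul (m \<tau>) g) = to_hull (zmul (k * s' \<tau>) (b \<tau>))"
    using m_nonzero[of \<tau>] by (simp add: to_hull_zmul gc)
  then have "zmul (m \<tau>) g = zmul (k * s' \<tau>) (b \<tau>)"
    using to_hull_eqD[OF G add_subgroup_zmul[OF G(1) g(1)] add_subgroup_zmul[OF G(1) bG]] by blast
  then have "zmul (m \<tau>) g \<in> Reg_at G \<tau>"
    using add_subgroup_zmul[OF internal_dsum_subgroup[OF F.dsum \<tau>]] b[OF \<tau>] by simp
  then have "g \<in> Reg_at G \<tau>" by (rule rigid_Reg_at(4)[OF rigid \<tau> g(1) m_nonzero])
  then have "g \<in> Reg G" by (rule internal_dsum_component[OF F.dsum \<tau>])
  then have "hull_comb (T_of G) b c \<in> to_hull ` Reg G" using g(2) by simp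
  then have "c \<tau> \<in> Rloc (P_inf \<tau>)" using \<tau> by (simp add: F.mem_A_iff)
  then have "m \<tau> dvd k * s' \<tau>" unfolding c_def single_apply if_P[OF refl] divide_m_iff .
  then show ?thesis using s'_coprime[of \<tau>] by (metis coprime_commute coprime_dvd_mult_left_iff)
qed

sublocale std: std_data "T_of G" P_inf m
proof (rule std_data.intro)
  show "\<And>i j. i \<in> T_of G \<Longrightarrow> j \<in> T_of G \<Longrightarrow> P_inf i \<subseteq> P_inf j \<Longrightarrow> i = j"
    by (rule P_inf_incomparable[OF block_rigid ring_type])
  show "\<And>i k. i \<in> T_of G \<Longrightarrow> (\<And>j. j \<in> T_of G \<Longrightarrow> j \<noteq> i \<Longrightarrow> m j dvd k) \<Longrightarrow> m i dvd k"
    by (rule m_pure)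
qed (simp_all add: F.fin F.prime m_nonzero m_coprime)

text \<open>With \<open>t\<close> inverse to \<open>s'\<close> modulo \<open>m\<close>,
  \<open>Bil_iso\<close> and \<open>iso_iff\<close> leave a congruence between \<open>s'\<close> and
  \<open>t\<close>; multiplying by \<open>s'\<close> turns it into one for the square.\<close>

lemma iso_Mult_iff_cong:
  "add_group G \<cong> Mult G \<longleftrightarrow> (\<exists>x y k. \<forall>\<tau>\<in>T0 G. P_number (P_inf \<tau>) (x \<tau>) \<and> P_number (P_inf \<tau>) (y \<tau>) \<and>
     coprime k (int (m_of G \<tau>)) \<and> [y \<tau> * s \<tau> * s \<tau> = k * x \<tau>] (mod int (m_of G \<tau>)))"
proof -
  have "\<forall>\<tau>. \<exists>t. [s' \<tau> * t = 1] (mod m \<tau>)"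
    using cong_solve_coprime_int[OF s'_coprime] by blast
  then obtain t where t: "\<And>\<tau>. [s' \<tau> * t \<tau> = 1] (mod m \<tau>)" by metis
  have t_coprime: "coprime (t \<tau>) (m \<tau>)" for \<tau>
    using t[of \<tau>] by (metis coprime_iff_invertible_int mult.commute)
  have "add_group G \<cong> Mult G \<longleftrightarrow> add_group (std.K s') \<cong> Bil (std.K s')"
    using F.iso_Mult_iff by (simp add: coord_group_eq)
  also have "\<dots> \<longleftrightarrow> add_group (std.K s') \<cong> add_group (std.K t)"
  proof -
    have B: "add_group (std.K t) \<cong> Bil (std.K s')" by (rule std.Bil_iso[OF s'_coprime t])
    have B': "Bil (std.K s') \<cong> add_group (std.K t)"
      by (rule group.iso_sym[OF group_add_group[OF coord_subgroup.subgroup[OF std.coord_subgroup]] B])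
    show ?thesis using iso_trans[OF _ B] iso_trans[OF _ B'] by blast
  qed
  also have "\<dots> \<longleftrightarrow> (\<exists>x y k. \<forall>\<tau>\<in>T_of G. P_number (P_inf \<tau>) (x \<tau>) \<and> P_number (P_inf \<tau>) (y \<tau>) \<and>
       coprime k (m \<tau>) \<and> [y \<tau> * s' \<tau> = k * x \<tau> * t \<tau>] (mod m \<tau>))"
    by (rule std.iso_iff[OF s'_coprime t_coprime])
  also have "\<dots> \<longleftrightarrow> (\<exists>x y k. \<forall>\<tau>\<in>T0 G. P_number (P_inf \<tau>) (x \<tau>) \<and> P_number (P_inf \<tau>) (y \<tau>) \<and>
     coprime k (int (m_of G \<tau>)) \<and> [y \<tau> * s \<tau> * s \<tau> = k * x \<tau>] (mod int (m_of G \<tau>)))" (is "?L \<longleftrightarrow> ?R")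
  proof
    assume ?L
    then obtain x y k where L: "\<And>\<tau>. \<tau> \<in> T_of G \<Longrightarrow> P_number (P_inf \<tau>) (x \<tau>) \<and> P_number (P_inf \<tau>) (y \<tau>) \<and>
       coprime k (m \<tau>) \<and> [y \<tau> * s' \<tau> = k * x \<tau> * t \<tau>] (mod m \<tau>)" by metis
    have "P_number (P_inf \<tau>) (x \<tau>) \<and> P_number (P_inf \<tau>) (y \<tau>) \<and>
     coprime k (int (m_of G \<tau>)) \<and> [y \<tau> * s \<tau> * s \<tau> = k * x \<tau>] (mod int (m_of G \<tau>))"
      if \<tau>: "\<tau> \<in> T0 G" for \<tau>
    proof -
      have L': "P_number (P_inf \<tau>) (x \<tau>)" "P_number (P_inf \<tau>) (y \<tau>)" "coprime k (m \<tau>)"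
        "[y \<tau> * s' \<tau> = k * x \<tau> * t \<tau>] (mod m \<tau>)" using L T0_subset \<tau> by blast+
      have "[y \<tau> * s' \<tau> * s' \<tau> = k * x \<tau> * t \<tau> * s' \<tau>] (mod m \<tau>)"
        by (intro cong_mult L'(4) cong_refl)
      also have "k * x \<tau> * t \<tau> * s' \<tau> = k * x \<tau> * (s' \<tau> * t \<tau>)" by (simp add: ac_simps)
      also have "[k * x \<tau> * (s' \<tau> * t \<tau>) = k * x \<tau> * 1] (mod m \<tau>)"
        by (intro cong_mult t cong_refl)
      finally show ?thesis using L' \<tau> by (simp add: m_def s'_def)
    qed
    then show ?R by blast
  next
    assume ?R
    then obtain x y k where R: "\<And>\<tau>. \<tau> \<in> T0 G \<Longrightarrow> P_number (P_inf \<tau>) (x \<tau>) \<and> P_number (P_inf \<tau>) (y \<tau>) \<and>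
     coprime k (int (m_of G \<tau>)) \<and> [y \<tau> * s \<tau> * s \<tau> = k * x \<tau>] (mod int (m_of G \<tau>))" by metis
    \<comment> \<open>Off \<open>T0 G\<close> the modulus is 1, so the congruence is void and 1, a
      \<open>P\<close>-number for every \<open>P\<close>, will do.\<close>
    define x' where "x' \<tau> = (if \<tau> \<in> T0 G then x \<tau> else 1)" for \<tau>
    define y' where "y' \<tau> = (if \<tau> \<in> T0 G then y \<tau> else 1)" for \<tau>
    have "P_number (P_inf \<tau>) (x' \<tau>) \<and> P_number (P_inf \<tau>) (y' \<tau>) \<and>
       coprime k (m \<tau>) \<and> [y' \<tau> * s' \<tau> = k * x' \<tau> * t \<tau>] (mod m \<tau>)" for \<tau>
    proof (cases "\<tau> \<in> T0 G")
      case True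
      have R': "[y' \<tau> * s' \<tau> * s' \<tau> = k * x' \<tau>] (mod m \<tau>)"
        using R[OF True] True by (simp add: x'_def y'_def s'_def m_def)
      have "[y' \<tau> * s' \<tau> * (s' \<tau> * t \<tau>) = y' \<tau> * s' \<tau> * 1] (mod m \<tau>)"
        by (intro cong_mult t cong_refl)
      then have "[y' \<tau> * s' \<tau> = y' \<tau> * s' \<tau> * s' \<tau> * t \<tau>] (mod m \<tau>)"
        by (simp add: cong_sym_eq ac_simps)
      also have "[y' \<tau> * s' \<tau> * s' \<tau> * t \<tau> = k * x' \<tau> * t \<tau>] (mod m \<tau>)"
        by (intro cong_mult R' cong_refl)
      finally show ?thesis using R[OF True] True by (simp add: x'_def y'_def m_def)
    qed (simp add: x'_def y'_def m_def)
    then show ?L by blast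
  qed
  finally show ?thesis .
qed

lemma m_dvd_order: assumes "\<tau> \<in> T0 G" shows "int (m_of G \<tau>) dvd int (order (quot G (Reg G)))"
proof -
  let ?n = "int (order (quot G (Reg G)))"
  have \<tau>T: "\<tau> \<in> T_of G" using assms T0_subset by blast
  have "hull_comb (T_of G) b (\<lambda>\<tau>. of_int ?n * dc \<tau>) = to_hull (zmul ?n d)"
    by (simp add: to_hull_zmul to_hull_d hull_comb_scale)
  then have "hull_comb (T_of G) b (\<lambda>\<tau>. of_int ?n * dc \<tau>) \<in> to_hull ` Reg G"
    using order_zmul[OF std_facts(1)] by simp
  then have "of_int ?n * dc \<tau> \<in> Rloc (P_inf \<tau>)" using \<tau>T unfolding F.mem_A_iff by blast
  then have "of_int (?n * s \<tau>) / of_int (m \<tau>) \<in> Rloc (P_inf \<tau>)" using assms by (simp add: dc_def m_def)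
  then have "m \<tau> dvd ?n * s \<tau>" unfolding divide_m_iff .
  then show ?thesis using std_facts(5)[OF assms] assms
    by (metis coprime_commute coprime_dvd_mult_left_iff m_def)
qed

text \<open>The product of all the orders carries \<open>d\<close> into the regulator, so it is a
  multiple of the index. This turns coprimality to each modulus into the condition in
  \<open>Gamma\<close>.\<close>

lemma coprime_order:
  assumes "\<And>\<tau>. \<tau> \<in> T0 G \<Longrightarrow> coprime k (int (m_of G \<tau>))"
  shows "coprime k (int (order (quot G (Reg G))))"
proof -
  have fin: "finite (T0 G)" using F.fin T0_subset finite_subset by blast
  define M where "M = (\<Prod>\<tau>\<in>T0 G. int (m_of G \<tau>))"
  have "hull_comb (T_of G) b (\<lambda>\<tau>. of_int M * dc \<tau>) = to_hull (zmul M d)"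
    by (simp add: to_hull_zmul to_hull_d hull_comb_scale)
  moreover have "of_int M * dc \<tau> \<in> Rloc (P_inf \<tau>)" for \<tau>
  proof (cases "\<tau> \<in> T0 G")
    case True
    have "m \<tau> dvd M * s \<tau>" using fin True by (auto simp: M_def m_def intro!: dvd_mult2 dvd_prodI)
    then have "of_int (M * s \<tau>) / of_int (m \<tau>) \<in> Rloc (P_inf \<tau>)" unfolding divide_m_iff .
    then show ?thesis using True by (simp add: dc_def m_def)
  qed (simp add: dc_def)
  ultimately have "to_hull (zmul M d) \<in> to_hull ` Reg G" by (metis F.mem_A_iff)
  then obtain a where a: "a \<in> Reg G" "to_hull (zmul M d) = to_hull a" by blast
  then have "zmul M d = a"
    using to_hull_eqD[OF G add_subgroup_zmul[OF G(1) std_facts(1)]] Reg(2) by blast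
  then have "int (order (quot G (Reg G))) dvd M"
    using zmul_mem_iff_order_dvd(1)[OF G(1) Reg(1,2) std_facts(2) Reg(3), of M] a(1) by simp
  moreover have "coprime k M" unfolding M_def using assms by (intro prod_coprime_right)
  ultimately show ?thesis by (meson coprime_divisors dvd_refl)
qed

end

section \<open>The units of S\<close>

lemma S_elem_mult: "S_elem G a \<otimes>\<^bsub>S_ring G\<^esub> S_elem G c = S_elem G (\<lambda>\<tau>. a \<tau> * c \<tau>)"
  by (auto simp: S_ring_def product_ring_def S_elem_def residue_ring_def mod_mult_eq)

lemma S_elem_eq_iff: "S_elem G a = S_elem G c \<longleftrightarrow> (\<forall>\<tau>\<in>T1 G. [a \<tau> = c \<tau>] (mod int (m_of G \<tau>)))"
  by (auto simp: S_elem_def cong_def fun_eq_iff restrict_def)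

lemma S_elem_carrier: "S_elem G a \<in> carrier (S_ring G)"
  by (auto simp: S_ring_def product_ring_def S_elem_def residue_ring_def T1_def)

lemma S_elem_one: "\<one>\<^bsub>S_ring G\<^esub> = S_elem G (\<lambda>_. 1)"
  by (auto simp: S_ring_def product_ring_def S_elem_def residue_ring_def T1_def)

text \<open>Residues are their own representatives, so laws in \<open>S\<close> reduce to those of
  integer-valued families.\<close>

lemma S_carrier_elem: "x \<in> carrier (S_ring G) \<Longrightarrow> x = S_elem G x"
  by (rule extensionalityI[of _ "T1 G"])
    (auto simp: S_ring_def product_ring_def S_elem_def residue_ring_def PiE_iff)

lemma comm_monoid_S_ring: "comm_monoid (S_ring G)"
proof (rule comm_monoidI)
  fix x y z assume xyz: "x \<in> carrier (S_ring G)" "y \<in> carrier (S_ring G)"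
  show "x \<otimes>\<^bsub>S_ring G\<^esub> y \<in> carrier (S_ring G)"
    using S_carrier_elem[OF xyz(1)] S_carrier_elem[OF xyz(2)] S_elem_mult S_elem_carrier by metis
  have "S_elem G x \<otimes>\<^bsub>S_ring G\<^esub> S_elem G y = S_elem G y \<otimes>\<^bsub>S_ring G\<^esub> S_elem G x"
    by (simp add: S_elem_mult mult.commute)
  then show "x \<otimes>\<^bsub>S_ring G\<^esub> y = y \<otimes>\<^bsub>S_ring G\<^esub> x"
    by (simp flip: S_carrier_elem[OF xyz(1)] S_carrier_elem[OF xyz(2)])
  have "S_elem G (\<lambda>_. 1) \<otimes>\<^bsub>S_ring G\<^esub> S_elem G x = S_elem G x" by (simp add: S_elem_mult)
  then show "\<one>\<^bsub>S_ring G\<^esub> \<otimes>\<^bsub>S_ring G\<^esub> x = x"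
    unfolding S_elem_one by (simp flip: S_carrier_elem[OF xyz(1)])
  assume z: "z \<in> carrier (S_ring G)"
  have "S_elem G x \<otimes>\<^bsub>S_ring G\<^esub> S_elem G y \<otimes>\<^bsub>S_ring G\<^esub> S_elem G z =
    S_elem G x \<otimes>\<^bsub>S_ring G\<^esub> (S_elem G y \<otimes>\<^bsub>S_ring G\<^esub> S_elem G z)"
    by (simp add: S_elem_mult mult.assoc)
  then show "x \<otimes>\<^bsub>S_ring G\<^esub> y \<otimes>\<^bsub>S_ring G\<^esub> z = x \<otimes>\<^bsub>S_ring G\<^esub> (y \<otimes>\<^bsub>S_ring G\<^esub> z)"
    by (simp flip: S_carrier_elem[OF xyz(1)] S_carrier_elem[OF xyz(2)] S_carrier_elem[OF z])
qed (simp add: S_elem_one S_elem_carrier)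

lemma comm_group_S_units: "comm_group (S_units G)"
  unfolding S_units_def by (rule comm_monoid.units_comm_group[OF comm_monoid_S_ring])

lemma S_units_mult: "S_elem G a \<otimes>\<^bsub>S_units G\<^esub> S_elem G c = S_elem G (\<lambda>\<tau>. a \<tau> * c \<tau>)"
  by (simp add: S_units_def units_of_mult S_elem_mult)

lemma S_elem_unit:
  assumes "\<And>\<tau>. \<tau> \<in> T1 G \<Longrightarrow> coprime (a \<tau>) (int (m_of G \<tau>))"
  shows "S_elem G a \<in> carrier (S_units G)"
proof -
  have "\<forall>\<tau>\<in>T1 G. \<exists>t. [a \<tau> * t = 1] (mod int (m_of G \<tau>))"
    using cong_solve_coprime_int assms by blast
  then obtain t where t: "\<And>\<tau>. \<tau> \<in> T1 G \<Longrightarrow> [a \<tau> * t \<tau> = 1] (mod int (m_of G \<tau>))" by metis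
  have "S_elem G a \<otimes>\<^bsub>S_ring G\<^esub> S_elem G t = \<one>\<^bsub>S_ring G\<^esub>" "S_elem G t \<otimes>\<^bsub>S_ring G\<^esub> S_elem G a = \<one>\<^bsub>S_ring G\<^esub>"
    using t by (simp_all add: S_elem_mult S_elem_one S_elem_eq_iff mult.commute)
  then show ?thesis unfolding S_units_def units_of_carrier Units_def using S_elem_carrier by blast
qed

lemma (in comm_group) eq_mult_quotients_iff:
  assumes "a \<in> carrier G" "p \<in> carrier G" "q \<in> carrier G" "r \<in> carrier G" "t \<in> carrier G"
  shows "a = (p \<otimes> inv q) \<otimes> (r \<otimes> inv t) \<longleftrightarrow> a \<otimes> (q \<otimes> t) = p \<otimes> r"
proof -
  have "(p \<otimes> inv q) \<otimes> (r \<otimes> inv t) = (p \<otimes> r) \<otimes> inv (q \<otimes> t)"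
    using assms by (simp add: inv_mult m_ac)
  then show ?thesis using assms inv_solve_right[of a "p \<otimes> r" "q \<otimes> t"] by auto
qed

text \<open>Clearing the two inverses in the unit group leaves integer congruences, with
  \<open>\<alpha>\<close> and \<open>\<beta>\<close> common to all types while \<open>x\<close> and
  \<open>y\<close> vary with the type.\<close>

lemma square_mem_Gamma_V_iff:
  fixes s :: "gtype \<Rightarrow> int"
  defines "n G \<equiv> int (order (quot G (Reg G)))"
  assumes dvd: "\<And>\<tau>. \<tau> \<in> T1 G \<Longrightarrow> int (m_of G \<tau>) dvd n G"
    and P: "\<And>\<tau> x. \<tau> \<in> T1 G \<Longrightarrow> P_number (P_inf \<tau>) x \<Longrightarrow> coprime x (int (m_of G \<tau>))"
    and s: "\<And>\<tau>. \<tau> \<in> T1 G \<Longrightarrow> coprime (s \<tau>) (int (m_of G \<tau>))"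
  shows "S_elem G s [^]\<^bsub>S_units G\<^esub> (2::nat) \<in> Gamma G <#>\<^bsub>S_units G\<^esub> V_inf G \<longleftrightarrow>
    (\<exists>\<alpha> \<beta> x y. coprime \<alpha> (n G) \<and> coprime \<beta> (n G) \<and>
      (\<forall>\<tau>\<in>T1 G. P_number (P_inf \<tau>) (x \<tau>) \<and> P_number (P_inf \<tau>) (y \<tau>)) \<and>
      (\<forall>\<tau>\<in>T1 G. [s \<tau> * s \<tau> * (\<beta> * y \<tau>) = \<alpha> * x \<tau>] (mod int (m_of G \<tau>))))" (is "?L \<longleftrightarrow> ?R")
proof -
  interpret comm_group "S_units G" by (rule comm_group_S_units)
  have sU: "S_elem G s \<in> carrier (S_units G)" by (rule S_elem_unit[OF s])
  have square: "S_elem G s [^]\<^bsub>S_units G\<^esub> (2::nat) = S_elem G (\<lambda>\<tau>. s \<tau> * s \<tau>)"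
    using sU by (simp add: numeral_2_eq_2 S_units_mult)
  have sqU: "S_elem G (\<lambda>\<tau>. s \<tau> * s \<tau>) \<in> carrier (S_units G)"
    using m_closed[OF sU sU] by (simp add: S_units_mult)
  have cU: "S_elem G (\<lambda>_. \<alpha>) \<in> carrier (S_units G)" if "coprime \<alpha> (n G)" for \<alpha>
    using that dvd by (intro S_elem_unit) (meson coprime_divisors dvd_refl)
  have PU: "S_elem G x \<in> carrier (S_units G)" if "\<forall>\<tau>\<in>T1 G. P_number (P_inf \<tau>) (x \<tau>)" for x
    using that P by (intro S_elem_unit) blast
  have iff: "S_elem G (\<lambda>\<tau>. s \<tau> * s \<tau>) =
      (S_elem G (\<lambda>_. \<alpha>) \<otimes>\<^bsub>S_units G\<^esub> inv\<^bsub>S_units G\<^esub> S_elem G (\<lambda>_. \<beta>)) \<otimes>\<^bsub>S_units G\<^esub>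
      (S_elem G x \<otimes>\<^bsub>S_units G\<^esub> inv\<^bsub>S_units G\<^esub> S_elem G y) \<longleftrightarrow>
      (\<forall>\<tau>\<in>T1 G. [s \<tau> * s \<tau> * (\<beta> * y \<tau>) = \<alpha> * x \<tau>] (mod int (m_of G \<tau>)))"
    if "coprime \<alpha> (n G)" "coprime \<beta> (n G)"
      "\<forall>\<tau>\<in>T1 G. P_number (P_inf \<tau>) (x \<tau>) \<and> P_number (P_inf \<tau>) (y \<tau>)" for \<alpha> \<beta> x y
  proof -
    have "S_elem G x \<in> carrier (S_units G)" "S_elem G y \<in> carrier (S_units G)"
      using that(3) by (intro PU; blast)+
    from eq_mult_quotients_iff[OF sqU cU[OF that(1)] cU[OF that(2)] this]
    show ?thesis by (simp add: S_units_mult S_elem_eq_iff)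
  qed
  show ?thesis
  proof
    assume ?L
    then obtain h k where hk: "h \<in> Gamma G" "k \<in> V_inf G" "S_elem G (\<lambda>\<tau>. s \<tau> * s \<tau>) = h \<otimes>\<^bsub>S_units G\<^esub> k"
      unfolding square set_mult_def by blast
    obtain \<alpha> \<beta> where 1: "coprime \<alpha> (n G)" "coprime \<beta> (n G)"
      "h = S_elem G (\<lambda>_. \<alpha>) \<otimes>\<^bsub>S_units G\<^esub> inv\<^bsub>S_units G\<^esub> S_elem G (\<lambda>_. \<beta>)"
      using hk(1) unfolding Gamma_def n_def by blast
    obtain x y where 2: "\<forall>\<tau>\<in>T1 G. P_number (P_inf \<tau>) (x \<tau>) \<and> P_number (P_inf \<tau>) (y \<tau>)"
      "k = S_elem G x \<otimes>\<^bsub>S_units G\<^esub> inv\<^bsub>S_units G\<^esub> S_elem G y"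
      using hk(2) unfolding V_inf_def by blast
    have "\<forall>\<tau>\<in>T1 G. [s \<tau> * s \<tau> * (\<beta> * y \<tau>) = \<alpha> * x \<tau>] (mod int (m_of G \<tau>))"
      using hk(3) unfolding 1(3) 2(2) by (simp only: iff[OF 1(1,2) 2(1)])
    then show ?R using 1(1,2) 2(1) by blast
  next
    assume ?R
    then obtain \<alpha> \<beta> x y where 1: "coprime \<alpha> (n G)" "coprime \<beta> (n G)"
      and 2: "\<forall>\<tau>\<in>T1 G. P_number (P_inf \<tau>) (x \<tau>) \<and> P_number (P_inf \<tau>) (y \<tau>)"
      and 3: "\<forall>\<tau>\<in>T1 G. [s \<tau> * s \<tau> * (\<beta> * y \<tau>) = \<alpha> * x \<tau>] (mod int (m_of G \<tau>))" by blast
    have "S_elem G (\<lambda>_. \<alpha>) \<otimes>\<^bsub>S_units G\<^esub> inv\<^bsub>S_units G\<^esub> S_elem G (\<lambda>_. \<beta>) \<in> Gamma G"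
      unfolding Gamma_def using 1 unfolding n_def by blast
    moreover have "S_elem G x \<otimes>\<^bsub>S_units G\<^esub> inv\<^bsub>S_units G\<^esub> S_elem G y \<in> V_inf G"
      unfolding V_inf_def using 2 by blast
    moreover have "S_elem G (\<lambda>\<tau>. s \<tau> * s \<tau>) =
      (S_elem G (\<lambda>_. \<alpha>) \<otimes>\<^bsub>S_units G\<^esub> inv\<^bsub>S_units G\<^esub> S_elem G (\<lambda>_. \<beta>)) \<otimes>\<^bsub>S_units G\<^esub>
      (S_elem G x \<otimes>\<^bsub>S_units G\<^esub> inv\<^bsub>S_units G\<^esub> S_elem G y)"
      using 3 by (simp only: iff[OF 1 2])
    ultimately show ?L
      unfolding square set_mult_def by blast
  qed
qed

text \<open>The multiplier \<open>k\<close> of an isomorphism plays the role of the quotient of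
  \<open>\<alpha>\<close> by \<open>\<beta>\<close>: a single integer prime to the index represents
  it.\<close>

lemma (in rigid_setting) iso_Mult_iff_square:
  "add_group G \<cong> Mult G \<longleftrightarrow>
    S_elem G s [^]\<^bsub>S_units G\<^esub> (2::nat) \<in> Gamma G <#>\<^bsub>S_units G\<^esub> V_inf G"
proof -
  let ?n = "int (order (quot G (Reg G)))"
  have P: "coprime x (int (m_of G \<tau>))" if "\<tau> \<in> T0 G" "P_number (P_inf \<tau>) x" for \<tau> x
  proof -
    have "coprime (m \<tau>) x" by (rule P_number_coprime[OF that(2) m_nonzero]) (rule m_coprime)
    then show ?thesis using that(1) by (simp add: m_def coprime_commute)
  qed
  have "(\<exists>x y k. \<forall>\<tau>\<in>T0 G. P_number (P_inf \<tau>) (x \<tau>) \<and> P_number (P_inf \<tau>) (y \<tau>) \<and>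
     coprime k (int (m_of G \<tau>)) \<and> [y \<tau> * s \<tau> * s \<tau> = k * x \<tau>] (mod int (m_of G \<tau>))) \<longleftrightarrow>
    (\<exists>\<alpha> \<beta> x y. coprime \<alpha> ?n \<and> coprime \<beta> ?n \<and>
      (\<forall>\<tau>\<in>T0 G. P_number (P_inf \<tau>) (x \<tau>) \<and> P_number (P_inf \<tau>) (y \<tau>)) \<and>
      (\<forall>\<tau>\<in>T0 G. [s \<tau> * s \<tau> * (\<beta> * y \<tau>) = \<alpha> * x \<tau>] (mod int (m_of G \<tau>))))" (is "?L \<longleftrightarrow> ?R")
  proof
    assume ?L
    then obtain x y k where L: "\<forall>\<tau>\<in>T0 G. P_number (P_inf \<tau>) (x \<tau>) \<and> P_number (P_inf \<tau>) (y \<tau>) \<and>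
     coprime k (int (m_of G \<tau>)) \<and> [y \<tau> * s \<tau> * s \<tau> = k * x \<tau>] (mod int (m_of G \<tau>))" by blast
    then have "coprime k ?n" by (intro coprime_order) blast
    then show ?R using L by (intro exI[of _ k] exI[of _ 1] exI[of _ x] exI[of _ y]) (simp add: ac_simps)
  next
    assume ?R
    then obtain \<alpha> \<beta> x y where 1: "coprime \<alpha> ?n" "coprime \<beta> ?n"
      and 2: "\<forall>\<tau>\<in>T0 G. P_number (P_inf \<tau>) (x \<tau>) \<and> P_number (P_inf \<tau>) (y \<tau>)"
      and 3: "\<forall>\<tau>\<in>T0 G. [s \<tau> * s \<tau> * (\<beta> * y \<tau>) = \<alpha> * x \<tau>] (mod int (m_of G \<tau>))" by blast
    \<comment> \<open>Inverting \<open>\<beta>\<close> modulo the index inverts it modulo every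
      \<open>m_of G \<tau>\<close> at once, as these divide the index.\<close>
    obtain \<gamma> where \<gamma>: "[\<beta> * \<gamma> = 1] (mod ?n)" using cong_solve_coprime_int[OF 1(2)] by blast
    then have "coprime \<gamma> ?n" by (metis coprime_iff_invertible_int mult.commute)
    then have \<alpha>\<gamma>: "coprime (\<alpha> * \<gamma>) ?n" using 1(1) by simp
    have "coprime (\<alpha> * \<gamma>) (int (m_of G \<tau>)) \<and> [y \<tau> * s \<tau> * s \<tau> = \<alpha> * \<gamma> * x \<tau>] (mod int (m_of G \<tau>))"
      if \<tau>: "\<tau> \<in> T0 G" for \<tau>
    proof
      show "coprime (\<alpha> * \<gamma>) (int (m_of G \<tau>))"
        using \<alpha>\<gamma> m_dvd_order[OF \<tau>] by (meson coprime_divisors dvd_refl)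
      have \<gamma>': "[\<beta> * \<gamma> = 1] (mod int (m_of G \<tau>))" using \<gamma> m_dvd_order[OF \<tau>] by (rule cong_dvd_modulus)
      have "[y \<tau> * s \<tau> * s \<tau> * 1 = y \<tau> * s \<tau> * s \<tau> * (\<beta> * \<gamma>)] (mod int (m_of G \<tau>))"
        by (intro cong_mult cong_refl cong_sym[OF \<gamma>'])
      also have "y \<tau> * s \<tau> * s \<tau> * (\<beta> * \<gamma>) = (s \<tau> * s \<tau> * (\<beta> * y \<tau>)) * \<gamma>" by (simp add: ac_simps)
      also have "[(s \<tau> * s \<tau> * (\<beta> * y \<tau>)) * \<gamma> = (\<alpha> * x \<tau>) * \<gamma>] (mod int (m_of G \<tau>))"
        using 3 \<tau> cong_refl by (intro cong_mult[of _ "\<alpha> * x \<tau>"]) blast+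
      finally show "[y \<tau> * s \<tau> * s \<tau> = \<alpha> * \<gamma> * x \<tau>] (mod int (m_of G \<tau>))" by (simp add: ac_simps)
    qed
    then show ?L using 2 by (intro exI[of _ x] exI[of _ y] exI[of _ "\<alpha> * \<gamma>"]) blast
  qed
  also have "?R \<longleftrightarrow> S_elem G s [^]\<^bsub>S_units G\<^esub> (2::nat) \<in> Gamma G <#>\<^bsub>S_units G\<^esub> V_inf G"
  proof (rule square_mem_Gamma_V_iff[of G s, unfolded T1_eq, symmetric])
    fix \<tau> assume "\<tau> \<in> T0 G"
    then show "int (m_of G \<tau>) dvd ?n" "coprime (s \<tau>) (int (m_of G \<tau>))"
      "\<And>x. P_number (P_inf \<tau>) x \<Longrightarrow> coprime x (int (m_of G \<tau>))"
      using m_dvd_order std_facts(5) P by blast+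
  qed
  finally show ?thesis unfolding iso_Mult_iff_cong .
qed

theorem theorem4p7:
  fixes G G1 C :: "'a::ab_group_add set"
    and e :: "gtype \<Rightarrow> 'a"
    and d :: 'a
    and s :: "gtype \<Rightarrow> int"
  assumes "class_A0 G"
    and "main_decomp G G1 C"
    and "rc_basis G G1 e"
    and "std_repr G G1 e d s"
  shows "add_group G \<cong> Mult G \<longleftrightarrow>
    rigid G \<and>
    S_elem G s [^]\<^bsub>S_units G\<^esub> (2::nat) \<in> Gamma G <#>\<^bsub>S_units G\<^esub> V_inf G"
proof -
  interpret crq_group G by (rule crq_groupI[OF assms(1)])
  \<comment> \<open>The standard coordinates exist only for a rigid group, so rigidity has to be
    derived before the congruences can be used.\<close>
  have rigid: "rigid G" if "add_group G \<cong> Mult G"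
    using iso_Mult_imp_rigid that assms(1) by (auto simp: class_A0_def)
  have "add_group G \<cong> Mult G \<longleftrightarrow>
    S_elem G s [^]\<^bsub>S_units G\<^esub> (2::nat) \<in> Gamma G <#>\<^bsub>S_units G\<^esub> V_inf G" if "rigid G"
    by (rule rigid_setting.iso_Mult_iff_square[OF rigid_setting.intro[OF assms that]])
  then show ?thesis using rigid by blast
qed

end
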